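(* Let $\lambda>0$ and $\frac{2\lambda}{2\lambda+1}<p\le 1$. There is a constant $c>0$, independent of $F$, such that for every $F=u+iv\in H^p_\lambda(\mathbb{R}^2_+)$ ($u,v$ real-valued), $$\|F\|_{H^p_\lambda(\mathbb{R}^2_+)}\le c\,\|u^*_\nabla\|_{L^p_\lambda}.$$
   Context: Fix $\lambda>0$ and let $\mathbb{R}^2_+=\{(x,y):x\in\mathbb{R},\,y>0\}$. The Dunkl operator in $x$ is $D_xf(x)=f'(x)+\frac{\lambda}{x}[f(x)-f(-x)]$ (with its limiting value $(1+2\lambda)f'(0)$ at $x=0$). A function $F=u+iv$ on $\mathbb{R}^2_+$, with $u,v$ real-valued $C^2$ functions, is called $\lambda$-analytic if $D_xu-\partial_yv=0$ and $\partial_yu+D_xv=0$ on $\mathbb{R}^2_+$. Let $c_\lambda=\big(2^{\lambda+1/2}\Gamma(\lambda+1/2)\big)^{-1}$ and $\|f\|_{L^p_\lambda}=\big(c_\lambda\int_{\mathbb{R}}|f(x)|^p|x|^{2\lambda}dx\big)^{1/p}$. The Hardy space $H^p_\lambda(\mathbb{R}^2_+)$ is the set of $\lambda$-analytic functions $F$ on $\mathbb{R}^2_+$ with $$\|F\|_{H^p_\lambda(\mathbb{R}^2_+)}=\sup_{y>0}\Big(c_\lambda\int_{\mathbb{R}}|F(x,y)|^p|x|^{2\lambda}dx\Big)^{1/p}<\infty .$$ The non-tangential maximal function of $u$ is $u^*_\nabla(x)=\sup_{|s-x|<y}|u(s,y)|$, the supremum being over all $(s,y)\in\mathbb{R}^2_+$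 with $|s-x|<y$. *)

theory Defs
  imports "HOL-Analysis.Analysis"
begin

definition upper_half_plane :: "(real \<times> real) set" where
  "upper_half_plane = {(x, y). y > 0}"

text \<open>Twice continuously differentiable, via Frechet derivatives. Since derivatives are taken in
  the full space (\<open>at z\<close>), this is meant for open \<open>S\<close>.\<close>

definition C2_on ::
  "('a::real_normed_vector \<Rightarrow> 'b::real_normed_vector) \<Rightarrow> 'a set \<Rightarrow> bool" where
  "C2_on f S \<longleftrightarrow>
     (\<exists>(f' :: 'a \<Rightarrow> 'a \<Rightarrow>\<^sub>L 'b) (f'' :: 'a \<Rightarrow> 'a \<Rightarrow>\<^sub>L ('a \<Rightarrow>\<^sub>L 'b)).
        (\<forall>z\<in>S. (f has_derivative blinfun_apply (f' z)) (at z)) \<and>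
        (\<forall>z\<in>S. (f' has_derivative blinfun_apply (f'' z)) (at z)) \<and>
        continuous_on S f'')"

definition dunkl :: "real \<Rightarrow> (real \<Rightarrow> real) \<Rightarrow> real \<Rightarrow> real" where
  "dunkl l f x =
     (if x = 0 then (1 + 2 * l) * deriv f 0
      else deriv f x + l / x * (f x - f (- x)))"

definition lambda_analytic :: "real \<Rightarrow> (real \<times> real \<Rightarrow> complex) \<Rightarrow> bool" where
  "lambda_analytic l F \<longleftrightarrow>
     (let u = (\<lambda>z. Re (F z)); v = (\<lambda>z. Im (F z)) in
       C2_on u upper_half_plane \<and> C2_on v upper_half_plane \<and>
       (\<forall>(x, y) \<in> upper_half_plane.
          dunkl l (\<lambda>s. u (s, y)) x - deriv (\<lambda>t. v (x, t)) y = 0 \<and>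
          deriv (\<lambda>t. u (x, t)) y + dunkl l (\<lambda>s. v (s, y)) x = 0))"

definition c_const :: "real \<Rightarrow> real" where
  "c_const l = inverse (2 powr (l + 1/2) * Gamma (l + 1/2))"

text \<open>Real powers of extended nonnegative reals, meant for exponents \<open>p > 0\<close>.\<close>

definition ennreal_powr :: "ennreal \<Rightarrow> real \<Rightarrow> ennreal" where
  "ennreal_powr a p = (if a = \<infinity> then \<infinity> else ennreal (enn2real a powr p))"

text \<open>The argument is the modulus \<open>|f|\<close>, which may take the value \<open>\<infinity>\<close> (as the maximal
  function below can), and the norm itself may be \<open>\<infinity>\<close>.\<close>

definition Lp_norm :: "real \<Rightarrow> real \<Rightarrow> (real \<Rightarrow> ennreal) \<Rightarrow> ennreal" where
  "Lp_norm l p f =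
     ennreal_powr
       (ennreal (c_const l) *
         (\<integral>\<^sup>+ x. ennreal_powr (f x) p * ennreal (\<bar>x\<bar> powr (2 * l)) \<partial>lborel)) (1 / p)"

definition Hardy_norm :: "real \<Rightarrow> real \<Rightarrow> (real \<times> real \<Rightarrow> complex) \<Rightarrow> ennreal" where
  "Hardy_norm l p F = (SUP y\<in>{0<..}. Lp_norm l p (\<lambda>x. ennreal (cmod (F (x, y)))))"

definition Hardy :: "real \<Rightarrow> real \<Rightarrow> (real \<times> real \<Rightarrow> complex) set" where
  "Hardy l p = {F. lambda_analytic l F \<and> Hardy_norm l p F < \<infinity>}"

definition nt_maximal :: "(real \<times> real \<Rightarrow> real) \<Rightarrow> real \<Rightarrow> ennreal" where
  "nt_maximal u x =
     (SUP z \<in> {(s, y) \<in> upper_half_plane. \<bar>s - x\<bar> < y}. ennreal \<bar>u z\<bar>)"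

end

theory Submission
  imports Defs
begin

text \<open>
  The argument is that of Burkholder, Gundy and Silverstein, with Cauchy's theorem for \<open>F\<^sup>2\<close> replaced by
  a weighted identity. Write \<open>w = \<bar>x\<bar>\<^bsup>2\<lambda>\<^esup>\<close> and mark values at the reflected point \<open>(- x, y)\<close> by a tilde. For
  \<open>F = u + i v\<close> put \<open>A = u\<^sup>2 - v\<^sup>2 + (u~)\<^sup>2 - (v~)\<^sup>2\<close> and \<open>B = 2 u v - 2 u~ v~\<close>. The Cauchy-Riemann system of the
  Dunkl operator implies that \<open>w (B, A)\<close> is divergence free (\<open>divergence_free\<close>). Hence
  \<open>\<integral> w (A - \<psi>' B) dx\<close>, taken along the graph of a function \<open>\<psi>\<close>, is unchanged when the graph is moved
  upwards, and it is \<open>0\<close> if \<open>F\<close> decays enough. If \<open>\<bar>\<psi>'\<bar> \<le> 1\<close>, the term with \<open>B\<close> can be absorbed, and the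
  weighted \<open>L\<^sup>2\<close> norm of \<open>v\<close> on the graph is bounded by that of \<open>u\<close> (\<open>graph_estimate\<close>).

  For \<open>\<alpha> > 0\<close> let \<open>K\<close> be the set where the (symmetrised) maximal function \<open>m\<close> of \<open>u\<close> is at most \<open>\<alpha>\<close>, and let
  \<open>\<psi>\<close> be a smooth function slightly above the distance to \<open>K\<close>. On its graph \<open>\<bar>u\<bar>\<close> is at most \<open>min m \<alpha>\<close>, and over
  \<open>K\<close> the graph is almost horizontal. So \<open>\<integral> w v\<^sup>2\<close> over \<open>K\<close>, at any fixed height, is at most a constant times
  \<open>\<integral> w (min m \<alpha>)\<^sup>2\<close> (\<open>sublevel_estimate\<close>). Integrating against \<open>\<alpha>\<^bsup>p-3\<^esup> d\<alpha>\<close> yields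
  \<open>\<integral> w \<bar>v\<bar>\<^bsup>p\<^esup> \<le> C \<integral> w m\<^bsup>p\<^esup>\<close> (\<open>conjugate_estimate\<close>), and \<open>\<bar>u\<bar> \<le> m\<close> is trivial.

  The decay of \<open>F\<close> is where \<open>F \<in> H\<^sup>p\<close> enters. For a component \<open>f\<close> of \<open>F\<close>, the function \<open>f\<^sup>2 + (f~)\<^sup>2\<close> is subharmonic for
  \<open>\<Delta> + (2\<lambda>/x) \<partial>\<^sub>x\<close>. Weighted averages around points of the axis \<open>x = 0\<close> increase with the radius
  (\<open>bump_mean_mono\<close>); away from the axis an exponential factor removes the drift. Together they give a
  mean value inequality at every scale (\<open>sq_le_ball_mass\<close>), which passes to the power \<open>p/2\<close> by an argument of
  Hardy and Littlewood (\<open>sub_mean_value_power\<close>). Hence \<open>\<bar>f (x, y)\<bar>\<^bsup>p\<^esup>\<close> is at most a constant times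
  \<open>y\<^bsup>-(2\<lambda>+1)\<^esup>\<close>, and \<open>w \<bar>F\<bar>\<^sup>2\<close> is integrable above every positive height.
\<close>

section \<open>Monotone weighted averages of subharmonic functions\<close>

definition csquare :: "real \<Rightarrow> real \<Rightarrow> real \<Rightarrow> (real \<times> real) set" where
  "csquare a b r = {z. z - (a, b) \<in> cbox (- r, - r) (r, r)}"

lemma csquare_iff: "(x, y) \<in> csquare a b r \<longleftrightarrow> \<bar>x - a\<bar> \<le> r \<and> \<bar>y - b\<bar> \<le> r"
  by (auto simp: csquare_def abs_le_iff)

lemma csquare_eq_cbox: "csquare a b r = cbox (a - r, b - r) (a + r, b + r)"
  by (auto simp: csquare_iff)

lemma csquare_sets [measurable]: "csquare a b r \<in> sets borel"
  unfolding csquare_eq_cbox by simp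

lemma csquare_subset_ball:
  assumes "\<bar>x - a\<bar> + \<bar>y - b\<bar> + 2 * r < R"
  shows "csquare x y r \<subseteq> ball (a, b) R"
proof safe
  fix s t assume "(s, t) \<in> csquare x y r"
  then have "\<bar>a - s\<bar> + \<bar>b - t\<bar> < R" using assms by (auto simp: csquare_iff)
  moreover have "dist (a, b) (s, t) \<le> \<bar>a - s\<bar> + \<bar>b - t\<bar>"
    unfolding dist_Pair_Pair dist_real_def by (rule sqrt_sum_squares_le_sum_abs[THEN order_trans]) simp
  ultimately show "(s, t) \<in> ball (a, b) R" by simp
qed

definition bump :: "real \<times> real \<Rightarrow> real" where
  "bump z = max 0 (1 - (fst z)\<^sup>2 - (snd z)\<^sup>2)"

text \<open>The case distinction makes the weight of exponent \<open>0\<close> constant; the power \<open>0 powr 0\<close> is \<open>0\<close>.\<close>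

definition wt :: "real \<Rightarrow> real \<Rightarrow> real" where
  "wt \<mu> x = (if \<mu> = 0 then 1 else \<bar>x\<bar> powr (2 * \<mu>))"

text \<open>The average over the disc of radius \<open>r\<close> around \<open>(a, b)\<close> is rescaled to a fixed square, so that
  the radius occurs only inside \<open>T\<close> and can be differentiated under the integral. The mass of the
  kernel is left unnormalised.\<close>

definition bump_mean :: "real \<Rightarrow> real \<Rightarrow> real \<Rightarrow> (real \<times> real \<Rightarrow> real) \<Rightarrow> real \<Rightarrow> real" where
  "bump_mean \<mu> a b T r =
     integral (cbox (-1, -1) (1, 1)) (\<lambda>z. T (a + r * fst z, b + r * snd z) * (bump z * wt \<mu> (fst z)))"

lemma bump_nonneg: "0 \<le> bump z" and bump_le_1: "bump z \<le> 1"
  by (auto simp: bump_def)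

lemma wt_nonneg: "0 \<le> wt \<mu> x"
  by (auto simp: wt_def)

lemma continuous_on_bump [continuous_intros]:
  "continuous_on A f \<Longrightarrow> continuous_on A (\<lambda>x. bump (f x))"
  unfolding bump_def by (intro continuous_intros)

lemma continuous_on_wt [continuous_intros]:
  assumes "0 \<le> \<mu>" "continuous_on A f"
  shows "continuous_on A (\<lambda>x. wt \<mu> (f x))"
proof (cases "\<mu> = 0")
  case False
  then show ?thesis
    unfolding wt_def using assms by (simp, intro continuous_on_powr' continuous_intros) auto
qed (simp add: wt_def)

lemma DERIV_max_0_square:
  "((\<lambda>t::real. (max 0 t)\<^sup>2) has_real_derivative 2 * max 0 t) (at t)"
proof -
  consider "t > 0" | "t < 0" | "t = 0" by linarith
  then show ?thesis
  proof cases
    case 1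
    have "((\<lambda>t::real. t\<^sup>2) has_real_derivative 2 * max 0 t) (at t)"
      using 1 by (auto intro!: derivative_eq_intros)
    then show ?thesis
      by (rule has_field_derivative_transform_within_open[where S="{0<..}"]) (use 1 in auto)
  next
    case 2
    have "((\<lambda>t::real. 0) has_real_derivative 2 * max 0 t) (at t)"
      using 2 by (auto intro!: derivative_eq_intros)
    then show ?thesis
      by (rule has_field_derivative_transform_within_open[where S="{..<0}"]) (use 2 in auto)
  next
    case 3
    have "((\<lambda>h::real. (max 0 h)\<^sup>2 / h) \<longlongrightarrow> 0) (at 0)"
    proof (rule Lim_null_comparison)
      show "\<forall>\<^sub>F h::real in at 0. norm ((max 0 h)\<^sup>2 / h) \<le> \<bar>h\<bar>"
        by (rule always_eventually) (auto simp: max_def power2_eq_square)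
      show "((\<lambda>h::real. \<bar>h\<bar>) \<longlongrightarrow> 0) (at 0)"
        by (rule tendsto_eq_intros tendsto_rabs_zero)+ auto
    qed
    then show ?thesis
      using 3 by (simp add: DERIV_def)
  qed
qed

lemma DERIV_bump_square_1:
  "((\<lambda>x. (bump (x, y))\<^sup>2 / 4) has_real_derivative - x * bump (x, y)) (at x)"
  unfolding bump_def fst_conv snd_conv
  by (rule derivative_eq_intros DERIV_chain2[OF DERIV_max_0_square] refl)+ auto

lemma DERIV_bump_square_2:
  "((\<lambda>y. (bump (x, y))\<^sup>2 / 4) has_real_derivative - y * bump (x, y)) (at y)"
  unfolding bump_def fst_conv snd_conv
  by (rule derivative_eq_intros DERIV_chain2[OF DERIV_max_0_square] refl)+ auto

lemma DERIV_abs_powr: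
  assumes "x \<noteq> 0"
  shows "((\<lambda>x::real. \<bar>x\<bar> powr a) has_real_derivative a / x * \<bar>x\<bar> powr a) (at x)"
proof (cases "x > 0")
  case True
  have "((\<lambda>x. x powr a) has_real_derivative a / x * \<bar>x\<bar> powr a) (at x)"
    using True by (auto intro!: derivative_eq_intros simp: powr_diff)
  then show ?thesis
    by (rule has_field_derivative_transform_within_open[where S="{0<..}"]) (use True in auto)
next
  case False
  have "((\<lambda>x. (-x) powr a) has_real_derivative a / x * \<bar>x\<bar> powr a) (at x)"
    using False assms by (auto intro!: derivative_eq_intros simp: powr_diff field_simps)
  then show ?thesis
    by (rule has_field_derivative_transform_within_open[where S="{..<0}"]) (use False assms in auto)
qed

lemma DERIV_wt:
  assumes "x \<noteq> 0"
  shows "((wt \<mu>) has_real_derivative 2 * \<mu> / x * wt \<mu> x) (at x)"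
  using DERIV_abs_powr[OF assms, of "2 * \<mu>"] unfolding wt_def
  by (cases "\<mu> = 0") auto

text \<open>The kernel is chosen so that \<open>\<zeta> \<cdot> bump \<zeta> = - \<nabla>K\<close> with \<open>K = bump\<^sup>2 / 4\<close>, a \<open>C\<^sup>1\<close> function that
  vanishes outside the unit disc. Differentiating in the radius therefore produces
  \<open>- \<integral> \<nabla>T \<cdot> \<nabla>K\<close> against the weight, and an integration by parts in each variable turns it into the
  integral of \<open>K\<close> against the weighted Laplacian of \<open>T\<close>, which is nonnegative. Working on a square with a
  compactly supported kernel replaces polar coordinates and the divergence theorem on discs. The
  weight is homogeneous about the centre, which is why its exponent may be positive only if the
  centre lies on the singular line of the operator.\<close>

lemma bump_mean_mono:
  fixes T :: "real \<times> real \<Rightarrow> real"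
  assumes \<mu>: "0 \<le> \<mu>"
    and dT: "\<And>z. z \<in> csquare a b R \<Longrightarrow>
       (T has_derivative (\<lambda>h. Tx z * fst h + Ty z * snd h)) (at z)"
    and d11: "\<And>x y. (x, y) \<in> csquare a b R \<Longrightarrow>
       ((\<lambda>s. Tx (s, y)) has_real_derivative Txx (x, y)) (at x)"
    and d22: "\<And>x y. (x, y) \<in> csquare a b R \<Longrightarrow>
       ((\<lambda>t. Ty (x, t)) has_real_derivative Tyy (x, y)) (at y)"
    and cont: "continuous_on (csquare a b R) Tx" "continuous_on (csquare a b R) Ty"
       "continuous_on (csquare a b R) Tyy"
    and sub: "\<And>x y. (x, y) \<in> csquare a b R \<Longrightarrow> x \<noteq> a \<or> \<mu> = 0 \<Longrightarrow>
       0 \<le> Txx (x, y) + Tyy (x, y) + 2 * \<mu> / (x - a) * Tx (x, y)"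
    and r: "0 \<le> r" "r \<le> r'" "r' \<le> R"
  shows "bump_mean \<mu> a b T r \<le> bump_mean \<mu> a b T r'"
proof (rule DERIV_nonneg_imp_increasing_open[OF r(2)])
  let ?B = "cbox (-1, -1) (1, 1) :: (real \<times> real) set"
  let ?p = "\<lambda>r z. (a + r * fst z, b + r * snd z)"
  let ?k = "\<lambda>z. bump z * wt \<mu> (fst z)"
  define m' where "m' r z = (Tx (?p r z) * fst z + Ty (?p r z) * snd z) * ?k z" for r z
  have inQ: "?p s z \<in> csquare a b R" if "z \<in> ?B" "s \<in> {0..r'}" for s z
  proof -
    have "\<bar>fst z\<bar> \<le> 1" "\<bar>snd z\<bar> \<le> 1" "\<bar>s\<bar> \<le> R"
      using that r by (cases z; auto simp: cbox_Pair_iff)+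
    then have "\<bar>s * fst z\<bar> \<le> R * 1" "\<bar>s * snd z\<bar> \<le> R * 1"
      unfolding abs_mult by (intro mult_mono; auto)+
    then show ?thesis by (auto simp: csquare_iff)
  qed
  have contT: "continuous_on (csquare a b R) T"
    by (rule has_derivative_continuous_on[where f' = "\<lambda>z h. Tx z * fst h + Ty z * snd h"])
       (rule has_derivative_at_withinI, rule dT, simp)
  have cp: "continuous_on ({0..r'} \<times> ?B) (\<lambda>x. g (?p (fst x) (snd x)))"
    if "continuous_on (csquare a b R) g" for g :: "real \<times> real \<Rightarrow> real"
    by (rule continuous_on_compose2[OF that]) (use inQ in \<open>auto intro!: continuous_intros simp: split_beta\<close>)
  have cp1: "continuous_on A (\<lambda>x. g (?p s (f x)))"
    if "continuous_on (csquare a b R) g" "s \<in> {0..r'}" "continuous_on A f" "f ` A \<subseteq> ?B"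
    for g :: "real \<times> real \<Rightarrow> real" and s A and f :: "'c::topological_space \<Rightarrow> real \<times> real"
    by (rule continuous_on_compose2[OF that(1)])
       (use inQ that in \<open>auto intro!: continuous_intros simp: split_beta image_subset_iff\<close>)
  have deriv: "(bump_mean \<mu> a b T has_real_derivative integral ?B (m' s)) (at s within {0..r'})"
    if s: "s \<in> {0..r'}" for s
    unfolding bump_mean_def
  proof (rule leibniz_rule_field_derivative[OF _ _ _ s])
    fix x z assume x: "x \<in> {0..r'}" and z: "z \<in> ?B"
    have "((\<lambda>x. ?p x z) has_derivative (\<lambda>h. (h * fst z, h * snd z))) (at x)"
      by (auto intro!: derivative_eq_intros)
    from has_derivative_compose[OF this dT[OF inQ[OF z x]]]
    have "((\<lambda>x. T (?p x z)) has_real_derivative (Tx (?p x z) * fst z + Ty (?p x z) * snd z)) (at x)"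
      unfolding has_field_derivative_def
      by (rule has_derivative_eq_rhs) (auto simp: algebra_simps)
    then show "((\<lambda>x. T (?p x z) * ?k z) has_real_derivative m' x z) (at x within {0..r'})"
      unfolding m'_def by (intro DERIV_cmult_right) (rule has_field_derivative_at_within)
  next
    fix x assume x: "x \<in> {0..r'}"
    show "(\<lambda>z. T (?p x z) * ?k z) integrable_on ?B"
      by (intro integrable_continuous continuous_intros cp1 \<mu> contT x) auto
  next
    show "continuous_on ({0..r'} \<times> ?B) (\<lambda>(x, z). m' x z)"
      unfolding m'_def split_beta
      by (intro continuous_intros cp \<mu> cont)
  qed auto
  show "continuous_on {r..r'} (bump_mean \<mu> a b T)"
    by (rule continuous_on_subset[of "{0..r'}"], rule DERIV_continuous_on, rule deriv) (use r(1) in auto)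
  fix s assume s: "r < s" "s < r'"
  with r have s0: "s \<in> {0..r'}" "0 < s" by auto
  have "(bump_mean \<mu> a b T has_real_derivative integral ?B (m' s)) (at s)"
    using deriv[OF s0(1)] s s0 by (simp add: at_within_Icc_at)
  moreover have "0 \<le> integral ?B (m' s)"
  proof -
    let ?I = "{-1..1::real}"
    define K where "K z = (bump z)\<^sup>2 / 4" for z
    have contK: "continuous_on A (\<lambda>x. K (f x))" if "continuous_on A f"
      for A and f :: "'c::topological_space \<Rightarrow> real \<times> real"
      unfolding K_def using that by (auto intro!: continuous_intros)
    have K0: "K (x, y) = 0" if "\<bar>x\<bar> = 1 \<or> \<bar>y\<bar> = 1" for x y
      using that by (auto simp: K_def bump_def max_def abs_if split: if_splits)
    have inB: "(x, y) \<in> ?B" if "x \<in> ?I" "y \<in> ?I" for x y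
      using that by (auto simp: cbox_Pair_iff)
    have cpair: "continuous_on A (\<lambda>x. h (?p s (f x, g x)))"
      if "continuous_on (csquare a b R) h" "continuous_on A f" "continuous_on A g"
        "\<And>x. x \<in> A \<Longrightarrow> f x \<in> ?I \<and> g x \<in> ?I"
      for h :: "real \<times> real \<Rightarrow> real" and A and f g :: "'c::topological_space \<Rightarrow> real"
      by (rule cp1[OF that(1) s0(1)]) (use that in \<open>auto intro!: continuous_intros simp: cbox_Pair_iff\<close>)
    note c1 = cpair[OF cont(1)] note c2 = cpair[OF cont(2)] note c3 = cpair[OF cont(3)]
    let ?Tx = "\<lambda>x y. Tx (?p s (x, y))" and ?Ty = "\<lambda>x y. Ty (?p s (x, y))"
      and ?Txx = "\<lambda>x y. Txx (?p s (x, y))" and ?Tyy = "\<lambda>x y. Tyy (?p s (x, y))"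
    have dx: "((\<lambda>x. ?Tx x y) has_real_derivative s * ?Txx x y) (at x)" if "x \<in> ?I" "y \<in> ?I" for x y
    proof -
      have *: "((\<lambda>x. Tx (x, b + s * y)) has_real_derivative Txx (a + s * x, b + s * y)) (at (a + s * x))"
        using inQ[OF inB[OF that] s0(1)] by (intro d11) simp
      have **: "((\<lambda>x. a + s * x) has_real_derivative s) (at x)"
        by (auto intro!: derivative_eq_intros)
      show ?thesis
        using DERIV_chain2[where f = "\<lambda>x. Tx (x, b + s * y)" and g = "\<lambda>x. a + s * x", OF * **]
        by (simp add: mult.commute)
    qed
    have dy: "((\<lambda>y. ?Ty x y) has_real_derivative s * ?Tyy x y) (at y)" if "x \<in> ?I" "y \<in> ?I" for x y
    proof -
      have *: "((\<lambda>y. Ty (a + s * x, y)) has_real_derivative Tyy (a + s * x, b + s * y)) (at (b + s * y))"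
        using inQ[OF inB[OF that] s0(1)] by (intro d22) simp
      have **: "((\<lambda>y. b + s * y) has_real_derivative s) (at y)"
        by (auto intro!: derivative_eq_intros)
      show ?thesis
        using DERIV_chain2[where f = "\<lambda>y. Ty (a + s * x, y)" and g = "\<lambda>y. b + s * y", OF * **]
        by (simp add: mult.commute)
    qed
    define P1 where "P1 x y = ?Tx x y * x * ?k (x, y)" for x y
    define P2 where "P2 x y = ?Ty x y * y * ?k (x, y)" for x y
    define Q1 where "Q1 x y = K (x, y) * wt \<mu> x * (s * ?Txx x y + 2 * \<mu> / x * ?Tx x y)" for x y
    define Q2 where "Q2 x y = K (x, y) * wt \<mu> x * (s * ?Tyy x y)" for x y
    have cP1: "continuous_on A (\<lambda>x. P1 (f x) (g x))"
      if "continuous_on A f" "continuous_on A g" "\<And>x. x \<in> A \<Longrightarrow> f x \<in> ?I \<and> g x \<in> ?I"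
      for A and f g :: "'c::topological_space \<Rightarrow> real"
      unfolding P1_def using that by (intro continuous_intros c1 \<mu>) (auto simp: cbox_Pair_iff)
    have cP2: "continuous_on A (\<lambda>x. P2 (f x) (g x))"
      if "continuous_on A f" "continuous_on A g" "\<And>x. x \<in> A \<Longrightarrow> f x \<in> ?I \<and> g x \<in> ?I"
      for A and f g :: "'c::topological_space \<Rightarrow> real"
      unfolding P2_def using that by (intro continuous_intros c2 \<mu>) (auto simp: cbox_Pair_iff)
    have cQ2: "continuous_on A (\<lambda>x. Q2 (f x) (g x))"
      if "continuous_on A f" "continuous_on A g" "\<And>x. x \<in> A \<Longrightarrow> f x \<in> ?I \<and> g x \<in> ?I"
      for A and f g :: "'c::topological_space \<Rightarrow> real"
      unfolding Q2_def using that by (intro continuous_intros contK c3 \<mu>) (auto simp: cbox_Pair_iff)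
    have I1: "((\<lambda>x. Q1 x y) has_integral integral ?I (\<lambda>x. P1 x y)) ?I" if y: "y \<in> ?I" for y
    proof -
      \<comment> \<open>The derivative may fail to exist on the line where the weight is singular; one exceptional point is harmless.\<close>
      have "((\<lambda>x. - P1 x y + Q1 x y) has_integral
              K (1, y) * wt \<mu> 1 * ?Tx 1 y - K (-1, y) * wt \<mu> (-1) * ?Tx (-1) y) ?I"
      proof (rule fundamental_theorem_of_calculus_interior_strong[where S="{0}"])
        fix x assume x: "x \<in> {-1<..<1} - {0::real}"
        then have xI: "x \<in> ?I" by auto
        have dK: "((\<lambda>x. K (x, y)) has_real_derivative - x * bump (x, y)) (at x)"
          unfolding K_def by (rule DERIV_bump_square_1)
        have dw: "(wt \<mu> has_real_derivative 2 * \<mu> / x * wt \<mu> x) (at x)"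
          by (rule DERIV_wt) (use x in auto)
        have "((\<lambda>x. K (x, y) * wt \<mu> x * ?Tx x y) has_real_derivative - P1 x y + Q1 x y) (at x)"
          by (rule DERIV_cong[OF DERIV_mult[OF DERIV_mult[OF dK dw] dx[OF xI y]]])
             (simp only: P1_def Q1_def fst_conv, simp add: distrib_left distrib_right left_diff_distrib right_diff_distrib mult_ac)
        then show "((\<lambda>x. K (x, y) * wt \<mu> x * ?Tx x y) has_vector_derivative - P1 x y + Q1 x y) (at x)"
          by (simp add: has_real_derivative_iff_has_vector_derivative)
      next
        show "continuous_on ?I (\<lambda>x. K (x, y) * wt \<mu> x * ?Tx x y)"
          using y by (intro continuous_intros contK c1 \<mu>) (auto simp: cbox_Pair_iff)
      qed auto
      then have A: "((\<lambda>x. - P1 x y + Q1 x y) has_integral 0) ?I"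
        by (simp add: K0)
      have "((\<lambda>x. P1 x y) has_integral integral ?I (\<lambda>x. P1 x y)) ?I"
        by (intro integrable_integral integrable_continuous_real cP1 continuous_intros) (use y in auto)
      from has_integral_add[OF A this] show ?thesis by simp
    qed
    have I2: "integral ?I (\<lambda>y. P2 x y) = integral ?I (\<lambda>y. Q2 x y)" if x: "x \<in> ?I" for x
    proof -
      have "((\<lambda>y. - P2 x y + Q2 x y) has_integral
              K (x, 1) * wt \<mu> x * ?Ty x 1 - K (x, -1) * wt \<mu> x * ?Ty x (-1)) ?I"
      proof (rule fundamental_theorem_of_calculus)
        fix y assume y: "y \<in> {-1..1::real}"
        have dK: "((\<lambda>y. K (x, y)) has_real_derivative - y * bump (x, y)) (at y)"
          unfolding K_def by (rule DERIV_bump_square_2)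
        have "((\<lambda>y. K (x, y) * wt \<mu> x * ?Ty x y) has_real_derivative - P2 x y + Q2 x y) (at y)"
          by (rule DERIV_cong[OF DERIV_mult[OF DERIV_cmult_right[OF dK] dy[OF x y]]])
             (simp only: P2_def Q2_def fst_conv, simp add: mult_ac)
        then show "((\<lambda>y. K (x, y) * wt \<mu> x * ?Ty x y) has_vector_derivative - P2 x y + Q2 x y) (at y within ?I)"
          by (rule has_vector_derivative_at_within[OF iffD1[OF has_real_derivative_iff_has_vector_derivative]])
      qed auto
      then have "integral ?I (\<lambda>y. - P2 x y + Q2 x y) = 0"
        by (simp add: K0 integral_unique)
      moreover have "integral ?I (\<lambda>y. - P2 x y + Q2 x y) = integral ?I (\<lambda>y. - P2 x y) + integral ?I (\<lambda>y. Q2 x y)"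
        by (intro integral_add integrable_continuous_real continuous_intros cP2 cQ2) (use x in auto)
      ultimately show ?thesis by simp
    qed
    have swap: "integral ?I (\<lambda>x. integral ?I (\<lambda>y. g x y)) = integral ?I (\<lambda>y. integral ?I (\<lambda>x. g x y))"
      if "continuous_on ?B (\<lambda>z. g (fst z) (snd z))" for g :: "real \<Rightarrow> real \<Rightarrow> real"
      using integral_swap_continuous[of "-1" "-1" 1 1 g] that by (simp add: split_beta)
    have iter: "integral ?B (\<lambda>z. g (fst z) (snd z)) = integral ?I (\<lambda>x. integral ?I (\<lambda>y. g x y))"
      if "continuous_on ?B (\<lambda>z. g (fst z) (snd z))" for g :: "real \<Rightarrow> real \<Rightarrow> real"
      using integral_integrable_2dim integral_prod_continuous[of "-1" "-1" 1 1 "\<lambda>z. g (fst z) (snd z)"] that by simp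
    have cB: "continuous_on ?B (\<lambda>z. P1 (fst z) (snd z))" "continuous_on ?B (\<lambda>z. P2 (fst z) (snd z))"
       "continuous_on ?B (\<lambda>z. Q2 (fst z) (snd z))"
      by (intro cP1 cP2 cQ2 continuous_intros; auto simp: cbox_Pair_iff)+
    have intiter: "(\<lambda>y. integral ?I (\<lambda>x. g x y)) integrable_on ?I"
      if "continuous_on ?B (\<lambda>z. g (fst z) (snd z))" for g :: "real \<Rightarrow> real \<Rightarrow> real"
    proof -
      have "continuous_on (cbox (-1) 1) (\<lambda>y. integral (cbox (-1) 1) (\<lambda>x. g x y))"
        by (rule integral_continuous_on_param, unfold split_beta,
            rule continuous_on_compose2[OF that, of _ "\<lambda>p. (snd p, fst p)", simplified])
           (auto intro!: continuous_intros)
      then show ?thesis by (simp add: integrable_continuous_real)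
    qed
    have "integral ?B (m' s) = integral ?B (\<lambda>z. P1 (fst z) (snd z) + P2 (fst z) (snd z))"
      by (intro integral_cong) (auto simp: m'_def P1_def P2_def algebra_simps)
    also have "\<dots> = integral ?B (\<lambda>z. P1 (fst z) (snd z)) + integral ?B (\<lambda>z. P2 (fst z) (snd z))"
      by (intro integral_add integrable_continuous cB)
    also have "integral ?B (\<lambda>z. P1 (fst z) (snd z)) = integral ?I (\<lambda>y. integral ?I (\<lambda>x. P1 x y))"
      by (simp add: iter[OF cB(1)] swap[OF cB(1)])
    also have "integral ?B (\<lambda>z. P2 (fst z) (snd z)) = integral ?I (\<lambda>x. integral ?I (\<lambda>y. Q2 x y))"
      unfolding iter[OF cB(2)] by (intro integral_cong I2)
    also have "\<dots> = integral ?I (\<lambda>y. integral ?I (\<lambda>x. Q2 x y))"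
      by (rule swap[OF cB(3)])
    also have "integral ?I (\<lambda>y. integral ?I (\<lambda>x. P1 x y)) + \<dots>
        = integral ?I (\<lambda>y. integral ?I (\<lambda>x. P1 x y) + integral ?I (\<lambda>x. Q2 x y))"
      by (intro integral_add[symmetric] intiter cB)
    also have "\<dots> \<ge> 0"
    proof (rule integral_nonneg)
      show "(\<lambda>y. integral ?I (\<lambda>x. P1 x y) + integral ?I (\<lambda>x. Q2 x y)) integrable_on ?I"
        by (intro integrable_add intiter cB)
      fix y assume y: "y \<in> ?I"
      have "((\<lambda>x. Q2 x y) has_integral integral ?I (\<lambda>x. Q2 x y)) ?I"
        by (intro integrable_integral integrable_continuous_real cQ2 continuous_intros) (use y in auto)
      from has_integral_add[OF I1[OF y] this]
      show "0 \<le> integral ?I (\<lambda>x. P1 x y) + integral ?I (\<lambda>x. Q2 x y)"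
      proof (rule has_integral_nonneg)
        fix x assume x: "x \<in> ?I"
        define D where "D = 2 * \<mu> / (s * x)"
        have "2 * \<mu> / x = s * D"
          using s0 by (simp add: D_def)
        then have "Q1 x y + Q2 x y = K (x, y) * s * (wt \<mu> x * (?Txx x y + ?Tyy x y + D * ?Tx x y))"
          unfolding Q1_def Q2_def by (simp add: distrib_left distrib_right left_diff_distrib right_diff_distrib mult_ac)
        then have eq: "Q1 x y + Q2 x y = K (x, y) * s *
           (wt \<mu> x * (?Txx x y + ?Tyy x y + 2 * \<mu> / (s * x) * ?Tx x y))"
          by (simp only: D_def)
        have "0 \<le> wt \<mu> x * (?Txx x y + ?Tyy x y + 2 * \<mu> / (s * x) * ?Tx x y)"
        proof (cases "x = 0 \<and> \<mu> \<noteq> 0")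
          case False
          then show ?thesis
            using sub[of "a + s * x" "b + s * y"] inQ[OF inB[OF x y] s0(1)] s0
            by (intro mult_nonneg_nonneg wt_nonneg) auto
        qed (simp add: wt_def)
        moreover have "0 \<le> K (x, y) * s"
          using s0 by (simp add: K_def)
        ultimately show "0 \<le> Q1 x y + Q2 x y"
          unfolding eq by (rule mult_nonneg_nonneg[rotated])
      qed
    qed
    finally show ?thesis .
  qed
  ultimately show "\<exists>y. (bump_mean \<mu> a b T has_real_derivative y) (at s) \<and> 0 \<le> y"
    by blast
qed

section \<open>Squares of Dunkl-harmonic functions\<close>

lemma measurable_csquare:
  fixes g :: "real \<times> real \<Rightarrow> real"
  assumes "continuous_on (csquare a b r) g"
  shows "(\<lambda>z. ennreal (g z) * indicator (csquare a b r) z) \<in> borel_measurable borel"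
proof -
  have "(\<lambda>z. indicator (csquare a b r) z *\<^sub>R g z) \<in> borel_measurable borel"
    by (rule borel_measurable_continuous_on_indicator[OF csquare_sets assms])
  then have "(\<lambda>z. ennreal (indicator (csquare a b r) z *\<^sub>R g z)) \<in> borel_measurable borel"
    by measurable
  also have "(\<lambda>z. ennreal (indicator (csquare a b r) z *\<^sub>R g z))
      = (\<lambda>z. ennreal (g z) * indicator (csquare a b r) z)"
    by (auto simp: indicator_def)
  finally show ?thesis .
qed

text \<open>The rescaled averages are Henstock-Kurzweil integrals, whereas all mass estimates are phrased with
  nonnegative Lebesgue integrals; this is the bridge between the two.\<close>

lemma integral_rescale_csquare:
  fixes g :: "real \<times> real \<Rightarrow> real"
  assumes r: "0 < r" and cont: "continuous_on (csquare a b r) g"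
    and nonneg: "\<And>z. z \<in> csquare a b r \<Longrightarrow> 0 \<le> g z"
  shows "ennreal (r\<^sup>2) * ennreal (integral (cbox (-1, -1) (1, 1)) (\<lambda>z. g (a + r * fst z, b + r * snd z)))
       = (\<integral>\<^sup>+z. ennreal (g z) * indicator (csquare a b r) z \<partial>lborel)"
proof -
  let ?B = "cbox (-1, -1) (1, 1) :: (real \<times> real) set"
  let ?p = "\<lambda>z. (a + r * fst z, b + r * snd z)"
  define G where "G z = ennreal (g z) * indicator (csquare a b r) z" for z
  have inB: "?p z \<in> csquare a b r \<longleftrightarrow> z \<in> ?B" for z
  proof -
    have "\<bar>r * t\<bar> \<le> r \<longleftrightarrow> \<bar>t\<bar> \<le> 1" for t
      using r by (simp add: abs_mult)
    then show ?thesis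
      by (cases z) (auto simp: csquare_iff abs_le_iff)
  qed
  have G [measurable]: "G \<in> borel_measurable borel"
    unfolding G_def[abs_def] by (rule measurable_csquare[OF cont])
  have "continuous_on ?B (\<lambda>z. g (?p z))"
    by (rule continuous_on_compose2[OF cont]) (use inB in \<open>auto intro!: continuous_intros\<close>)
  then have "((\<lambda>z. g (?p z)) has_integral integral ?B (\<lambda>z. g (?p z))) ?B"
    by (intro integrable_integral integrable_continuous)
  then have "ennreal (integral ?B (\<lambda>z. g (?p z))) = (\<integral>\<^sup>+z. ennreal (g (?p z)) * indicator ?B z \<partial>lborel)"
    by (rule nn_integral_has_integral_lebesgue'[symmetric, rotated]) (use inB nonneg in auto)
  also have "\<dots> = (\<integral>\<^sup>+z. G (?p z) \<partial>lborel)"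
    unfolding G_def by (intro nn_integral_cong) (simp add: inB indicator_def)
  finally have I: "ennreal (integral ?B (\<lambda>z. g (?p z))) = (\<integral>\<^sup>+z. G (?p z) \<partial>lborel)" .
  have "(\<integral>\<^sup>+z. G z \<partial>lborel)
      = (\<integral>\<^sup>+z. G z \<partial>density (distr lborel borel (\<lambda>x. (a, b) + r *\<^sub>R x)) (\<lambda>_. ennreal (\<bar>r\<bar> ^ DIM(real \<times> real))))"
    using r by (subst lborel_affine[of r "(a, b)"]) auto
  also have "\<dots> = ennreal (r\<^sup>2) * (\<integral>\<^sup>+z. G ((a, b) + r *\<^sub>R z) \<partial>lborel)"
    using r by (simp add: nn_integral_density nn_integral_distr nn_integral_cmult power2_eq_square)
  also have "(\<lambda>z. G ((a, b) + r *\<^sub>R z)) = (\<lambda>z. G (?p z))"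
    by (auto simp: fun_eq_iff)
  finally show ?thesis
    by (simp add: I G_def)
qed

lemma has_derivative_imp_partial:
  fixes g :: "real \<times> real \<Rightarrow> real"
  assumes "(g has_derivative (\<lambda>h. a * fst h + b * snd h)) (at (x, y))"
  shows has_derivative_imp_partial_x: "((\<lambda>s. g (s, y)) has_real_derivative a) (at x)"
    and has_derivative_imp_partial_y: "((\<lambda>t. g (x, t)) has_real_derivative b) (at y)"
proof -
  have "((\<lambda>s. (s, y)) has_derivative (\<lambda>h. (h, 0))) (at x)" "((\<lambda>t. (x, t)) has_derivative (\<lambda>h. (0, h))) (at y)"
    by (auto intro!: derivative_eq_intros)
  from this[THEN has_derivative_compose, OF assms]
  show "((\<lambda>s. g (s, y)) has_real_derivative a) (at x)" "((\<lambda>t. g (x, t)) has_real_derivative b) (at y)"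
    by (simp_all add: has_field_derivative_def mult_commute_abs)
qed

locale C2_half_plane =
  fixes f fx fy fxx fyy fxy :: "real \<times> real \<Rightarrow> real"
  assumes has_deriv: "\<And>x y. 0 < y \<Longrightarrow> (f has_derivative (\<lambda>h. fx (x, y) * fst h + fy (x, y) * snd h)) (at (x, y))"
    and has_dx: "\<And>x y. 0 < y \<Longrightarrow> ((\<lambda>s. f (s, y)) has_real_derivative fx (x, y)) (at x)"
    and has_dy: "\<And>x y. 0 < y \<Longrightarrow> ((\<lambda>t. f (x, t)) has_real_derivative fy (x, y)) (at y)"
    and has_dxx: "\<And>x y. 0 < y \<Longrightarrow> ((\<lambda>s. fx (s, y)) has_real_derivative fxx (x, y)) (at x)"
    and has_dyy: "\<And>x y. 0 < y \<Longrightarrow> ((\<lambda>t. fy (x, t)) has_real_derivative fyy (x, y)) (at y)"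
    and has_dxy: "\<And>x y. 0 < y \<Longrightarrow> ((\<lambda>t. fx (x, t)) has_real_derivative fxy (x, y)) (at y)"
    and has_dyx: "\<And>x y. 0 < y \<Longrightarrow> ((\<lambda>s. fy (s, y)) has_real_derivative fxy (x, y)) (at x)"
    and cont_fx: "continuous_on upper_half_plane fx"
    and cont_fy: "continuous_on upper_half_plane fy"
    and cont_fyy: "continuous_on upper_half_plane fyy"

text \<open>The equation is \<open>D\<^sub>x\<^sup>2 f + \<partial>\<^sub>y\<^sup>2 f = 0\<close> written out away from the axis \<open>x = 0\<close>.\<close>

locale dunkl_harmonic = C2_half_plane f fx fy fxx fyy fxy
  for l :: real and f fx fy fxx fyy fxy +
  assumes l_pos: "0 < l"
    and laplace: "\<And>x y. 0 < y \<Longrightarrow> x \<noteq> 0 \<Longrightarrow>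
      fxx (x, y) + fyy (x, y) + 2 * l / x * fx (x, y) = l / x\<^sup>2 * (f (x, y) - f (- x, y))"
begin

text \<open>Adding the square of the reflected function makes the nonlocal term of the Dunkl Laplacian into a
  square, so that the sum is subharmonic for the local operator \<open>\<Delta> + (2l/x) \<partial>\<^sub>x\<close>.\<close>

definition sq :: "real \<times> real \<Rightarrow> real" where
  "sq z = (f z)\<^sup>2 + (f (- fst z, snd z))\<^sup>2"

definition sq_x :: "real \<times> real \<Rightarrow> real" where
  "sq_x z = 2 * f z * fx z - 2 * f (- fst z, snd z) * fx (- fst z, snd z)"

definition sq_y :: "real \<times> real \<Rightarrow> real" where
  "sq_y z = 2 * f z * fy z + 2 * f (- fst z, snd z) * fy (- fst z, snd z)"

definition sq_xx :: "real \<times> real \<Rightarrow> real" where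
  "sq_xx z = 2 * (fx z)\<^sup>2 + 2 * f z * fxx z
     + 2 * (fx (- fst z, snd z))\<^sup>2 + 2 * f (- fst z, snd z) * fxx (- fst z, snd z)"

definition sq_yy :: "real \<times> real \<Rightarrow> real" where
  "sq_yy z = 2 * (fy z)\<^sup>2 + 2 * f z * fyy z
     + 2 * (fy (- fst z, snd z))\<^sup>2 + 2 * f (- fst z, snd z) * fyy (- fst z, snd z)"

lemma sq_nonneg: "0 \<le> sq z"
  by (simp add: sq_def)

lemma cont_f: "continuous_on upper_half_plane f"
  by (rule has_derivative_continuous_on[where f' = "\<lambda>z h. fx z * fst h + fy z * snd h"])
     (auto simp: upper_half_plane_def intro: has_derivative_at_withinI has_deriv)

lemma continuous_on_reflect:
  assumes "continuous_on upper_half_plane g"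
  shows "continuous_on upper_half_plane (\<lambda>z. g (- fst z, snd z))"
  by (rule continuous_on_compose2[OF assms])
     (auto intro!: continuous_intros simp: upper_half_plane_def)

lemmas cont_reflected = cont_f cont_fx cont_fy cont_fyy
  cont_f[THEN continuous_on_reflect] cont_fx[THEN continuous_on_reflect]
  cont_fy[THEN continuous_on_reflect] cont_fyy[THEN continuous_on_reflect]

lemma continuous_on_sq: "continuous_on upper_half_plane sq"
  and continuous_on_sq_x: "continuous_on upper_half_plane sq_x"
  and continuous_on_sq_y: "continuous_on upper_half_plane sq_y"
  and continuous_on_sq_yy: "continuous_on upper_half_plane sq_yy"
  unfolding sq_def sq_x_def sq_y_def sq_yy_def
  by (intro continuous_intros cont_reflected)+

lemma has_deriv_reflect:
  assumes y: "0 < y"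
  shows "((\<lambda>z. f (- fst z, snd z)) has_derivative
    (\<lambda>h. fx (- x, y) * - fst h + fy (- x, y) * snd h)) (at (x, y))"
proof -
  have "((\<lambda>z. (- fst z, snd z)) has_derivative (\<lambda>h. (- fst h, snd h))) (at (x, y))"
    by (auto intro!: derivative_eq_intros)
  then show ?thesis
    by (rule has_derivative_compose[where g=f, THEN has_derivative_eq_rhs])
       (use has_deriv[OF y] in \<open>auto\<close>)
qed

lemma has_deriv_sq:
  assumes y: "0 < y"
  shows "(sq has_derivative (\<lambda>h. sq_x (x, y) * fst h + sq_y (x, y) * snd h)) (at (x, y))"
  using has_derivative_add[OF has_derivative_power[OF has_deriv[OF y], of 2]
      has_derivative_power[OF has_deriv_reflect[OF y], of 2]]
  unfolding sq_def[abs_def]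
  by (rule has_derivative_eq_rhs) (auto simp: sq_x_def sq_y_def algebra_simps)

lemma DERIV_reflect:
  assumes "\<And>x. ((\<lambda>s. g (s, y)) has_real_derivative g' (x, y)) (at x)"
  shows "((\<lambda>s. g (- s, y)) has_real_derivative - g' (- x, y)) (at x)"
  using DERIV_mirror[of "\<lambda>s. g (s, y)" "g' (- x, y)" x] assms[of "- x"] by simp

lemma has_dxx_sq:
  assumes y: "0 < y"
  shows "((\<lambda>s. sq_x (s, y)) has_real_derivative sq_xx (x, y)) (at x)"
proof -
  note 1 = has_dx[OF y, of x] and 2 = has_dxx[OF y, of x]
    and 3 = DERIV_reflect[where g=f and g'=fx, OF has_dx[OF y], of x]
    and 4 = DERIV_reflect[where g=fx and g'=fxx, OF has_dxx[OF y], of x]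
  from DERIV_diff[OF DERIV_mult[OF DERIV_cmult[OF 1, of 2] 2] DERIV_mult[OF DERIV_cmult[OF 3, of 2] 4]]
  show ?thesis unfolding sq_x_def fst_conv snd_conv
    by (rule DERIV_cong) (simp add: sq_xx_def power2_eq_square algebra_simps)
qed

lemma has_dyy_sq:
  assumes y: "0 < y"
  shows "((\<lambda>t. sq_y (x, t)) has_real_derivative sq_yy (x, y)) (at y)"
proof -
  note 1 = has_dy[OF y, of x] and 2 = has_dyy[OF y, of x]
    and 3 = has_dy[OF y, of "- x"] and 4 = has_dyy[OF y, of "- x"]
  from DERIV_add[OF DERIV_mult[OF DERIV_cmult[OF 1, of 2] 2] DERIV_mult[OF DERIV_cmult[OF 3, of 2] 4]]
  show ?thesis unfolding sq_y_def fst_conv snd_conv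
    by (rule DERIV_cong) (simp add: sq_yy_def power2_eq_square algebra_simps)
qed

lemma laplace_sq:
  assumes y: "0 < y" and x: "x \<noteq> 0"
  shows "sq_xx (x, y) + sq_yy (x, y) + 2 * l / x * sq_x (x, y)
    = 2 * ((fx (x, y))\<^sup>2 + (fy (x, y))\<^sup>2 + (fx (- x, y))\<^sup>2 + (fy (- x, y))\<^sup>2)
      + 2 * l / x\<^sup>2 * (f (x, y) - f (- x, y))\<^sup>2"
proof -
  define A where "A = 2 * l / x"
  define B where "B = l / x\<^sup>2"
  have 1: "fyy (x, y) = B * (f (x, y) - f (- x, y)) - fxx (x, y) - A * fx (x, y)"
    using laplace[OF y x] by (simp add: A_def B_def)
  have 2: "fyy (- x, y) = B * (f (- x, y) - f (x, y)) - fxx (- x, y) + A * fx (- x, y)"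
    using laplace[OF y, of "- x"] x by (simp add: A_def B_def)
  have "sq_xx (x, y) + sq_yy (x, y) + A * sq_x (x, y)
    = 2 * ((fx (x, y))\<^sup>2 + (fy (x, y))\<^sup>2 + (fx (- x, y))\<^sup>2 + (fy (- x, y))\<^sup>2)
      + 2 * B * (f (x, y) - f (- x, y))\<^sup>2"
    unfolding sq_xx_def sq_yy_def sq_x_def fst_conv snd_conv 1 2
    by (simp add: power2_eq_square algebra_simps)
  then show ?thesis by (simp add: A_def B_def)
qed

lemma bump_mean_sq_axis_mono:
  assumes "0 \<le> r" "r \<le> r'" "r' < b"
  shows "bump_mean l 0 b sq r \<le> bump_mean l 0 b sq r'"
proof (rule bump_mean_mono[where R = r' and Tx = sq_x and Ty = sq_y and Txx = sq_xx and Tyy = sq_yy])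
  have sub: "csquare 0 b r' \<subseteq> upper_half_plane"
    using assms by (auto simp: upper_half_plane_def csquare_iff)
  show "continuous_on (csquare 0 b r') sq_x"
    "continuous_on (csquare 0 b r') sq_y"
    "continuous_on (csquare 0 b r') sq_yy"
    by (rule continuous_on_subset[OF _ sub], rule continuous_on_sq_x continuous_on_sq_y continuous_on_sq_yy)+
  have pos: "0 < y" if "(x, y) \<in> csquare 0 b r'" for x y
    using that assms by (auto simp: csquare_iff)
  show "(sq has_derivative (\<lambda>h. sq_x z * fst h + sq_y z * snd h)) (at z)"
    if "z \<in> csquare 0 b r'" for z
    using has_deriv_sq pos that by (cases z) auto
  show "((\<lambda>s. sq_x (s, y)) has_real_derivative sq_xx (x, y)) (at x)"
    "((\<lambda>t. sq_y (x, t)) has_real_derivative sq_yy (x, y)) (at y)"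
    if "(x, y) \<in> csquare 0 b r'" for x y
    using has_dxx_sq has_dyy_sq pos[OF that] by auto
  show "0 \<le> sq_xx (x, y) + sq_yy (x, y) + 2 * l / (x - 0) * sq_x (x, y)"
    if "(x, y) \<in> csquare 0 b r'" "x \<noteq> 0 \<or> l = 0" for x y
    using laplace_sq[OF pos[OF that(1)], of x] that(2) l_pos by simp
qed (use assms l_pos in auto)

text \<open>Off the axis, the drift \<open>(2l/x) \<partial>\<^sub>x\<close> is removed by the factor \<open>exp (k x)\<close>. With \<open>k = l/a\<close> the drift cancels
  exactly at the centre \<open>a\<close>; for \<open>x\<close> within \<open>\<bar>a\<bar>/3\<close> of \<open>a\<close> the remainder is absorbed by the gradient
  term and by \<open>k\<^sup>2\<close>, after completing the square. The asserted sign is that of the ordinary Laplacian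
  of \<open>exp (k x) sq\<close>.\<close>

lemma exp_sq_subharmonic:
  assumes y: "0 < y" and a: "a \<noteq> 0" and x: "\<bar>x - a\<bar> \<le> \<bar>a\<bar> / 3"
  defines "k \<equiv> l / a"
  shows "0 \<le> k\<^sup>2 * sq (x, y) + 2 * k * sq_x (x, y) + sq_xx (x, y) + sq_yy (x, y)"
proof -
  have x0: "x \<noteq> 0" using x a by auto
  define d where "d = k - l / x"
  have q: "\<bar>1 - a / x\<bar> \<le> 1 / 2"
  proof -
    have "\<bar>x\<bar> \<ge> 2 / 3 * \<bar>a\<bar>" using x by linarith
    then have "\<bar>x - a\<bar> \<le> \<bar>x\<bar> / 2" using x by linarith
    moreover have "1 - a / x = (x - a) / x" using x0 by (simp add: field_simps)
    ultimately show ?thesis using x0 by (simp add: abs_divide field_simps)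
  qed
  have "d = k * (1 - a / x)"
    using x0 a by (simp add: d_def k_def field_simps)
  then have "d\<^sup>2 = k\<^sup>2 * (1 - a / x)\<^sup>2" by (simp add: power_mult_distrib)
  also have "\<dots> \<le> k\<^sup>2 * (1 / 2)\<^sup>2"
    using q by (intro mult_left_mono) (auto simp: abs_le_square_iff[symmetric])
  finally have d2: "d\<^sup>2 \<le> k\<^sup>2 / 4" by (simp add: power2_eq_square)
  have sos: "0 \<le> k\<^sup>2 * g\<^sup>2 + 4 * d * g * g' + 2 * g'\<^sup>2" for g g'
  proof -
    have "k\<^sup>2 * g\<^sup>2 + 4 * d * g * g' + 2 * g'\<^sup>2 = 2 * (g' + d * g)\<^sup>2 + (k\<^sup>2 - 2 * d\<^sup>2) * g\<^sup>2"
      by (simp add: power2_eq_square algebra_simps)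
    also have "\<dots> \<ge> 0"
    proof -
      have "0 \<le> k\<^sup>2 - 2 * d\<^sup>2" using d2 zero_le_power2[of k] by linarith
      then show ?thesis by (intro add_nonneg_nonneg mult_nonneg_nonneg) auto
    qed
    finally show ?thesis .
  qed
  let ?g = "f (x, y)" and ?h = "f (- x, y)" and ?g' = "fx (x, y)" and ?h' = "fx (- x, y)"
  have "sq_xx (x, y) + sq_yy (x, y) \<ge> 2 * ?g'\<^sup>2 + 2 * ?h'\<^sup>2 - 2 * l / x * sq_x (x, y)"
  proof -
    define E where "E = 2 * l / x\<^sup>2 * (?g - ?h)\<^sup>2"
    define M where "M = 2 * l / x * sq_x (x, y)"
    have "0 \<le> E"
      using l_pos by (simp add: E_def)
    moreover have "0 \<le> (fy (x, y))\<^sup>2" "0 \<le> (fy (- x, y))\<^sup>2" by simp_all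
    moreover have "S + M = 2 * (a + b + c + d) + E \<Longrightarrow> 0 \<le> E \<Longrightarrow> 0 \<le> b \<Longrightarrow> 0 \<le> d
        \<Longrightarrow> 2 * a + 2 * c - M \<le> S" for S a b c d :: real
      by simp
    ultimately have "sq_xx (x, y) + sq_yy (x, y) \<ge> 2 * ?g'\<^sup>2 + 2 * ?h'\<^sup>2 - M"
      using laplace_sq[OF y x0, folded E_def M_def] by blast
    then show ?thesis by (simp add: M_def)
  qed
  moreover have "2 * k * sq_x (x, y) - 2 * l / x * sq_x (x, y) = 2 * d * sq_x (x, y)"
    by (simp add: d_def algebra_simps)
  moreover have "k\<^sup>2 * sq (x, y) + 2 * d * sq_x (x, y) + 2 * ?g'\<^sup>2 + 2 * ?h'\<^sup>2
      = (k\<^sup>2 * ?g\<^sup>2 + 4 * d * ?g * ?g' + 2 * ?g'\<^sup>2) + (k\<^sup>2 * ?h\<^sup>2 + 4 * d * ?h * (- ?h') + 2 * (- ?h')\<^sup>2)"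
    by (simp add: sq_def sq_x_def algebra_simps)
  ultimately show ?thesis
    using sos[of ?g ?g'] sos[of ?h "- ?h'"] by linarith
qed

lemma bump_mean_exp_sq:
  assumes a: "a \<noteq> 0" and r: "0 \<le> r" "r \<le> \<bar>a\<bar> / 3" "r < b"
  defines "T \<equiv> \<lambda>z. exp (l / a * fst z) * sq z"
  shows "bump_mean 0 a b T 0 \<le> bump_mean 0 a b T r"
proof -
  define k where "k = l / a"
  let ?T1 = "\<lambda>z. exp (k * fst z) * (k * sq z + sq_x z)"
  let ?T2 = "\<lambda>z. exp (k * fst z) * sq_y z"
  let ?T11 = "\<lambda>z. exp (k * fst z) * (k\<^sup>2 * sq z + 2 * k * sq_x z + sq_xx z)"
  let ?T22 = "\<lambda>z. exp (k * fst z) * sq_yy z"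
  let ?Q = "csquare a b r"
  have sub: "?Q \<subseteq> upper_half_plane"
    using r by (auto simp: upper_half_plane_def csquare_iff)
  note cs = continuous_on_subset[OF continuous_on_sq sub] continuous_on_subset[OF continuous_on_sq_x sub]
    continuous_on_subset[OF continuous_on_sq_y sub] continuous_on_subset[OF continuous_on_sq_yy sub]
  have pos: "0 < y" if "(x, y) \<in> csquare a b r" for x y
    using that r by (auto simp: csquare_iff)
  have sqx: "((\<lambda>s. sq (s, y)) has_real_derivative sq_x (x, y)) (at x)" if "0 < y" for x y
    by (rule has_derivative_imp_partial_x[OF has_deriv_sq[OF that]])
  have dexp: "((\<lambda>s. exp (k * s)) has_real_derivative k * exp (k * x)) (at x)" for x
    by (auto intro!: derivative_eq_intros)
  have "bump_mean 0 a b (\<lambda>z. exp (k * fst z) * sq z) 0 \<le> bump_mean 0 a b (\<lambda>z. exp (k * fst z) * sq z) r"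
  proof (rule bump_mean_mono[where R = r and Tx = ?T1 and Ty = ?T2 and Txx = ?T11 and Tyy = ?T22])
    show "continuous_on ?Q ?T1" "continuous_on ?Q ?T2" "continuous_on ?Q ?T22"
      by (intro continuous_intros cs)+
    show "((\<lambda>z. exp (k * fst z) * sq z) has_derivative (\<lambda>h. ?T1 z * fst h + ?T2 z * snd h)) (at z)"
      if "z \<in> csquare a b r" for z
    proof -
      obtain x y where z: "z = (x, y)" by (cases z)
      have e: "((\<lambda>z. exp (k * fst z)) has_derivative (\<lambda>h. exp (k * x) * (k * fst h))) (at (x, y))"
        by (auto intro!: derivative_eq_intros)
      have "0 < y" using pos that z by auto
      from has_derivative_mult[OF e has_deriv_sq[OF this]] show ?thesis
        unfolding z by (rule has_derivative_eq_rhs) (auto simp: algebra_simps)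
    qed
    show "((\<lambda>s. ?T1 (s, y)) has_real_derivative ?T11 (x, y)) (at x)"
      if "(x, y) \<in> csquare a b r" for x y
    proof -
      note y = pos[OF that]
      from DERIV_mult[OF dexp[of x] DERIV_add[OF DERIV_cmult[OF sqx[OF y], of k] has_dxx_sq[OF y]]]
      show ?thesis unfolding fst_conv
        by (rule DERIV_cong) (simp add: power2_eq_square algebra_simps)
    qed
    show "((\<lambda>t. ?T2 (x, t)) has_real_derivative ?T22 (x, y)) (at y)"
      if "(x, y) \<in> csquare a b r" for x y
      unfolding fst_conv by (intro DERIV_cmult has_dyy_sq pos[OF that])
    show "0 \<le> ?T11 (x, y) + ?T22 (x, y) + 2 * 0 / (x - a) * ?T1 (x, y)"
      if "(x, y) \<in> csquare a b r" for x y
    proof -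
      have "\<bar>x - a\<bar> \<le> r" using that by (auto simp: csquare_iff)
      with r have "\<bar>x - a\<bar> \<le> \<bar>a\<bar> / 3" by linarith
      from exp_sq_subharmonic[OF pos[OF that] a this]
      have "0 \<le> exp (k * x) * (k\<^sup>2 * sq (x, y) + 2 * k * sq_x (x, y) + sq_xx (x, y) + sq_yy (x, y))"
        unfolding k_def by (intro mult_nonneg_nonneg) auto
      then show ?thesis by (simp add: algebra_simps)
    qed
  qed (use r in auto)
  then show ?thesis by (simp add: T_def k_def)
qed

end

section \<open>The local mean value inequality\<close>

lemma bump_mass_pos:
  assumes "0 \<le> \<mu>"
  shows "0 < integral (cbox (-1, -1) (1, 1)) (\<lambda>z. bump z * wt \<mu> (fst z))"
proof -
  let ?B = "cbox (-1, -1) (1, 1) :: (real \<times> real) set" and ?g = "\<lambda>z. bump z * wt \<mu> (fst z)"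
  have c: "continuous_on ?B ?g" by (intro continuous_intros assms)
  have nn: "0 \<le> ?g z" for z by (simp add: bump_nonneg wt_nonneg)
  have "integral ?B ?g \<noteq> 0"
  proof
    assume 0: "integral ?B ?g = 0"
    then have "(?g has_integral 0) ?B"
      using integrable_integral[OF integrable_continuous[OF c]] by simp
    from has_integral_0_cbox_imp_0[OF c nn this, of "(1/2, 1/2)"]
    have "bump (1/2, 1/2) * wt \<mu> (1/2) = 0" by (auto simp: box_ne_empty Basis_prod_def)
    then show False by (simp add: bump_def wt_def power2_eq_square split: if_splits)
  qed
  moreover have "0 \<le> integral ?B ?g" by (intro integral_nonneg integrable_continuous c nn)
  ultimately show ?thesis by linarith
qed

context dunkl_harmonic
begin

definition sq_mass :: "(real \<times> real) set \<Rightarrow> ennreal" where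
  "sq_mass A = (\<integral>\<^sup>+z. ennreal (sq z * \<bar>fst z\<bar> powr (2 * l)) * indicator A z \<partial>lborel)"

lemma sq_mass_mono: "A \<subseteq> B \<Longrightarrow> sq_mass A \<le> sq_mass B"
  unfolding sq_mass_def by (intro nn_integral_mono) (auto simp: indicator_def)

lemma csquare_subset_half_plane: "r < b \<Longrightarrow> csquare a b r \<subseteq> upper_half_plane"
  by (auto simp: upper_half_plane_def csquare_iff)

lemma cont_sq_csquare: "r < b \<Longrightarrow> continuous_on (csquare a b r) sq"
  using continuous_on_subset[OF continuous_on_sq csquare_subset_half_plane] .

lemma bump_mean_sq_nonneg:
  assumes "0 \<le> R" "R < b"
  shows "0 \<le> bump_mean l 0 b sq R"
proof -
  have "continuous_on (cbox (-1, -1) (1, 1)) (\<lambda>z. sq (0 + R * fst z, b + R * snd z))"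
  proof (rule continuous_on_compose2[OF continuous_on_sq])
    have "0 < b + R * y" if "- 1 \<le> y" for y
      using mult_left_mono[OF that assms(1)] assms by simp
    then show "(\<lambda>z. (0 + R * fst z, b + R * snd z)) ` cbox (- 1, - 1) (1, 1) \<subseteq> upper_half_plane"
      by (auto simp: upper_half_plane_def)
  qed (intro continuous_intros)
  then show ?thesis
    unfolding bump_mean_def using l_pos
    by (intro integral_nonneg integrable_continuous continuous_intros mult_nonneg_nonneg
        sq_nonneg bump_nonneg wt_nonneg) auto
qed

lemma bump_mean_sq_rescale:
  assumes R: "0 < R" "R < b"
  defines "g \<equiv> \<lambda>z. sq z * bump (fst z / R, (snd z - b) / R) * \<bar>fst z\<bar> powr (2 * l)"
  shows "ennreal (R powr (2 + 2 * l) * bump_mean l 0 b sq R)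
     = (\<integral>\<^sup>+z. ennreal (g z) * indicator (csquare 0 b R) z \<partial>lborel)"
    and "continuous_on (csquare 0 b R) g"
proof -
  have c: "continuous_on (csquare 0 b R) g"
    unfolding g_def using R l_pos
    by (intro continuous_intros cont_sq_csquare continuous_on_powr') auto
  have "integral (cbox (-1, -1) (1, 1)) (\<lambda>z. g (0 + R * fst z, b + R * snd z))
      = integral (cbox (-1, -1) (1, 1)) (\<lambda>z. R powr (2 * l) *
          (sq (0 + R * fst z, b + R * snd z) * (bump z * wt l (fst z))))"
    using R l_pos by (intro integral_cong) (simp add: g_def wt_def abs_mult powr_mult mult_ac)
  also have "\<dots> = R powr (2 * l) * bump_mean l 0 b sq R"
    by (simp add: bump_mean_def)
  finally have eq: "integral (cbox (-1, -1) (1, 1)) (\<lambda>z. g (0 + R * fst z, b + R * snd z))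
      = R powr (2 * l) * bump_mean l 0 b sq R" .
  have "ennreal (R powr (2 + 2 * l) * bump_mean l 0 b sq R)
      = ennreal (R\<^sup>2) * ennreal (R powr (2 * l) * bump_mean l 0 b sq R)"
    using R by (simp add: ennreal_mult'[symmetric] powr_add powr_numeral mult.assoc)
  also have "\<dots> = (\<integral>\<^sup>+z. ennreal (g z) * indicator (csquare 0 b R) z \<partial>lborel)"
    unfolding eq[symmetric]
    by (rule integral_rescale_csquare[OF R(1) c]) (simp add: g_def sq_nonneg bump_nonneg)
  finally show "ennreal (R powr (2 + 2 * l) * bump_mean l 0 b sq R)
     = (\<integral>\<^sup>+z. ennreal (g z) * indicator (csquare 0 b R) z \<partial>lborel)" .
  show "continuous_on (csquare 0 b R) g" by (rule c)
qed

lemma bump_mean_sq_le_mass: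
  assumes R: "0 < R" "R < b"
  shows "ennreal (R powr (2 + 2 * l) * bump_mean l 0 b sq R) \<le> sq_mass (csquare 0 b R)"
  unfolding bump_mean_sq_rescale(1)[OF R] sq_mass_def
proof (intro nn_integral_mono mult_right_mono[OF ennreal_leI])
  fix z
  have "sq z * bump (fst z / R, (snd z - b) / R) \<le> sq z * 1"
    by (intro mult_left_mono bump_le_1 sq_nonneg)
  then show "sq z * bump (fst z / R, (snd z - b) / R) * \<bar>fst z\<bar> powr (2 * l) \<le> sq z * \<bar>fst z\<bar> powr (2 * l)"
    by (intro mult_right_mono) auto
qed simp

text \<open>The square of half side \<open>\<bar>a\<bar>/3\<close> around \<open>(a, b)\<close> lies inside the disc of radius \<open>2\<bar>a\<bar>\<close> around
  \<open>(0, b)\<close>, in the region where the kernel is at least \<open>1/2\<close>.\<close>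

lemma off_axis_mass_le_bump_mean:
  assumes a: "a \<noteq> 0" "2 * \<bar>a\<bar> < b"
  shows "sq_mass (csquare a b (\<bar>a\<bar> / 3)) \<le> ennreal (2 * (2 * \<bar>a\<bar>) powr (2 + 2 * l) * bump_mean l 0 b sq (2 * \<bar>a\<bar>))"
proof -
  define R where "R = 2 * \<bar>a\<bar>"
  have R: "0 < R" "R < b" using a by (auto simp: R_def)
  let ?g = "\<lambda>z. sq z * bump (fst z / R, (snd z - b) / R) * \<bar>fst z\<bar> powr (2 * l)"
  have "sq_mass (csquare a b (\<bar>a\<bar> / 3)) \<le> (\<integral>\<^sup>+z. 2 * (ennreal (?g z) * indicator (csquare 0 b R) z) \<partial>lborel)"
    unfolding sq_mass_def
  proof (intro nn_integral_mono)
    fix z :: "real \<times> real"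
    obtain x y where z: "z = (x, y)" by (cases z)
    show "ennreal (sq z * \<bar>fst z\<bar> powr (2 * l)) * indicator (csquare a b (\<bar>a\<bar> / 3)) z
       \<le> 2 * (ennreal (?g z) * indicator (csquare 0 b R) z)"
    proof (cases "z \<in> csquare a b (\<bar>a\<bar> / 3)")
      case True
      then have xy: "\<bar>x - a\<bar> \<le> \<bar>a\<bar> / 3" "\<bar>y - b\<bar> \<le> \<bar>a\<bar> / 3" by (auto simp: z csquare_iff)
      then have "\<bar>x\<bar> \<le> R * (2 / 3)" "\<bar>y - b\<bar> \<le> R * (1 / 6)" unfolding R_def by linarith+
      then have x: "\<bar>x / R\<bar> \<le> 2 / 3" "\<bar>(y - b) / R\<bar> \<le> 1 / 6"
        using R by (simp_all add: abs_divide field_simps)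
      have "(x / R)\<^sup>2 \<le> (2 / 3)\<^sup>2" "((y - b) / R)\<^sup>2 \<le> (1 / 6)\<^sup>2"
        using x by (subst abs_le_square_iff[symmetric], simp)+
      then have "1 / 2 \<le> bump (x / R, (y - b) / R)"
      proof -
        have "1 / 2 \<le> 1 - (2 / 3)\<^sup>2 - (1 / 6 :: real)\<^sup>2" by (simp add: power2_eq_square)
        also have "\<dots> \<le> 1 - (x / R)\<^sup>2 - ((y - b) / R)\<^sup>2"
          using \<open>(x / R)\<^sup>2 \<le> (2 / 3)\<^sup>2\<close> \<open>((y - b) / R)\<^sup>2 \<le> (1 / 6)\<^sup>2\<close> by (intro diff_mono) auto
        also have "\<dots> \<le> bump (x / R, (y - b) / R)" by (simp add: bump_def)
        finally show ?thesis .
      qed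
      from mult_left_mono[OF this, of "2 * sq z"]
      have "sq z \<le> 2 * (sq z * bump (x / R, (y - b) / R))" using sq_nonneg[of z] by simp
      from mult_right_mono[OF this, of "\<bar>x\<bar> powr (2 * l)"]
      have "sq z * \<bar>fst z\<bar> powr (2 * l) \<le> 2 * ?g z" by (simp add: z mult_ac)
      then have "ennreal (sq z * \<bar>fst z\<bar> powr (2 * l)) \<le> ennreal (2 * ?g z)"
        by (rule ennreal_leI)
      also have "\<dots> = 2 * ennreal (?g z)"
        by (simp add: ennreal_mult' sq_nonneg bump_nonneg)
      finally have "ennreal (sq z * \<bar>fst z\<bar> powr (2 * l)) \<le> 2 * ennreal (?g z)" .
      moreover have "z \<in> csquare 0 b R"
        using \<open>\<bar>x\<bar> \<le> R * (2 / 3)\<close> \<open>\<bar>y - b\<bar> \<le> R * (1 / 6)\<close> R by (simp add: z csquare_iff)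
      ultimately show ?thesis using True by simp
    qed simp
  qed
  also have "\<dots> = 2 * (\<integral>\<^sup>+z. ennreal (?g z) * indicator (csquare 0 b R) z \<partial>lborel)"
    by (subst nn_integral_cmult) (use measurable_csquare[OF bump_mean_sq_rescale(2)[OF R]] in auto)
  also have "\<dots> = 2 * ennreal (R powr (2 + 2 * l) * bump_mean l 0 b sq R)"
    using bump_mean_sq_rescale(1)[OF R] by simp
  also have "\<dots> = ennreal (2 * R powr (2 + 2 * l) * bump_mean l 0 b sq R)"
    using bump_mean_sq_nonneg[of R b] R by (simp add: ennreal_mult' mult.assoc)
  finally show ?thesis by (simp add: R_def)
qed

lemma sq_off_axis_le_mass:
  assumes a: "a \<noteq> 0" and r: "0 < r" "r \<le> \<bar>a\<bar> / 3" "r < b"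
  defines "\<kappa> \<equiv> integral (cbox (-1, -1) (1, 1)) bump * exp (- l / 3)"
  shows "ennreal (sq (a, b) * \<kappa> * (r\<^sup>2 * (2 * \<bar>a\<bar> / 3) powr (2 * l))) \<le> sq_mass (csquare a b r)"
proof -
  let ?B = "cbox (-1, -1) (1, 1) :: (real \<times> real) set"
  let ?p = "\<lambda>z. (a + r * fst z, b + r * snd z)"
  let ?c = "(2 * \<bar>a\<bar> / 3) powr (2 * l)"
  define T where "T z = exp (l / a * fst z) * sq z" for z
  define I where "I = integral ?B (\<lambda>z. sq (?p z))"
  have inB: "?p z \<in> csquare a b r" if "z \<in> ?B" for z
  proof -
    have "\<bar>r * t\<bar> \<le> r \<longleftrightarrow> \<bar>t\<bar> \<le> 1" for t
      using r by (simp add: abs_mult)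
    then show ?thesis
      using that by (cases z) (auto simp: csquare_iff abs_le_iff)
  qed
  have cT: "continuous_on (csquare a b r) T"
    unfolding T_def by (intro continuous_intros cont_sq_csquare r)
  have cp: "continuous_on ?B (\<lambda>z. g (?p z))" if "continuous_on (csquare a b r) g" for g :: "real \<times> real \<Rightarrow> real"
    by (rule continuous_on_compose2[OF that]) (use inB in \<open>auto intro!: continuous_intros\<close>)
  have "bump_mean 0 a b T 0 = T (a, b) * integral ?B bump"
    by (simp add: bump_mean_def wt_def)
  then have "exp l * sq (a, b) * integral ?B bump \<le> bump_mean 0 a b T r"
    using bump_mean_exp_sq[of a r b] a r by (simp add: T_def[abs_def])
  also have "\<dots> \<le> integral ?B (\<lambda>z. exp (l + l / 3) * sq (?p z))"
    unfolding bump_mean_def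
  proof (intro integral_le integrable_continuous continuous_intros cp cT cont_sq_csquare r)
    fix z assume "z \<in> ?B"
    then have "?p z \<in> csquare a b r" by (rule inB)
    then have x: "\<bar>a + r * fst z - a\<bar> \<le> \<bar>a\<bar> / 3" using r by (simp add: csquare_iff)
    have "l / a * (a + r * fst z) = l + l * ((r * fst z) / a)"
      using a by (simp add: field_simps)
    also have "(r * fst z) / a \<le> 1 / 3"
    proof -
      have "\<bar>r * fst z / a\<bar> \<le> 1 / 3" using x a by (simp add: abs_divide field_simps)
      then show ?thesis by linarith
    qed
    then have "l + l * ((r * fst z) / a) \<le> l + l * (1 / 3)"
      using l_pos by (intro add_left_mono mult_left_mono) auto
    finally have "exp (l / a * (a + r * fst z)) \<le> exp (l + l / 3)" by simp
    then have "T (?p z) \<le> exp (l + l / 3) * sq (?p z)"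
      unfolding T_def fst_conv by (intro mult_right_mono sq_nonneg)
    moreover have "T (?p z) * (bump z * wt 0 (fst z)) \<le> T (?p z) * 1"
      unfolding wt_def using bump_le_1 by (intro mult_left_mono) (auto simp: T_def sq_nonneg)
    ultimately show "T (?p z) * (bump z * wt 0 (fst z)) \<le> exp (l + l / 3) * sq (?p z)" by linarith
  qed simp_all
  also have "\<dots> = exp (l + l / 3) * I"
    by (simp add: I_def)
  finally have "exp l * sq (a, b) * integral ?B bump \<le> exp (l + l / 3) * I" .
  then have "exp l * (sq (a, b) * integral ?B bump) \<le> exp l * (exp (l / 3) * I)"
    by (simp only: exp_add mult.assoc)
  then have "sq (a, b) * integral ?B bump \<le> exp (l / 3) * I" by (simp only: mult_le_cancel_left_pos exp_gt_zero)
  then have "exp (- l / 3) * (sq (a, b) * integral ?B bump) \<le> exp (- l / 3) * (exp (l / 3) * I)"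
    by (intro mult_left_mono) auto
  moreover have "exp (- l / 3) * (exp (l / 3) * I) = I"
    by (simp add: mult.assoc[symmetric] exp_add[symmetric])
  ultimately have "sq (a, b) * \<kappa> \<le> I"
    by (simp only: \<kappa>_def mult_ac)
  then have "sq (a, b) * \<kappa> * (r\<^sup>2 * ?c) \<le> I * (r\<^sup>2 * ?c)"
    by (intro mult_right_mono) auto
  then have "ennreal (sq (a, b) * \<kappa> * (r\<^sup>2 * ?c)) \<le> ennreal (r\<^sup>2) * ennreal (integral ?B (\<lambda>z. ?c * sq (?p z)))"
    by (simp add: ennreal_mult'[symmetric] I_def ennreal_leI mult_ac)
  also have "\<dots> = (\<integral>\<^sup>+z. ennreal (?c * sq z) * indicator (csquare a b r) z \<partial>lborel)"
    by (rule integral_rescale_csquare[OF r(1)])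
       (auto intro!: continuous_intros cont_sq_csquare r simp: sq_nonneg)
  also have "\<dots> \<le> sq_mass (csquare a b r)"
    unfolding sq_mass_def
  proof (intro nn_integral_mono)
    fix z :: "real \<times> real"
    show "ennreal (?c * sq z) * indicator (csquare a b r) z
      \<le> ennreal (sq z * \<bar>fst z\<bar> powr (2 * l)) * indicator (csquare a b r) z"
    proof (cases "z \<in> csquare a b r")
      case True
      then have "\<bar>fst z - a\<bar> \<le> \<bar>a\<bar> / 3" using r by (cases z) (auto simp: csquare_iff)
      then have "2 * \<bar>a\<bar> / 3 \<le> \<bar>fst z\<bar>" by linarith
      then have "?c \<le> \<bar>fst z\<bar> powr (2 * l)"
        using l_pos by (intro powr_mono2) auto
      then show ?thesis
        using True by (auto intro!: ennreal_leI mult_left_mono simp: sq_nonneg mult.commute[of ?c])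
    qed simp
  qed
  finally show ?thesis .
qed

text \<open>A point far from the axis, compared with the radius, has a mean value inequality without weight,
  since the weight is nearly constant there. A point \<open>(a, b)\<close> close to the axis is first bounded by the
  mass of the square of half side \<open>\<bar>a\<bar>/3\<close> around it, then by the average around \<open>(0, b)\<close> at radius \<open>2\<bar>a\<bar>\<close>; as the
  averages centred on the axis increase with the radius, the radius can be enlarged to a fixed
  fraction of \<open>r\<close>. This two-step argument replaces a Harnack inequality for the degenerate operator.\<close>

lemma sq_le_ball_mass:
  obtains C where "0 < C"
    "\<And>a b r. 0 < r \<Longrightarrow> r < b \<Longrightarrow> ennreal (C * r powr (2 + 2 * l) * sq (a, b)) \<le> sq_mass (ball (a, b) r)"
proof -
  define \<kappa> where "\<kappa> = integral (cbox (-1, -1) (1, 1)) bump * exp (- l / 3)"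
  define \<kappa>' where "\<kappa>' = integral (cbox (-1, -1) (1, 1)) (\<lambda>z. bump z * wt l (fst z))"
  have pos: "0 < \<kappa>" "0 < \<kappa>'"
    using bump_mass_pos[of 0] bump_mass_pos[of l] l_pos by (auto simp: \<kappa>_def \<kappa>'_def wt_def)
  define C1 where "C1 = \<kappa> * ((1 / 30)\<^sup>2 * (1 / 15) powr (2 * l))"
  define C2 where "C2 = \<kappa> / (72 * 3 powr (2 * l)) * (1 / 5) powr (2 + 2 * l)"
  define C3 where "C3 = \<kappa>' * (1 / 5) powr (2 + 2 * l)"
  define C where "C = min C1 (min C2 C3)"
  have C: "C \<le> C1" "C \<le> C2" "C \<le> C3" by (auto simp: C_def)
  show ?thesis
  proof (rule that)
    show "0 < C" unfolding C_def C1_def C2_def C3_def using pos by simp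
    fix a b r :: real
    assume r: "0 < r" "r < b"
    define P where "P = r powr (2 + 2 * l) * sq (a, b)"
    have P: "0 \<le> P" by (simp add: P_def sq_nonneg)
    have CP: "ennreal (C * r powr (2 + 2 * l) * sq (a, b)) \<le> ennreal (D * P)" if "C \<le> D" for D
      using mult_right_mono[OF that P] by (intro ennreal_leI) (simp add: P_def mult_ac)
    \<comment> \<open>Small enough for all squares used below to stay inside the ball.\<close>
    define \<sigma> where "\<sigma> = r / 10"
    have rsplit: "(r / 5) powr (2 + 2 * l) = r powr (2 + 2 * l) * (1 / 5) powr (2 + 2 * l)"
      using r by (simp add: powr_divide)
    have near: "ennreal ((r / 5) powr (2 + 2 * l) * bump_mean l 0 b sq (r / 5)) \<le> sq_mass (ball (a, b) r)"
      if "\<bar>a\<bar> \<le> \<sigma>"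
    proof -
      have "ennreal ((r / 5) powr (2 + 2 * l) * bump_mean l 0 b sq (r / 5)) \<le> sq_mass (csquare 0 b (r / 5))"
        by (rule bump_mean_sq_le_mass) (use r in auto)
      also have "\<dots> \<le> sq_mass (ball (a, b) r)"
        using that r by (intro sq_mass_mono csquare_subset_ball) (simp add: \<sigma>_def)
      finally show ?thesis .
    qed
    consider "\<sigma> < \<bar>a\<bar>" | "a = 0" | "a \<noteq> 0" "\<bar>a\<bar> \<le> \<sigma>" by linarith
    then show "ennreal (C * r powr (2 + 2 * l) * sq (a, b)) \<le> sq_mass (ball (a, b) r)"
    proof cases
      case 1
      have "C1 * P = sq (a, b) * \<kappa> * ((\<sigma> / 3)\<^sup>2 * (2 * \<sigma> / 3) powr (2 * l))"
      proof -
        have "(2 * \<sigma> / 3) powr (2 * l) = r powr (2 * l) * (1 / 15) powr (2 * l)"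
          using r by (simp add: \<sigma>_def powr_divide)
        moreover have "(\<sigma> / 3)\<^sup>2 = r powr 2 * (1 / 30)\<^sup>2"
          using r by (simp add: \<sigma>_def power2_eq_square powr_numeral)
        ultimately show ?thesis by (simp add: C1_def P_def powr_add mult_ac)
      qed
      also have "\<dots> \<le> sq (a, b) * \<kappa> * ((\<sigma> / 3)\<^sup>2 * (2 * \<bar>a\<bar> / 3) powr (2 * l))"
        using 1 r l_pos pos by (intro mult_left_mono powr_mono2 mult_nonneg_nonneg sq_nonneg) (auto simp: \<sigma>_def)
      finally have "ennreal (C1 * P) \<le> ennreal \<dots>" by (rule ennreal_leI)
      also have "\<dots> \<le> sq_mass (csquare a b (\<sigma> / 3))"
        unfolding \<kappa>_def by (rule sq_off_axis_le_mass) (use 1 r in \<open>auto simp: \<sigma>_def\<close>)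
      also have "\<dots> \<le> sq_mass (ball (a, b) r)"
        by (intro sq_mass_mono csquare_subset_ball) (use r in \<open>simp add: \<sigma>_def\<close>)
      finally show ?thesis using CP[OF C(1)] by (rule order_trans[rotated])
    next
      case 2
      have "\<kappa>' * sq (a, b) = bump_mean l 0 b sq 0"
        by (simp add: 2 \<kappa>'_def bump_mean_def)
      also have "\<dots> \<le> bump_mean l 0 b sq (r / 5)"
        by (rule bump_mean_sq_axis_mono) (use r in auto)
      finally have "(r / 5) powr (2 + 2 * l) * (\<kappa>' * sq (a, b)) \<le> (r / 5) powr (2 + 2 * l) * bump_mean l 0 b sq (r / 5)"
        by (intro mult_left_mono) auto
      then have "C3 * P \<le> (r / 5) powr (2 + 2 * l) * bump_mean l 0 b sq (r / 5)"
        unfolding C3_def P_def rsplit by (simp add: mult_ac)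
      then have "ennreal (C3 * P) \<le> ennreal ((r / 5) powr (2 + 2 * l) * bump_mean l 0 b sq (r / 5))"
        by (rule ennreal_leI)
      also have "\<dots> \<le> sq_mass (ball (a, b) r)"
        by (rule near) (use 2 r in \<open>auto simp: \<sigma>_def\<close>)
      finally have "ennreal (C3 * P) \<le> sq_mass (ball (a, b) r)" .
      then show ?thesis using CP[OF C(3)] by (rule order_trans[rotated])
    next
      case 3
      let ?q = "(2 * \<bar>a\<bar>) powr (2 * l)"
      have ab: "2 * \<bar>a\<bar> \<le> r / 5" using 3 by (simp add: \<sigma>_def)
      have "ennreal (sq (a, b) * \<kappa> * ((\<bar>a\<bar> / 3)\<^sup>2 * (2 * \<bar>a\<bar> / 3) powr (2 * l))) \<le> sq_mass (csquare a b (\<bar>a\<bar> / 3))"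
        unfolding \<kappa>_def by (rule sq_off_axis_le_mass) (use 3 r ab in auto)
      also have "\<dots> \<le> ennreal (2 * (2 * \<bar>a\<bar>) powr (2 + 2 * l) * bump_mean l 0 b sq (2 * \<bar>a\<bar>))"
        by (rule off_axis_mass_le_bump_mean) (use 3 r ab in auto)
      finally have "sq (a, b) * \<kappa> * ((\<bar>a\<bar> / 3)\<^sup>2 * (2 * \<bar>a\<bar> / 3) powr (2 * l))
          \<le> 2 * (2 * \<bar>a\<bar>) powr (2 + 2 * l) * bump_mean l 0 b sq (2 * \<bar>a\<bar>)"
        by (subst (asm) ennreal_le_iff) (use bump_mean_sq_nonneg[of "2 * \<bar>a\<bar>" b] ab r in auto)
      moreover have "sq (a, b) * \<kappa> * ((\<bar>a\<bar> / 3)\<^sup>2 * (2 * \<bar>a\<bar> / 3) powr (2 * l))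
          = (8 * \<bar>a\<bar>\<^sup>2 * ?q) * (\<kappa> / (72 * 3 powr (2 * l)) * sq (a, b))"
        by (simp add: powr_divide power2_eq_square)
      moreover have "2 * (2 * \<bar>a\<bar>) powr (2 + 2 * l) = 8 * \<bar>a\<bar>\<^sup>2 * ?q"
        using 3 by (simp add: powr_add powr_numeral power2_eq_square)
      moreover have "0 < 8 * \<bar>a\<bar>\<^sup>2 * ?q" using 3 by simp
      ultimately have "\<kappa> / (72 * 3 powr (2 * l)) * sq (a, b) \<le> bump_mean l 0 b sq (2 * \<bar>a\<bar>)"
        by (simp only: mult_le_cancel_left_pos)
      also have "\<dots> \<le> bump_mean l 0 b sq (r / 5)"
        by (rule bump_mean_sq_axis_mono) (use r ab in auto)
      finally have "(r / 5) powr (2 + 2 * l) * (\<kappa> / (72 * 3 powr (2 * l)) * sq (a, b))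
          \<le> (r / 5) powr (2 + 2 * l) * bump_mean l 0 b sq (r / 5)"
        by (intro mult_left_mono) auto
      then have "C2 * P \<le> (r / 5) powr (2 + 2 * l) * bump_mean l 0 b sq (r / 5)"
        unfolding C2_def P_def rsplit by (simp add: mult_ac)
      then have "ennreal (C2 * P) \<le> ennreal ((r / 5) powr (2 + 2 * l) * bump_mean l 0 b sq (r / 5))"
        by (rule ennreal_leI)
      also have "\<dots> \<le> sq_mass (ball (a, b) r)"
        by (rule near) (use 3 in auto)
      finally have "ennreal (C2 * P) \<le> sq_mass (ball (a, b) r)" .
      then show ?thesis using CP[OF C(2)] by (rule order_trans[rotated])
    qed
  qed
qed

end

section \<open>Decay of Dunkl-harmonic functions with bounded line integrals\<close>

lemma powr_add_le_double:
  fixes a b q :: real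
  assumes "0 \<le> a" "0 \<le> b" "0 \<le> q" "q \<le> 1"
  shows "(a + b) powr q \<le> 2 * (a powr q + b powr q)"
proof -
  have "(a + b) powr q \<le> (2 * max a b) powr q"
    using assms by (intro powr_mono2) auto
  also have "\<dots> = 2 powr q * max a b powr q"
    using assms by (intro powr_mult)
  also have "\<dots> \<le> 2 powr 1 * (a powr q + b powr q)"
    using assms by (intro mult_mono powr_mono) (auto simp: max_def)
  finally show ?thesis by simp
qed

text \<open>The Hardy-Littlewood argument that a mean value inequality for \<open>S\<close> implies one for its small powers.
  The maximum \<open>M\<close> of \<open>(R - dist z0 z)\<^bsup>D\<^esup> S(z)\<^bsup>q\<^esup>\<close> over the ball is finite; at a maximum point, the mean value
  inequality at half the distance to the sphere, with \<open>S = S\<^bsup>1-q\<^esup> S\<^bsup>q\<^esup>\<close> and the first factor bounded through \<open>M\<close>,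
  bounds \<open>M\<^bsup>1/q\<^esup>\<close> by a multiple of \<open>M\<^bsup>1/q - 1\<^esup> J\<close>, and one divides.\<close>

lemma sub_mean_value_power:
  fixes S W :: "'a::euclidean_space \<Rightarrow> real"
  assumes R: "0 < R" and D: "0 < D" and q: "0 < q" "q < 1" and K: "0 < K" and J: "0 \<le> J"
    and cont: "continuous_on (cball z0 R) S" "continuous_on (cball z0 R) W"
    and nonneg: "\<And>z. 0 \<le> S z" "\<And>z. 0 \<le> W z"
    and sub: "\<And>z r. 0 < r \<Longrightarrow> dist z0 z + r \<le> R \<Longrightarrow>
      ennreal (K * r powr D * S z) \<le> (\<integral>\<^sup>+x. ennreal (S x * W x) * indicator (ball z r) x \<partial>lborel)"
    and mass: "(\<integral>\<^sup>+x. ennreal (S x powr q * W x) * indicator (ball z0 R) x \<partial>lborel) \<le> ennreal J"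
  shows "K * R powr D * S z0 powr q \<le> 2 powr (D / q) * J"
proof -
  define h where "h z = (R - dist z0 z) powr D * S z powr q" for z
  have "continuous_on (cball z0 R) h"
    unfolding h_def using D q nonneg
    by (intro continuous_intros continuous_on_powr' cont) auto
  from continuous_attains_sup[OF compact_cball _ this]
  obtain z1 where z1: "z1 \<in> cball z0 R" and max: "\<And>z. z \<in> cball z0 R \<Longrightarrow> h z \<le> h z1"
    using R by (metis cball_eq_empty not_less_iff_gr_or_eq)
  have "K * h z1 \<le> 2 powr (D / q) * J"
  proof (cases "h z1 = 0")
    case False
    \<comment> \<open>On the ball of radius \<open>r\<close> around \<open>z1\<close> the distance to the sphere is still at least \<open>r\<close>.\<close>
    define r where "r = (R - dist z0 z1) / 2"
    have "dist z0 z1 \<noteq> R" using False by (auto simp: h_def)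
    then have r: "0 < r" "dist z0 z1 + r \<le> R" using z1 by (auto simp: r_def field_simps)
    define m where "m = h z1 / r powr D"
    have "0 < h z1" using False by (simp add: h_def less_le nonneg)
    then have m: "0 < m" using r by (simp add: m_def)
    have dom: "S x powr q \<le> m" if x: "x \<in> ball z1 r" for x
    proof -
      have d: "r \<le> R - dist z0 x"
        using dist_triangle[of z0 x z1] x r by (simp add: r_def field_simps)
      have "r powr D * S x powr q \<le> h x"
        unfolding h_def using d r D by (intro mult_right_mono powr_mono2) auto
      also have "\<dots> \<le> h z1" using d r by (intro max) auto
      finally show ?thesis using r by (simp add: m_def field_simps)
    qed
    have S_split: "S x * W x \<le> m powr ((1 - q) / q) * (S x powr q * W x)" if "x \<in> ball z1 r" for x
    proof (cases "S x = 0")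
      case False
      then have "S x = (S x powr q) powr ((1 - q) / q) * S x powr q"
        using q nonneg(1)[of x] by (simp add: powr_powr powr_add[symmetric])
      also have "\<dots> \<le> m powr ((1 - q) / q) * S x powr q"
        using dom[OF that] q by (intro mult_right_mono powr_mono2) auto
      finally show ?thesis
        using mult_right_mono[OF _ nonneg(2)] by (simp add: mult.assoc[symmetric])
    qed (use q in simp)
    have "(\<lambda>x. indicator (ball z0 R) x *\<^sub>R (S x powr q * W x)) \<in> borel_measurable borel"
    proof (rule borel_measurable_continuous_on_indicator)
      have "continuous_on (cball z0 R) (\<lambda>x. S x powr q * W x)"
        using q nonneg by (intro continuous_intros continuous_on_powr' cont) auto
      then show "continuous_on (ball z0 R) (\<lambda>x. S x powr q * W x)"
        by (rule continuous_on_subset) auto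
    qed simp
    then have "(\<lambda>x. ennreal (indicator (ball z0 R) x *\<^sub>R (S x powr q * W x))) \<in> borel_measurable borel"
      by measurable
    also have "(\<lambda>x. ennreal (indicator (ball z0 R) x *\<^sub>R (S x powr q * W x)))
        = (\<lambda>x. ennreal (S x powr q * W x) * indicator (ball z0 R) x)"
      by (auto simp: indicator_def)
    finally have meas: "(\<lambda>x. ennreal (S x powr q * W x) * indicator (ball z0 R) x) \<in> borel_measurable borel" .
    have "ennreal (K * r powr D * S z1) \<le> (\<integral>\<^sup>+x. ennreal (S x * W x) * indicator (ball z1 r) x \<partial>lborel)"
      by (rule sub[OF r])
    also have "\<dots> \<le> (\<integral>\<^sup>+x. ennreal (m powr ((1 - q) / q)) *
        (ennreal (S x powr q * W x) * indicator (ball z0 R) x) \<partial>lborel)"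
    proof (intro nn_integral_mono)
      fix x
      show "ennreal (S x * W x) * indicator (ball z1 r) x
        \<le> ennreal (m powr ((1 - q) / q)) * (ennreal (S x powr q * W x) * indicator (ball z0 R) x)"
      proof (cases "x \<in> ball z1 r")
        case True
        then have "x \<in> ball z0 R"
          using dist_triangle[of z0 x z1] r by simp
        then show ?thesis
          using True S_split[OF True] by (auto simp: ennreal_mult'[symmetric] intro!: ennreal_leI)
      qed simp
    qed
    also have "\<dots> = ennreal (m powr ((1 - q) / q)) *
        (\<integral>\<^sup>+x. ennreal (S x powr q * W x) * indicator (ball z0 R) x \<partial>lborel)"
      by (rule nn_integral_cmult) (use meas in simp)
    also have "\<dots> \<le> ennreal (m powr ((1 - q) / q)) * ennreal J"
      by (intro mult_left_mono mass) simp
    finally have "K * r powr D * S z1 \<le> m powr ((1 - q) / q) * J"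
      using J by (simp add: ennreal_mult'[symmetric])
    moreover have "S z1 = 2 powr (- D / q) * (m powr ((1 - q) / q) * m)"
    proof -
      have "R - dist z0 z1 = 2 * r" by (simp add: r_def)
      then have "m = 2 powr D * S z1 powr q"
        using r by (simp add: m_def h_def powr_mult)
      then have "S z1 powr q = 2 powr (- D) * m"
        by (simp add: powr_minus field_simps)
      then have "(S z1 powr q) powr (1 / q) = 2 powr (- D / q) * m powr (1 / q)"
        using m by (simp add: powr_mult powr_powr)
      moreover have "(S z1 powr q) powr (1 / q) = S z1"
        using q nonneg(1)[of z1] by (simp add: powr_powr)
      moreover have "m powr (1 / q) = m powr ((1 - q) / q) * m"
      proof -
        have "1 / q = (1 - q) / q + 1" using q by (simp add: field_simps)
        then have "m powr (1 / q) = m powr ((1 - q) / q) * m powr 1" by (simp only: powr_add)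
        then show ?thesis using m by simp
      qed
      ultimately show ?thesis by simp
    qed
    ultimately have "m powr ((1 - q) / q) * (K * r powr D * 2 powr (- D / q) * m) \<le> m powr ((1 - q) / q) * J"
      by (simp add: mult_ac)
    then have "K * r powr D * 2 powr (- D / q) * m \<le> J"
      using m by simp
    moreover have "r powr D * m = h z1" using r by (simp add: m_def)
    moreover have "K * r powr D * 2 powr (- D / q) * m = 2 powr (- D / q) * (K * (r powr D * m))"
      by (simp only: mult_ac)
    ultimately have "2 powr (- D / q) * (K * h z1) \<le> J" by (simp only:)
    then show ?thesis by (simp add: powr_minus field_simps)
  qed (use J in simp)
  moreover have "K * (R powr D * S z0 powr q) \<le> K * h z1"
    using max[of z0] R K by (intro mult_left_mono) (auto simp: h_def)
  ultimately show ?thesis by (simp add: mult.assoc)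
qed

lemma nn_integral_reflect:
  fixes g :: "real \<Rightarrow> ennreal"
  assumes "g \<in> borel_measurable borel"
  shows "(\<integral>\<^sup>+x. g (- x) \<partial>lborel) = (\<integral>\<^sup>+x. g x \<partial>lborel)"
  using nn_integral_real_affine[of g "-1" 0] assms by simp

context dunkl_harmonic
begin

lemma cont_line:
  assumes "0 < y"
  shows "continuous_on UNIV (\<lambda>x. f (x, y))"
  by (rule continuous_on_compose2[OF cont_f])
     (use assms in \<open>auto intro!: continuous_intros simp: upper_half_plane_def\<close>)

lemma measurable_line [measurable]:
  assumes "0 < y"
  shows "(\<lambda>x. f (x, y)) \<in> borel_measurable borel"
  using cont_line[OF assms] by (rule borel_measurable_continuous_onI)

text \<open>The ball of radius \<open>y/2\<close> around \<open>(x, y)\<close> meets only lines at heights comparable with \<open>y\<close>, so the line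
  integrals bound the mass of \<open>sq\<^bsup>p/2\<^esup>\<close> in it by a multiple of \<open>N y\<close>, while the mean value inequality
  divides by \<open>y\<^bsup>2l+2\<^esup>\<close>.\<close>

lemma pointwise_decay:
  assumes p: "0 < p" "p < 2" and N: "0 \<le> N"
    and Lp: "\<And>y. 0 < y \<Longrightarrow> (\<integral>\<^sup>+x. ennreal (\<bar>f (x, y)\<bar> powr p * \<bar>x\<bar> powr (2 * l)) \<partial>lborel) \<le> ennreal N"
  obtains C where "0 \<le> C" "\<And>x y. 0 < y \<Longrightarrow> \<bar>f (x, y)\<bar> powr p \<le> C * y powr (- (2 * l + 1))"
proof -
  define D where "D = 2 + 2 * l"
  define q where "q = p / 2"
  have q: "0 < q" "q < 1" using p by (auto simp: q_def)
  have sqp: "(a\<^sup>2) powr q = \<bar>a\<bar> powr p" for a :: real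
  proof -
    have "a\<^sup>2 = \<bar>a\<bar> powr 2" by (cases "a = 0") (auto simp: powr_numeral)
    then have "(a\<^sup>2) powr q = \<bar>a\<bar> powr (2 * q)" by (simp only: powr_powr)
    then show ?thesis by (simp add: q_def)
  qed
  obtain K where K: "0 < K"
    "\<And>a b r. 0 < r \<Longrightarrow> r < b \<Longrightarrow> ennreal (K * r powr D * sq (a, b)) \<le> sq_mass (ball (a, b) r)"
    unfolding D_def by (rule sq_le_ball_mass) blast
  define C where "C = 2 powr (D / q) * (6 * N) * 2 powr D / K"
  show ?thesis
  proof (rule that)
    show "0 \<le> C" using N K by (simp add: C_def)
    fix x y :: real assume y: "0 < y"
    define R where "R = y / 2"
    have R: "0 < R" using y by (simp add: R_def)
    have half: "\<bar>snd z - y\<bar> \<le> dist (x, y) z" for z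
      using dist_snd_le[of "(x, y)" z] by (simp add: dist_real_def abs_minus_commute)
    have sub_half: "cball (x, y) R \<subseteq> upper_half_plane"
    proof
      fix z assume "z \<in> cball (x, y) R"
      then show "z \<in> upper_half_plane"
        using half[of z] y by (cases z) (auto simp: upper_half_plane_def R_def)
    qed
    define U where "U = {z :: real \<times> real. y / 2 < snd z \<and> snd z < 2 * y}"
    define G where "G z = ennreal (sq z powr q * \<bar>fst z\<bar> powr (2 * l)) * indicator U z" for z
    have "open U" unfolding U_def
      by (intro open_Collect_conj open_Collect_less continuous_intros)
    have "(\<lambda>z. indicator U z *\<^sub>R (sq z powr q * \<bar>fst z\<bar> powr (2 * l))) \<in> borel_measurable borel"
    proof (rule borel_measurable_continuous_on_indicator)
      show "U \<in> sets borel" using \<open>open U\<close> by simp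
      have "U \<subseteq> upper_half_plane" using y by (auto simp: U_def upper_half_plane_def)
      then show "continuous_on U (\<lambda>z. sq z powr q * \<bar>fst z\<bar> powr (2 * l))"
        using q l_pos sq_nonneg
        by (intro continuous_intros continuous_on_powr' continuous_on_subset[OF continuous_on_sq]) auto
    qed
    then have "(\<lambda>z. ennreal (indicator U z *\<^sub>R (sq z powr q * \<bar>fst z\<bar> powr (2 * l)))) \<in> borel_measurable borel"
      by measurable
    also have "(\<lambda>z. ennreal (indicator U z *\<^sub>R (sq z powr q * \<bar>fst z\<bar> powr (2 * l)))) = G"
      by (auto simp: G_def indicator_def)
    finally have G: "G \<in> borel_measurable (lborel \<Otimes>\<^sub>M lborel)"
      by (simp add: lborel_prod)
    have line: "(\<integral>\<^sup>+s. G (s, t) \<partial>lborel) \<le> ennreal (4 * N) * indicator {y / 2..2 * y} t" for t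
    proof (cases "t \<in> {y / 2..2 * y}")
      case True
      then have t: "0 < t" using y by auto
      note [measurable] = measurable_line[OF t]
      let ?g = "\<lambda>s. ennreal (\<bar>f (s, t)\<bar> powr p * \<bar>s\<bar> powr (2 * l))"
      have g [measurable]: "?g \<in> borel_measurable borel" by measurable
      have "(\<integral>\<^sup>+s. G (s, t) \<partial>lborel) \<le> (\<integral>\<^sup>+s. 2 * (?g s + ?g (- s)) \<partial>lborel)"
      proof (intro nn_integral_mono)
        fix s
        have "sq (s, t) powr q \<le> 2 * (\<bar>f (s, t)\<bar> powr p + \<bar>f (- s, t)\<bar> powr p)"
          using powr_add_le_double[of "(f (s, t))\<^sup>2" "(f (- s, t))\<^sup>2" q] q
          by (simp add: sq_def sqp)
        from mult_right_mono[OF this, of "\<bar>s\<bar> powr (2 * l)"]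
        have "sq (s, t) powr q * \<bar>s\<bar> powr (2 * l)
          \<le> 2 * (\<bar>f (s, t)\<bar> powr p * \<bar>s\<bar> powr (2 * l) + \<bar>f (- s, t)\<bar> powr p * \<bar>- s\<bar> powr (2 * l))"
          by (simp add: algebra_simps)
        then have "ennreal (sq (s, t) powr q * \<bar>s\<bar> powr (2 * l)) \<le> 2 * (?g s + ?g (- s))"
          by (simp add: ennreal_plus[symmetric] ennreal_mult''[symmetric] flip: ennreal_numeral del: ennreal_plus)
        then show "G (s, t) \<le> 2 * (?g s + ?g (- s))"
          by (auto simp: G_def indicator_def)
      qed
      also have "\<dots> = 2 * ((\<integral>\<^sup>+s. ?g s \<partial>lborel) + (\<integral>\<^sup>+s. ?g (- s) \<partial>lborel))"
        by (subst nn_integral_cmult, measurable) (subst nn_integral_add, measurable)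
      also have "(\<integral>\<^sup>+s. ?g (- s) \<partial>lborel) = (\<integral>\<^sup>+s. ?g s \<partial>lborel)"
        by (rule nn_integral_reflect[OF g])
      also have "2 * ((\<integral>\<^sup>+s. ?g s \<partial>lborel) + (\<integral>\<^sup>+s. ?g s \<partial>lborel)) \<le> 2 * (ennreal N + ennreal N)"
        by (intro mult_left_mono add_mono Lp t) simp
      also have "\<dots> = ennreal (4 * N)"
        using N by (simp add: ennreal_plus[symmetric] ennreal_mult''[symmetric] flip: ennreal_numeral del: ennreal_plus)
      finally show ?thesis using True by simp
    next
      case False
      then have "G (s, t) = 0" for s by (auto simp: G_def U_def)
      then show ?thesis by simp
    qed
    have "(\<integral>\<^sup>+z. ennreal (sq z powr q * \<bar>fst z\<bar> powr (2 * l)) * indicator (ball (x, y) R) z \<partial>lborel)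
        \<le> (\<integral>\<^sup>+z. G z \<partial>lborel)"
    proof (intro nn_integral_mono)
      fix z
      have "z \<in> U" if "z \<in> ball (x, y) R"
        using that half[of z] y by (auto simp: U_def R_def)
      then show "ennreal (sq z powr q * \<bar>fst z\<bar> powr (2 * l)) * indicator (ball (x, y) R) z \<le> G z"
        by (auto simp: G_def indicator_def)
    qed
    also have "\<dots> = (\<integral>\<^sup>+t. \<integral>\<^sup>+s. G (s, t) \<partial>lborel \<partial>lborel)"
      using lborel_pair.nn_integral_snd[OF G] by (simp add: lborel_prod)
    also have "\<dots> \<le> (\<integral>\<^sup>+t. ennreal (4 * N) * indicator {y / 2..2 * y} t \<partial>lborel)"
      by (intro nn_integral_mono line)
    also have "\<dots> = ennreal (4 * N * (3 / 2 * y))"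
      using y N by (subst nn_integral_cmult) (auto simp: ennreal_mult'[symmetric])
    finally have mass: "(\<integral>\<^sup>+z. ennreal (sq z powr q * \<bar>fst z\<bar> powr (2 * l)) * indicator (ball (x, y) R) z \<partial>lborel)
        \<le> ennreal (4 * N * (3 / 2 * y))" .
    have "K * R powr D * sq (x, y) powr q \<le> 2 powr (D / q) * (4 * N * (3 / 2 * y))"
    proof (rule sub_mean_value_power[where W = "\<lambda>z. \<bar>fst z\<bar> powr (2 * l)"])
      show "continuous_on (cball (x, y) R) sq"
        by (rule continuous_on_subset[OF continuous_on_sq sub_half])
      show "continuous_on (cball (x, y) R) (\<lambda>z. \<bar>fst z\<bar> powr (2 * l))"
        using l_pos by (intro continuous_intros continuous_on_powr') auto
      show "ennreal (K * r powr D * sq z) \<le> (\<integral>\<^sup>+x. ennreal (sq x * \<bar>fst x\<bar> powr (2 * l)) * indicator (ball z r) x \<partial>lborel)"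
        if "0 < r" "dist (x, y) z + r \<le> R" for z r
        using K(2)[of r "snd z" "fst z"] that half[of z] y by (simp add: sq_mass_def R_def)
    qed (use R l_pos q K N y mass sq_nonneg in \<open>auto simp: D_def\<close>)
    moreover have "\<bar>f (x, y)\<bar> powr p \<le> sq (x, y) powr q"
      unfolding sqp[symmetric] sq_def using q by (intro powr_mono2) auto
    then have "K * R powr D * \<bar>f (x, y)\<bar> powr p \<le> K * R powr D * sq (x, y) powr q"
      using K by (intro mult_left_mono) auto
    ultimately have "K * R powr D * \<bar>f (x, y)\<bar> powr p \<le> 2 powr (D / q) * (6 * N * y)"
      by simp
    moreover have "R powr D = y powr D / 2 powr D"
      using y by (simp add: R_def powr_divide)
    moreover have "2 powr (D / q) * (6 * N * y) = y powr D * (2 powr (D / q) * (6 * N) * y powr (- (2 * l + 1)))"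
    proof -
      have "y powr D * (2 powr (D / q) * (6 * N) * y powr (- (2 * l + 1)))
          = 2 powr (D / q) * (6 * N * (y powr D * y powr (- (2 * l + 1))))"
        by (simp only: mult_ac)
      also have "y powr D * y powr (- (2 * l + 1)) = y"
        using y by (simp add: D_def powr_add[symmetric])
      finally show ?thesis ..
    qed
    ultimately have "y powr D * (K / 2 powr D * \<bar>f (x, y)\<bar> powr p)
        \<le> y powr D * (2 powr (D / q) * (6 * N) * y powr (- (2 * l + 1)))"
      by (simp only: times_divide_eq_left times_divide_eq_right mult_ac)
    then have "K / 2 powr D * \<bar>f (x, y)\<bar> powr p \<le> 2 powr (D / q) * (6 * N) * y powr (- (2 * l + 1))"
      using y by (simp only: mult_le_cancel_left_pos powr_gt_zero)
    then show "\<bar>f (x, y)\<bar> powr p \<le> C * y powr (- (2 * l + 1))"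
      using K by (simp add: C_def field_simps)
  qed
qed

text \<open>Write \<open>f\<^sup>2 = \<bar>f\<bar>\<^bsup>p\<^esup> \<bar>f\<bar>\<^bsup>2-p\<^esup>\<close> and use the pointwise decay for the second factor.\<close>

lemma line_square_decay:
  assumes p: "0 < p" "p < 2" and N: "0 \<le> N"
    and Lp: "\<And>y. 0 < y \<Longrightarrow> (\<integral>\<^sup>+x. ennreal (\<bar>f (x, y)\<bar> powr p * \<bar>x\<bar> powr (2 * l)) \<partial>lborel) \<le> ennreal N"
  obtains C where "0 \<le> C" "\<And>y. 0 < y \<Longrightarrow>
    (\<integral>\<^sup>+x. ennreal ((f (x, y))\<^sup>2 * \<bar>x\<bar> powr (2 * l)) \<partial>lborel)
      \<le> ennreal (C * y powr (- (2 * l + 1) * ((2 - p) / p)))"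
proof -
  obtain C where C: "0 \<le> C" "\<And>x y. 0 < y \<Longrightarrow> \<bar>f (x, y)\<bar> powr p \<le> C * y powr (- (2 * l + 1))"
    using pointwise_decay[of p N] p N Lp by auto
  define \<alpha> where "\<alpha> = (2 - p) / p"
  define \<gamma> where "\<gamma> = - (2 * l + 1) * \<alpha>"
  have \<alpha>: "0 < \<alpha>" using p by (simp add: \<alpha>_def)
  have line: "(\<integral>\<^sup>+x. ennreal ((f (x, y))\<^sup>2 * \<bar>x\<bar> powr (2 * l)) \<partial>lborel) \<le> ennreal (C powr \<alpha> * N * y powr \<gamma>)"
    if y: "0 < y" for y
  proof -
    note [measurable] = measurable_line[OF y]
    have sq: "(f (x, y))\<^sup>2 \<le> C powr \<alpha> * y powr \<gamma> * \<bar>f (x, y)\<bar> powr p" for x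
    proof -
      have "(f (x, y))\<^sup>2 = \<bar>f (x, y)\<bar> powr (p * \<alpha> + p)"
        using p by (cases "f (x, y) = 0") (auto simp: \<alpha>_def powr_numeral)
      also have "\<dots> = (\<bar>f (x, y)\<bar> powr p) powr \<alpha> * \<bar>f (x, y)\<bar> powr p"
        by (simp add: powr_add powr_powr)
      also have "\<dots> \<le> (C * y powr (- (2 * l + 1))) powr \<alpha> * \<bar>f (x, y)\<bar> powr p"
        using C y \<alpha> by (intro mult_right_mono powr_mono2) auto
      also have "(C * y powr (- (2 * l + 1))) powr \<alpha> = C powr \<alpha> * y powr \<gamma>"
        using C y by (simp add: powr_mult powr_powr \<gamma>_def)
      finally show ?thesis .
    qed
    have "(\<integral>\<^sup>+x. ennreal ((f (x, y))\<^sup>2 * \<bar>x\<bar> powr (2 * l)) \<partial>lborel)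
      \<le> (\<integral>\<^sup>+x. ennreal (C powr \<alpha> * y powr \<gamma>) * ennreal (\<bar>f (x, y)\<bar> powr p * \<bar>x\<bar> powr (2 * l)) \<partial>lborel)"
      using sq by (intro nn_integral_mono)
        (auto simp: ennreal_mult'[symmetric] mult.assoc[symmetric] intro!: ennreal_leI mult_right_mono)
    also have "\<dots> = ennreal (C powr \<alpha> * y powr \<gamma>) * (\<integral>\<^sup>+x. ennreal (\<bar>f (x, y)\<bar> powr p * \<bar>x\<bar> powr (2 * l)) \<partial>lborel)"
      by (intro nn_integral_cmult) measurable
    also have "\<dots> \<le> ennreal (C powr \<alpha> * y powr \<gamma>) * ennreal N"
      by (intro mult_left_mono Lp y) simp
    also have "\<dots> = ennreal (C powr \<alpha> * N * y powr \<gamma>)"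
      using N by (simp add: ennreal_mult'[symmetric] mult_ac)
    finally show ?thesis .
  qed
  show ?thesis
    by (rule that[of "C powr \<alpha> * N"]) (use N line in \<open>auto simp: \<gamma>_def \<alpha>_def\<close>)
qed

end

section \<open>The weighted Cauchy identity on graphs\<close>

text \<open>Used with \<open>\<eta> = \<infinity>\<close> on a bounded interval and with finite \<open>\<eta>\<close> on a half line.\<close>

lemma exists_small_value:
  fixes h :: "real \<Rightarrow> ennreal"
  assumes "A \<in> sets borel" "(\<integral>\<^sup>+t. h t * indicator A t \<partial>lborel) < \<infinity>" "\<eta> * emeasure lborel A = \<infinity>"
  shows "\<exists>t\<in>A. h t < \<eta>"
proof (rule ccontr)
  assume "\<not> ?thesis"
  then have "\<eta> * indicator A t \<le> h t * indicator A t" for t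
    by (auto simp: indicator_def not_less)
  then have "(\<integral>\<^sup>+t. \<eta> * indicator A t \<partial>lborel) \<le> (\<integral>\<^sup>+t. h t * indicator A t \<partial>lborel)"
    by (intro nn_integral_mono)
  moreover have "(\<integral>\<^sup>+t. \<eta> * indicator A t \<partial>lborel) = \<infinity>"
    using assms by (subst nn_integral_cmult_indicator) auto
  ultimately show False using assms(2) by simp
qed

lemma emeasure_lborel_atLeast: "emeasure lborel {a::real..} = \<infinity>"
proof -
  have "ennreal r \<le> emeasure lborel {a..}" if "0 \<le> r" for r :: real
    using emeasure_mono[of "{a..a + r}" "{a..}" lborel] that by auto
  then show ?thesis
  proof (cases "emeasure lborel {a..}")
    case (real r)
    then have "ennreal (r + 1) \<le> ennreal r" using \<open>\<And>r. 0 \<le> r \<Longrightarrow> ennreal r \<le> emeasure lborel {a..}\<close>[of "r + 1"] by simp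
    then show ?thesis using real by simp
  qed simp
qed

text \<open>The two equations are \<open>D\<^sub>x u = \<partial>\<^sub>y v\<close> and \<open>\<partial>\<^sub>y u = - D\<^sub>x v\<close>, written out away from the axis.\<close>

locale dunkl_pair =
  u: dunkl_harmonic l u ux uy uxx uyy uxy + v: dunkl_harmonic l v vx vy vxx vyy vxy
  for l :: real and u ux uy uxx uyy uxy v vx vy vxx vyy vxy +
  assumes cr1: "\<And>x y. 0 < y \<Longrightarrow> x \<noteq> 0 \<Longrightarrow>
      ux (x, y) + l / x * (u (x, y) - u (- x, y)) = vy (x, y)"
    and cr2: "\<And>x y. 0 < y \<Longrightarrow> x \<noteq> 0 \<Longrightarrow>
      uy (x, y) + (vx (x, y) + l / x * (v (x, y) - v (- x, y))) = 0"
begin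

definition w :: "real \<Rightarrow> real" where "w x = \<bar>x\<bar> powr (2 * l)"

text \<open>\<open>A\<close> and \<open>B\<close> are symmetrised versions of the real and imaginary parts of \<open>(u + i v)\<^sup>2\<close>; the reflected
  terms carry the sign that makes \<open>A\<close> even and \<open>B\<close> odd in \<open>x\<close>.\<close>

definition A :: "real \<times> real \<Rightarrow> real" where "A z = u.sq z - v.sq z"

definition A_y :: "real \<times> real \<Rightarrow> real" where "A_y z = u.sq_y z - v.sq_y z"

definition B :: "real \<times> real \<Rightarrow> real" where
  "B z = 2 * (u z * v z) - 2 * (u (- fst z, snd z) * v (- fst z, snd z))"

definition B_x :: "real \<times> real \<Rightarrow> real" where
  "B_x z = 2 * (ux z * v z + u z * vx z)
     + 2 * (ux (- fst z, snd z) * v (- fst z, snd z) + u (- fst z, snd z) * vx (- fst z, snd z))"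

definition B_y :: "real \<times> real \<Rightarrow> real" where
  "B_y z = 2 * (uy z * v z + u z * vy z)
     - 2 * (uy (- fst z, snd z) * v (- fst z, snd z) + u (- fst z, snd z) * vy (- fst z, snd z))"

definition strip_mass :: "real \<Rightarrow> ennreal" where
  "strip_mass e = (\<integral>\<^sup>+y. (\<integral>\<^sup>+x. ennreal (w x * (u.sq (x, y) + v.sq (x, y))) \<partial>lborel) * indicator {e..} y \<partial>lborel)"

text \<open>The square of a \<open>\<lambda>\<close>-analytic function need not be \<open>\<lambda>\<close>-analytic, but after symmetrisation the vector field
  \<open>\<bar>x\<bar>\<^bsup>2l\<^esup> (B, A)\<close> is still divergence free: the nonlocal contributions at \<open>x\<close> and \<open>- x\<close> cancel. This is what
  survives of Cauchy's theorem for \<open>(u + i v)\<^sup>2\<close>.\<close>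

lemma divergence_free:
  assumes y: "0 < y" and x: "x \<noteq> 0"
  shows "A_y (x, y) + B_x (x, y) + 2 * l / x * B (x, y) = 0"
proof -
  define m where "m = l / x"
  have 1: "vy (x, y) = ux (x, y) + m * (u (x, y) - u (- x, y))"
    "uy (x, y) = - vx (x, y) - m * (v (x, y) - v (- x, y))"
    using cr1[OF y x] cr2[OF y x] by (simp_all add: m_def)
  have 2: "vy (- x, y) = ux (- x, y) + m * (u (x, y) - u (- x, y))"
    "uy (- x, y) = - vx (- x, y) - m * (v (x, y) - v (- x, y))"
    using cr1[OF y, of "- x"] cr2[OF y, of "- x"] x by (simp_all add: m_def algebra_simps)
  have "A_y (x, y) + B_x (x, y) + 2 * m * B (x, y) = 0"
    unfolding A_y_def B_x_def B_def u.sq_y_def v.sq_y_def fst_conv snd_conv 1 2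
    by (simp add: algebra_simps)
  then show ?thesis by (simp add: m_def)
qed

lemma has_deriv_A:
  assumes y: "0 < y"
  shows "(A has_derivative (\<lambda>h. (u.sq_x (x, y) - v.sq_x (x, y)) * fst h + A_y (x, y) * snd h)) (at (x, y))"
  using has_derivative_diff[OF u.has_deriv_sq[OF y] v.has_deriv_sq[OF y]]
  unfolding A_def[abs_def]
  by (rule has_derivative_eq_rhs) (auto simp: A_y_def algebra_simps)

lemma has_deriv_B:
  assumes y: "0 < y"
  shows "(B has_derivative (\<lambda>h. B_x (x, y) * fst h + B_y (x, y) * snd h)) (at (x, y))"
  using has_derivative_diff[OF
      has_derivative_mult_right[OF has_derivative_mult[OF u.has_deriv[OF y] v.has_deriv[OF y]], of 2]
      has_derivative_mult_right[OF has_derivative_mult[OF u.has_deriv_reflect[OF y] v.has_deriv_reflect[OF y]], of 2]]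
  unfolding B_def[abs_def]
  by (rule has_derivative_eq_rhs) (auto simp: B_x_def B_y_def algebra_simps)

lemma continuous_on_AB:
  "continuous_on upper_half_plane A" "continuous_on upper_half_plane A_y"
  "continuous_on upper_half_plane B" "continuous_on upper_half_plane B_y"
  unfolding A_def A_y_def B_def B_y_def
  by (intro continuous_intros u.cont_reflected v.cont_reflected u.continuous_on_sq v.continuous_on_sq
      u.continuous_on_sq_y v.continuous_on_sq_y)+

lemma abs_A_le: "\<bar>A z\<bar> \<le> u.sq z + v.sq z"
  using u.sq_nonneg[of z] v.sq_nonneg[of z] by (simp add: A_def)

lemma abs_B_le: "\<bar>B z\<bar> \<le> u.sq z + v.sq z" and abs_B_le': "\<bar>B z\<bar> \<le> 2 * u.sq z + v.sq z / 2"
proof -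
  have *: "\<bar>2 * (a * b)\<bar> \<le> a\<^sup>2 + b\<^sup>2" "\<bar>2 * (a * b)\<bar> \<le> 2 * a\<^sup>2 + b\<^sup>2 / 2" for a b :: real
  proof -
    have "0 \<le> (\<bar>a\<bar> - \<bar>b\<bar>)\<^sup>2" "0 \<le> (2 * \<bar>a\<bar> - \<bar>b\<bar>)\<^sup>2" by simp_all
    then show "\<bar>2 * (a * b)\<bar> \<le> a\<^sup>2 + b\<^sup>2" "\<bar>2 * (a * b)\<bar> \<le> 2 * a\<^sup>2 + b\<^sup>2 / 2"
      by (simp_all add: power2_eq_square algebra_simps abs_mult)
  qed
  show "\<bar>B z\<bar> \<le> u.sq z + v.sq z"
    unfolding B_def u.sq_def v.sq_def
    using *(1)[of "u z" "v z"] *(1)[of "u (- fst z, snd z)" "v (- fst z, snd z)"] by linarith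
  show "\<bar>B z\<bar> \<le> 2 * u.sq z + v.sq z / 2"
    unfolding B_def u.sq_def v.sq_def
    using *(2)[of "u z" "v z"] *(2)[of "u (- fst z, snd z)" "v (- fst z, snd z)"] by (simp add: add_divide_distrib)
qed

lemma cont_compose_half_plane:
  fixes g :: "real \<times> real \<Rightarrow> real" and p :: "'c::topological_space \<Rightarrow> real \<times> real"
  assumes "continuous_on upper_half_plane g" "continuous_on X p" "\<And>x. x \<in> X \<Longrightarrow> 0 < snd (p x)"
  shows "continuous_on X (\<lambda>x. g (p x))"
  by (rule continuous_on_compose2[OF assms(1,2)]) (use assms(3) in \<open>force simp: upper_half_plane_def\<close>)

end

text \<open>The graph of \<open>\<psi>\<close> and its vertical translates serve as contours. The slope bound \<open>1\<close> corresponds to the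
  aperture of the cones in the maximal function.\<close>

locale dunkl_graph = dunkl_pair +
  fixes \<psi> \<psi>' :: "real \<Rightarrow> real" and e :: real
  assumes e_pos: "0 < e" and \<psi>_ge: "\<And>x. e \<le> \<psi> x"
    and d\<psi>: "\<And>x. (\<psi> has_real_derivative \<psi>' x) (at x)"
    and cont\<psi>': "continuous_on UNIV \<psi>'"
    and abs\<psi>': "\<And>x. \<bar>\<psi>' x\<bar> \<le> 1"
begin

text \<open>\<open>F t\<close> is the density with respect to \<open>dx\<close> of the flux of \<open>\<bar>x\<bar>\<^bsup>2l\<^esup> (B, A)\<close> through the graph of \<open>\<psi> + t\<close>.\<close>

definition F :: "real \<Rightarrow> real \<Rightarrow> real" where
  "F t x = w x * (A (x, \<psi> x + t) - \<psi>' x * B (x, \<psi> x + t))"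

definition b :: "real \<Rightarrow> real \<Rightarrow> real" where
  "b t x = w x * B (x, \<psi> x + t)"

lemma w_nonneg: "0 \<le> w x" by (simp add: w_def)

lemma cont_w: "continuous_on X w"
  unfolding w_def using u.l_pos by (intro continuous_intros continuous_on_powr') auto

lemma cont_\<psi>: "continuous_on X \<psi>"
  by (rule continuous_on_subset[of UNIV], rule DERIV_continuous_on) (use d\<psi> in \<open>auto intro: has_field_derivative_at_within\<close>)

lemma \<psi>_pos: "0 \<le> t \<Longrightarrow> 0 < \<psi> x + t"
  using \<psi>_ge[of x] e_pos by linarith

text \<open>In the coordinates \<open>(x, t) \<mapsto> (x, \<psi> x + t)\<close> the vanishing of the divergence reads \<open>\<partial>\<^sub>t F = - \<partial>\<^sub>x b\<close>, so the flux
  through two translates of the graph differs only by what crosses the vertical sides.\<close>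

lemma flux_identity:
  assumes t: "0 \<le> t" "t \<le> t'" and X: "0 \<le> X"
  shows "((\<lambda>s. b s X - b s (- X)) has_integral
     integral {-X..X} (F t) - integral {-X..X} (F t')) {t..t'}"
proof -
  define Fy where "Fy s x = w x * (A_y (x, \<psi> x + s) - \<psi>' x * B_y (x, \<psi> x + s))" for s x
  have c1: "continuous_on {-X..X} (\<lambda>x. g (x, \<psi> x + s))"
    if "continuous_on upper_half_plane g" "0 \<le> s" for g :: "real \<times> real \<Rightarrow> real" and s
    by (rule cont_compose_half_plane[OF that(1)])
       (use that(2) in \<open>auto intro!: continuous_intros cont_\<psi> simp: \<psi>_pos\<close>)
  have slice: "integral {-X..X} (Fy s) = - (b s X - b s (- X))" if s: "0 \<le> s" for s
  proof -
    have "((\<lambda>x. - Fy s x) has_integral b s X - b s (- X)) {-X..X}"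
    proof (rule fundamental_theorem_of_calculus_interior_strong[where S = "{0}"])
      show "continuous_on {-X..X} (b s)"
        unfolding b_def[abs_def] by (intro continuous_on_mult cont_w c1 continuous_on_AB s)
      fix x assume x: "x \<in> {-X<..<X} - {0}"
      have p: "((\<lambda>x. (x, \<psi> x + s)) has_derivative (\<lambda>h. (h, \<psi>' x * h))) (at x)"
        using d\<psi>[of x] unfolding has_field_derivative_def
        by (intro has_derivative_Pair has_derivative_ident) (auto intro!: derivative_eq_intros)
      from has_derivative_compose[OF p has_deriv_B[OF \<psi>_pos[OF s]]]
      have dB: "((\<lambda>x. B (x, \<psi> x + s)) has_real_derivative
          B_x (x, \<psi> x + s) + \<psi>' x * B_y (x, \<psi> x + s)) (at x)"
        unfolding has_field_derivative_def
        by (rule has_derivative_eq_rhs) (auto simp: algebra_simps)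
      have dw: "(w has_real_derivative 2 * l / x * w x) (at x)"
        unfolding w_def by (rule DERIV_abs_powr) (use x in auto)
      have eq: "2 * l / x * B (x, \<psi> x + s) + B_x (x, \<psi> x + s) = - A_y (x, \<psi> x + s)"
        using divergence_free[OF \<psi>_pos[OF s], of x x] x by simp
      have "(b s has_real_derivative
          w x * ((2 * l / x * B (x, \<psi> x + s) + B_x (x, \<psi> x + s)) + \<psi>' x * B_y (x, \<psi> x + s))) (at x)"
        unfolding b_def
        by (rule DERIV_cong[OF DERIV_mult[OF dw dB]]) (simp add: algebra_simps)
      then have "(b s has_real_derivative - Fy s x) (at x)"
        unfolding eq by (simp add: Fy_def algebra_simps)
      then show "(b s has_vector_derivative - Fy s x) (at x)"
        by (simp add: has_real_derivative_iff_has_vector_derivative)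
    qed (use X in auto)
    then have "integral {-X..X} (\<lambda>x. - Fy s x) = b s X - b s (- X)"
      by (rule integral_unique)
    then show ?thesis by simp
  qed
  have cp: "continuous_on ({t..t'} \<times> cbox (- X) X) (\<lambda>z. g (snd z, \<psi> (snd z) + fst z))"
    if "continuous_on upper_half_plane g" for g :: "real \<times> real \<Rightarrow> real"
    by (rule cont_compose_half_plane[OF that])
       (use t in \<open>auto intro!: continuous_intros continuous_on_compose2[OF cont_\<psi>[of UNIV]] simp: \<psi>_pos\<close>)
  have deriv: "((\<lambda>s. integral (cbox (- X) X) (F s)) has_real_derivative integral (cbox (- X) X) (Fy s)) (at s within {t..t'})"
    if s: "s \<in> {t..t'}" for s
  proof (rule leibniz_rule_field_derivative[OF _ _ _ s])
    fix r x assume r: "r \<in> {t..t'}" and x: "x \<in> cbox (- X) X"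
    have pos: "0 < \<psi> x + r" using r t by (intro \<psi>_pos) auto
    have sh: "((\<lambda>r. \<psi> x + r) has_real_derivative 1) (at r)"
      by (auto intro!: derivative_eq_intros)
    have 1: "((\<lambda>r. A (x, \<psi> x + r)) has_real_derivative A_y (x, \<psi> x + r)) (at r)"
      using DERIV_chain2[where f = "\<lambda>y. A (x, y)" and g = "\<lambda>r. \<psi> x + r", OF has_derivative_imp_partial_y[OF has_deriv_A[OF pos]] sh] by simp
    have 2: "((\<lambda>r. B (x, \<psi> x + r)) has_real_derivative B_y (x, \<psi> x + r)) (at r)"
      using DERIV_chain2[where f = "\<lambda>y. B (x, y)" and g = "\<lambda>r. \<psi> x + r", OF has_derivative_imp_partial_y[OF has_deriv_B[OF pos]] sh] by simp
    show "((\<lambda>r. F r x) has_real_derivative Fy r x) (at r within {t..t'})"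
      unfolding F_def Fy_def
      by (intro has_field_derivative_at_within[OF DERIV_cmult[OF DERIV_diff[OF 1 DERIV_cmult[OF 2]]]])
  next
    fix r assume "r \<in> {t..t'}"
    then show "F r integrable_on cbox (- X) X"
      unfolding F_def[abs_def] using t
      by (intro integrable_continuous)
         (auto intro!: continuous_on_mult continuous_on_diff cont_w c1 continuous_on_AB continuous_on_subset[OF cont\<psi>'])
  next
    show "continuous_on ({t..t'} \<times> cbox (- X) X) (\<lambda>(r, x). Fy r x)"
      unfolding Fy_def split_beta
      by (intro continuous_intros cp continuous_on_AB continuous_on_compose2[OF cont_w[of UNIV]]
          continuous_on_compose2[OF cont\<psi>']) auto
  qed auto
  have "(integral {-X..X} \<circ> Fy has_integral integral {-X..X} (F t') - integral {-X..X} (F t)) {t..t'}"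
    using t(2) deriv
    by (intro fundamental_theorem_of_calculus)
       (auto simp: has_real_derivative_iff_has_vector_derivative[symmetric])
  then have "((\<lambda>s. - (b s X - b s (- X))) has_integral integral {-X..X} (F t') - integral {-X..X} (F t)) {t..t'}"
    by (rule has_integral_eq[rotated]) (use slice t in auto)
  from has_integral_neg[OF this] show ?thesis by simp
qed

end

section \<open>Comparison of conjugate functions on a Lipschitz graph\<close>

context dunkl_graph
begin

definition S :: "real \<times> real \<Rightarrow> real" where "S z = u.sq z + v.sq z"

text \<open>Finiteness of \<open>strip_mass\<close> controls \<open>line_mass\<close> and \<open>column_mass\<close> only in the mean, so good heights and good
  vertical sides have to be selected.\<close>

definition line_mass :: "real \<Rightarrow> ennreal" where
  "line_mass t = (\<integral>\<^sup>+x. ennreal (w x * S (x, \<psi> x + t)) \<partial>lborel)"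

definition column_mass :: "real \<Rightarrow> ennreal" where
  "column_mass x = (\<integral>\<^sup>+t. ennreal (w x * S (x, \<psi> x + t)) * indicator {0..} t \<partial>lborel)"

lemma S_nonneg: "0 \<le> S z"
  by (simp add: S_def u.sq_nonneg v.sq_nonneg)

lemma continuous_on_S: "continuous_on upper_half_plane S"
  unfolding S_def by (intro continuous_intros u.continuous_on_sq v.continuous_on_sq)

lemma abs_F_le: "\<bar>F t x\<bar> \<le> 2 * (w x * S (x, \<psi> x + t))"
proof -
  have "\<bar>A (x, \<psi> x + t) - \<psi>' x * B (x, \<psi> x + t)\<bar> \<le> \<bar>A (x, \<psi> x + t)\<bar> + \<bar>\<psi>' x\<bar> * \<bar>B (x, \<psi> x + t)\<bar>"
    by (simp add: abs_mult[symmetric])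
  also have "\<dots> \<le> S (x, \<psi> x + t) + 1 * S (x, \<psi> x + t)"
    unfolding S_def by (intro add_mono mult_mono abs_A_le abs_B_le abs\<psi>') auto
  finally show ?thesis
    unfolding F_def abs_mult using w_nonneg[of x] mult_left_mono by fastforce
qed

lemma F_le: "F t x \<le> 3 * (w x * u.sq (x, \<psi> x + t)) - (w x * v.sq (x, \<psi> x + t)) / 2"
proof -
  have "- (\<psi>' x * B (x, \<psi> x + t)) \<le> \<bar>\<psi>' x\<bar> * \<bar>B (x, \<psi> x + t)\<bar>"
    by (metis abs_ge_minus_self abs_mult)
  also have "\<dots> \<le> 1 * (2 * u.sq (x, \<psi> x + t) + v.sq (x, \<psi> x + t) / 2)"
    by (intro mult_mono abs_B_le' abs\<psi>') auto
  finally have "A (x, \<psi> x + t) - \<psi>' x * B (x, \<psi> x + t)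
      \<le> 3 * u.sq (x, \<psi> x + t) - v.sq (x, \<psi> x + t) / 2"
    by (simp add: A_def)
  from mult_left_mono[OF this w_nonneg[of x]] show ?thesis
    by (simp add: F_def algebra_simps)
qed

lemma abs_b_le: "\<bar>b t x\<bar> \<le> w x * S (x, \<psi> x + t)"
  unfolding b_def S_def abs_mult using w_nonneg[of x] by (auto intro!: mult_left_mono abs_B_le)

lemma cont_graph:
  assumes "continuous_on upper_half_plane g" "0 \<le> t"
  shows "continuous_on UNIV (\<lambda>x. g (x, \<psi> x + t) :: real)"
  by (rule cont_compose_half_plane[OF assms(1)])
     (use assms(2) in \<open>auto intro!: continuous_intros cont_\<psi> simp: \<psi>_pos\<close>)

lemma measurable_F: "0 \<le> t \<Longrightarrow> F t \<in> borel_measurable borel"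
  unfolding F_def[abs_def]
  by (intro borel_measurable_continuous_onI continuous_on_mult continuous_on_diff cont_w cont\<psi>'
      cont_graph continuous_on_AB)

text \<open>Truncating the height at \<open>e\<close> makes the density continuous on the whole plane, hence Borel, without
  changing it above the graph.\<close>

definition H :: "real \<times> real \<Rightarrow> ennreal" where
  "H z = ennreal (w (fst z) * S (fst z, max (snd z) e))"

lemma measurable_H [measurable]: "H \<in> borel_measurable borel"
proof -
  have "continuous_on UNIV (\<lambda>z. w (fst z) * S (fst z, max (snd z) e))"
    by (intro continuous_on_mult cont_compose_half_plane[OF continuous_on_S]
        continuous_on_compose2[OF cont_w[of UNIV]])
       (use e_pos in \<open>auto intro!: continuous_intros\<close>)
  then have "(\<lambda>z. w (fst z) * S (fst z, max (snd z) e)) \<in> borel_measurable borel"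
    by (rule borel_measurable_continuous_onI)
  then show ?thesis unfolding H_def by measurable
qed

lemma measurable_H_pair [measurable]: "H \<in> borel_measurable (borel \<Otimes>\<^sub>M borel)"
  by (simp add: borel_prod)

lemma measurable_\<psi> [measurable]: "\<psi> \<in> borel_measurable borel"
  by (rule borel_measurable_continuous_onI[OF cont_\<psi>])

lemma H_graph: "0 \<le> t \<Longrightarrow> H (x, \<psi> x + t) = ennreal (w x * S (x, \<psi> x + t))"
  using \<psi>_ge[of x] by (simp add: H_def max_absorb1)

lemma line_mass_eq: "line_mass t * indicator {0..} t = (\<integral>\<^sup>+x. H (x, \<psi> x + t) * indicator {0..} t \<partial>lborel)"
  by (cases "0 \<le> t") (simp_all add: line_mass_def H_graph)

lemma column_mass_eq: "column_mass x = (\<integral>\<^sup>+t. H (x, \<psi> x + t) * indicator {0..} t \<partial>lborel)"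
  unfolding column_mass_def by (intro nn_integral_cong) (auto simp: H_graph indicator_def)

lemma measurable_graph_density:
  "(\<lambda>z. H (fst z, \<psi> (fst z) + snd z) * indicator {0..} (snd z)) \<in> borel_measurable (lborel \<Otimes>\<^sub>M lborel)"
  by measurable

lemma measurable_column_mass [measurable]: "column_mass \<in> borel_measurable borel"
proof -
  have "(\<lambda>x. \<integral>\<^sup>+t. H (x, \<psi> x + t) * indicator {0..} t \<partial>lborel) \<in> borel_measurable lborel"
    using lborel.borel_measurable_nn_integral_fst[OF measurable_graph_density] by simp
  then show ?thesis unfolding column_mass_eq[abs_def] by simp
qed

lemma column_mass_finite:
  assumes "strip_mass e < \<infinity>"
  shows "(\<integral>\<^sup>+x. column_mass x \<partial>lborel) < \<infinity>"
proof -
  have "column_mass x \<le> (\<integral>\<^sup>+y. H (x, y) * indicator {e..} y \<partial>lborel)" for x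
  proof -
    have "column_mass x \<le> (\<integral>\<^sup>+t. H (x, \<psi> x + 1 * t) * indicator {e..} (\<psi> x + 1 * t) \<partial>lborel)"
      unfolding column_mass_eq using \<psi>_ge[of x]
      by (intro nn_integral_mono) (auto simp: indicator_def)
    also have "\<dots> = (\<integral>\<^sup>+y. H (x, y) * indicator {e..} y \<partial>lborel)"
      by (subst nn_integral_real_affine[of "\<lambda>y. H (x, y) * indicator {e..} y" 1 "\<psi> x"]) simp_all
    finally show ?thesis .
  qed
  then have "(\<integral>\<^sup>+x. column_mass x \<partial>lborel) \<le> (\<integral>\<^sup>+x. \<integral>\<^sup>+y. H (x, y) * indicator {e..} y \<partial>lborel \<partial>lborel)"
    by (intro nn_integral_mono)
  also have "\<dots> = (\<integral>\<^sup>+y. \<integral>\<^sup>+x. H (x, y) * indicator {e..} y \<partial>lborel \<partial>lborel)"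
  proof -
    have "(\<lambda>z. H z * indicator {e..} (snd z)) \<in> borel_measurable (lborel \<Otimes>\<^sub>M lborel)"
      by measurable
    from lborel_pair.Fubini[OF this] show ?thesis by simp
  qed
  also have "\<dots> = (\<integral>\<^sup>+y. (\<integral>\<^sup>+x. ennreal (w x * S (x, y)) \<partial>lborel) * indicator {e..} y \<partial>lborel)"
    by (intro nn_integral_cong) (auto simp: indicator_def H_def max_absorb1)
  finally show ?thesis using assms unfolding strip_mass_def S_def by simp
qed

lemma line_mass_finite:
  assumes "strip_mass e < \<infinity>"
  shows "(\<integral>\<^sup>+t. line_mass t * indicator {0..} t \<partial>lborel) < \<infinity>"
  using lborel_pair.Fubini[OF measurable_graph_density] column_mass_finite[OF assms]
  unfolding column_mass_eq line_mass_eq by simp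

lemma integrable_F:
  assumes "0 \<le> t" "line_mass t < \<infinity>"
  shows "integrable lborel (F t)"
    and "ennreal \<bar>LINT x|lborel. F t x\<bar> \<le> 2 * line_mass t"
proof -
  have [measurable]: "F t \<in> borel_measurable borel" by (rule measurable_F[OF assms(1)])
  have [measurable]: "(\<lambda>x. w x * S (x, \<psi> x + t)) \<in> borel_measurable borel"
    by (intro borel_measurable_continuous_onI continuous_on_mult cont_w cont_graph continuous_on_S assms)
  have le: "(\<integral>\<^sup>+x. ennreal (norm (F t x)) \<partial>lborel) \<le> 2 * line_mass t"
  proof -
    have "(\<integral>\<^sup>+x. ennreal (norm (F t x)) \<partial>lborel) \<le> (\<integral>\<^sup>+x. ennreal 2 * ennreal (w x * S (x, \<psi> x + t)) \<partial>lborel)"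
      using abs_F_le by (intro nn_integral_mono) (auto simp: ennreal_mult'[symmetric] simp del: ennreal_numeral intro!: ennreal_leI)
    also have "\<dots> = 2 * line_mass t"
      unfolding line_mass_def by (subst nn_integral_cmult) auto
    finally show ?thesis .
  qed
  also have "\<dots> < \<infinity>" using assms(2) by (simp add: ennreal_mult_less_top)
  finally show i: "integrable lborel (F t)"
    by (intro integrableI_bounded) auto
  show "ennreal \<bar>LINT x|lborel. F t x\<bar> \<le> 2 * line_mass t"
    using integral_norm_bound_ennreal[OF i] le by simp
qed

lemma flux_bound:
  assumes t: "0 \<le> t" "t \<le> t'" and X: "0 \<le> X"
  shows "ennreal \<bar>integral {-X..X} (F t) - integral {-X..X} (F t')\<bar> \<le> column_mass X + column_mass (- X)"
proof -
  define g where "g s = w X * S (X, \<psi> X + s) + w (- X) * S (- X, \<psi> (- X) + s)" for s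
  have contS: "continuous_on {t..t'} (\<lambda>s. S (x, \<psi> x + s))" for x
    by (rule cont_compose_half_plane[OF continuous_on_S])
       (use t in \<open>auto intro!: continuous_intros simp: \<psi>_pos\<close>)
  have cg: "continuous_on {t..t'} g"
    unfolding g_def by (intro continuous_intros contS)
  have g: "(g has_integral integral {t..t'} g) {t..t'}"
    by (intro integrable_integral integrable_continuous_real cg)
  have flux: "\<bar>b s X - b s (- X)\<bar> \<le> g s" for s
    unfolding g_def using abs_b_le[of s X] abs_b_le[of s "- X"] by linarith
  note I = flux_identity[OF assms]
  have "norm (integral {t..t'} (\<lambda>s. b s X - b s (- X))) \<le> integral {t..t'} g"
    by (rule integral_norm_bound_integral) (use I g flux in \<open>auto simp: integrable_on_def\<close>)
  then have "ennreal \<bar>integral {-X..X} (F t) - integral {-X..X} (F t')\<bar> \<le> ennreal (integral {t..t'} g)"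
    using integral_unique[OF I] by (simp add: ennreal_leI)
  also have "\<dots> = (\<integral>\<^sup>+s. ennreal (g s) * indicator {t..t'} s \<partial>lborel)"
    by (rule nn_integral_has_integral_lebesgue'[symmetric, OF _ g]) (use flux in \<open>auto intro: order_trans[OF abs_ge_zero]\<close>)
  also have "\<dots> \<le> (\<integral>\<^sup>+s. H (X, \<psi> X + s) * indicator {0..} s + H (- X, \<psi> (- X) + s) * indicator {0..} s \<partial>lborel)"
  proof (intro nn_integral_mono)
    fix s
    show "ennreal (g s) * indicator {t..t'} s
      \<le> H (X, \<psi> X + s) * indicator {0..} s + H (- X, \<psi> (- X) + s) * indicator {0..} s"
      using t by (cases "s \<in> {t..t'}") (auto simp: H_graph g_def S_nonneg w_nonneg)
  qed
  also have "\<dots> = column_mass X + column_mass (- X)"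
    unfolding column_mass_eq by (subst nn_integral_add) auto
  finally show ?thesis .
qed

text \<open>The flux through the vertical sides is bounded by \<open>column_mass\<close>, which is integrable and hence
  arbitrarily small along some sequence of abscissae tending to infinity.\<close>

lemma integral_F_eq:
  assumes fin: "strip_mass e < \<infinity>" and t: "0 \<le> t" "t \<le> t'" "line_mass t < \<infinity>" "line_mass t' < \<infinity>"
  shows "(LINT x|lborel. F t x) = (LINT x|lborel. F t' x)"
proof -
  have t': "0 \<le> t'" using t by simp
  have "\<exists>X\<in>{real n..}. column_mass X + column_mass (- X) < ennreal (1 / Suc n)" for n
  proof (rule exists_small_value)
    have "(\<integral>\<^sup>+X. (column_mass X + column_mass (- X)) * indicator {real n..} X \<partial>lborel)
        \<le> (\<integral>\<^sup>+X. column_mass X + column_mass (- X) \<partial>lborel)"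
      by (intro nn_integral_mono) (auto simp: indicator_def)
    also have "\<dots> = (\<integral>\<^sup>+X. column_mass X \<partial>lborel) + (\<integral>\<^sup>+X. column_mass (- X) \<partial>lborel)"
      by (intro nn_integral_add) measurable
    also have "\<dots> < \<infinity>"
      using column_mass_finite[OF fin] by (simp add: nn_integral_reflect)
    finally show "(\<integral>\<^sup>+X. (column_mass X + column_mass (- X)) * indicator {real n..} X \<partial>lborel) < \<infinity>" .
  qed (auto simp: emeasure_lborel_atLeast ennreal_mult_eq_top_iff)
  then obtain X where X: "\<And>n. real n \<le> X n" "\<And>n. column_mass (X n) + column_mass (- X n) < ennreal (1 / Suc n)"
    unfolding Bex_def atLeast_iff by metis
  have lim: "(\<lambda>n. integral {- X n..X n} (F s)) \<longlonglongrightarrow> (LINT x|lborel. F s x)"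
    if s: "0 \<le> s" "line_mass s < \<infinity>" for s
  proof -
    note i = integrable_F(1)[OF s]
    have "(\<lambda>n. LINT x|lborel. indicator {- X n..X n} x *\<^sub>R F s x) \<longlonglongrightarrow> (LINT x|lborel. F s x)"
    proof (rule integral_dominated_convergence[where w = "\<lambda>x. norm (F s x)"])
      show "AE x in lborel. (\<lambda>n. indicator {- X n..X n} x *\<^sub>R F s x) \<longlonglongrightarrow> F s x"
      proof (intro always_eventually allI)
        fix x
        have "eventually (\<lambda>n. \<bar>x\<bar> \<le> real n) sequentially"
          by (rule eventually_nat_real) (rule eventually_ge_at_top)
        then have "eventually (\<lambda>n. indicator {- X n..X n} x *\<^sub>R F s x = F s x) sequentially"
        proof eventually_elim
          case (elim n)
          then have "x \<in> {- X n..X n}" using X(1)[of n] by auto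
          then show ?case by simp
        qed
        then show "(\<lambda>n. indicator {- X n..X n} x *\<^sub>R F s x) \<longlonglongrightarrow> F s x"
          by (rule tendsto_eventually)
      qed
    qed (use i in \<open>auto simp: indicator_def\<close>)
    moreover have "(LINT x|lborel. indicator {- X n..X n} x *\<^sub>R F s x) = integral {- X n..X n} (F s)" for n
    proof -
      have "set_integrable lborel {- X n..X n} (F s)"
        unfolding set_integrable_def by (rule integrable_mult_indicator[OF _ i]) simp
      from set_borel_integral_eq_integral(2)[OF this] show ?thesis
        unfolding set_lebesgue_integral_def .
    qed
    ultimately show ?thesis by simp
  qed
  have "(\<lambda>n. integral {- X n..X n} (F t) - integral {- X n..X n} (F t')) \<longlonglongrightarrow> 0"
  proof (rule Lim_null_comparison[where g = "\<lambda>n. 1 / Suc n"])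
    show "eventually (\<lambda>n. norm (integral {- X n..X n} (F t) - integral {- X n..X n} (F t')) \<le> 1 / Suc n) sequentially"
    proof (intro always_eventually allI)
      fix n
      have "0 \<le> X n" using X(1)[of n] by (rule order_trans[rotated]) simp
      from order.strict_implies_order[OF order.strict_trans1[OF flux_bound[OF t(1,2) this] X(2)]]
      show "norm (integral {- X n..X n} (F t) - integral {- X n..X n} (F t')) \<le> 1 / Suc n"
        by simp
    qed
    show "(\<lambda>n. 1 / real (Suc n)) \<longlonglongrightarrow> 0"
      using LIMSEQ_inverse_real_of_nat by (simp add: inverse_eq_divide)
  qed
  moreover have "(\<lambda>n. integral {- X n..X n} (F t) - integral {- X n..X n} (F t'))
      \<longlonglongrightarrow> (LINT x|lborel. F t x) - (LINT x|lborel. F t' x)"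
    by (intro tendsto_diff lim t t')
  ultimately show ?thesis
    using LIMSEQ_unique by fastforce
qed

text \<open>The total flux is the same at all good heights, and it is small at suitable large heights.\<close>

lemma integral_F_eq_0:
  assumes fin: "strip_mass e < \<infinity>" and t: "0 \<le> t" "line_mass t < \<infinity>"
  shows "(LINT x|lborel. F t x) = 0"
proof (rule ccontr)
  define I where "I = \<bar>LINT x|lborel. F t x\<bar>"
  assume "\<not> ?thesis"
  then have I: "0 < I" by (simp add: I_def)
  have "\<exists>s\<in>{t..}. line_mass s < ennreal (I / 4)"
  proof (rule exists_small_value)
    have "(\<integral>\<^sup>+s. line_mass s * indicator {t..} s \<partial>lborel) \<le> (\<integral>\<^sup>+s. line_mass s * indicator {0..} s \<partial>lborel)"
      using t by (intro nn_integral_mono) (auto simp: indicator_def)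
    also have "\<dots> < \<infinity>" by (rule line_mass_finite[OF fin])
    finally show "(\<integral>\<^sup>+s. line_mass s * indicator {t..} s \<partial>lborel) < \<infinity>" .
  qed (use I in \<open>auto simp: emeasure_lborel_atLeast ennreal_mult_eq_top_iff\<close>)
  then obtain s where s: "t \<le> s" "line_mass s < ennreal (I / 4)" by auto
  then have fin_s: "line_mass s < \<infinity>" using order.strict_trans[OF s(2) ennreal_less_top] by simp
  have "ennreal I \<le> 2 * line_mass s"
    using integrable_F(2)[of s] integral_F_eq[OF fin t(1) s(1) t(2) fin_s] s t fin_s by (simp add: I_def)
  also have "\<dots> \<le> 2 * ennreal (I / 4)"
    using s by (intro mult_left_mono) auto
  also have "\<dots> = ennreal (I / 2)"
    using I by (simp add: ennreal_mult'[symmetric] flip: ennreal_numeral)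
  finally show False using I by simp
qed

text \<open>The flux density is at most \<open>3 \<bar>x\<bar>\<^bsup>2l\<^esup> u.sq - \<bar>x\<bar>\<^bsup>2l\<^esup> v.sq / 2\<close>, by the slope bound and
  \<open>2 \<bar>u v\<bar> \<le> 2 u\<^sup>2 + v\<^sup>2/2\<close>, and its integral vanishes. Finiteness of both sides, needed to subtract, is what
  restricts the statement to good heights \<open>t\<close>; these exist in every interval.\<close>

lemma graph_estimate:
  assumes fin: "strip_mass e < \<infinity>" and d: "0 < d"
  shows "\<exists>t. 0 < t \<and> t < d \<and> (\<integral>\<^sup>+x. ennreal (w x * v.sq (x, \<psi> x + t)) \<partial>lborel)
      \<le> 6 * (\<integral>\<^sup>+x. ennreal (w x * u.sq (x, \<psi> x + t)) \<partial>lborel)"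
proof -
  have "\<exists>t\<in>{0<..<d}. line_mass t < \<infinity>"
  proof (rule exists_small_value)
    have "(\<integral>\<^sup>+s. line_mass s * indicator {0<..<d} s \<partial>lborel) \<le> (\<integral>\<^sup>+s. line_mass s * indicator {0..} s \<partial>lborel)"
      by (intro nn_integral_mono) (auto simp: indicator_def)
    also have "\<dots> < \<infinity>" by (rule line_mass_finite[OF fin])
    finally show "(\<integral>\<^sup>+s. line_mass s * indicator {0<..<d} s \<partial>lborel) < \<infinity>" .
  qed (use d in \<open>auto simp: ennreal_mult_eq_top_iff\<close>)
  then obtain t where t: "0 < t" "t < d" "line_mass t < \<infinity>" by auto
  define u2 where "u2 x = w x * u.sq (x, \<psi> x + t)" for x
  define v2 where "v2 x = w x * v.sq (x, \<psi> x + t)" for x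
  have [measurable]: "u2 \<in> borel_measurable borel" "v2 \<in> borel_measurable borel"
    unfolding u2_def v2_def using t
    by (intro borel_measurable_continuous_onI continuous_on_mult cont_w cont_graph
        u.continuous_on_sq v.continuous_on_sq; simp)+
  have nn: "0 \<le> u2 x" "0 \<le> v2 x" for x
    by (simp_all add: u2_def v2_def w_nonneg u.sq_nonneg v.sq_nonneg)
  have sum: "u2 x + v2 x = w x * S (x, \<psi> x + t)" for x
    by (simp add: u2_def v2_def S_def distrib_left)
  have int: "integrable lborel u2" "integrable lborel v2"
  proof -
    have "(\<integral>\<^sup>+x. ennreal (norm (u2 x)) \<partial>lborel) \<le> line_mass t" "(\<integral>\<^sup>+x. ennreal (norm (v2 x)) \<partial>lborel) \<le> line_mass t"
      unfolding line_mass_def sum[symmetric] using nn by (auto intro!: nn_integral_mono ennreal_leI)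
    then show "integrable lborel u2" "integrable lborel v2"
      using t(3) by (auto intro!: integrableI_bounded intro: order.strict_trans1)
  qed
  have "0 = (LINT x|lborel. F t x)"
    using integral_F_eq_0[OF fin _ t(3)] t by simp
  also have "\<dots> \<le> (LINT x|lborel. 3 * u2 x - v2 x / 2)"
  proof (rule integral_mono)
    show "F t x \<le> 3 * u2 x - v2 x / 2" for x
      using F_le[of t x] by (simp add: u2_def v2_def)
  qed (use integrable_F(1)[OF _ t(3)] t int in auto)
  also have "\<dots> = 3 * (LINT x|lborel. u2 x) - (LINT x|lborel. v2 x) / 2"
    using int by simp
  finally have "(LINT x|lborel. v2 x) \<le> 6 * (LINT x|lborel. u2 x)" by simp
  then have "(\<integral>\<^sup>+x. ennreal (v2 x) \<partial>lborel) \<le> 6 * (\<integral>\<^sup>+x. ennreal (u2 x) \<partial>lborel)"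
    using nn int by (simp add: nn_integral_eq_integral ennreal_mult'[symmetric] flip: ennreal_numeral)
  then show ?thesis using t by (auto simp: u2_def v2_def)
qed

end

section \<open>The Dunkl system behind \<open>\<lambda>\<close>-analyticity\<close>

text \<open>Differentiate \<open>f (x, t) - f (x, c) = \<integral> fy\<close> under the integral sign in \<open>x\<close>, then in \<open>t\<close>.\<close>

lemma mixed_partials_eq:
  fixes f fx fy fxy fyx :: "real \<times> real \<Rightarrow> real"
  assumes dx: "\<And>x y. 0 < y \<Longrightarrow> ((\<lambda>s. f (s, y)) has_real_derivative fx (x, y)) (at x)"
    and dy: "\<And>x y. 0 < y \<Longrightarrow> ((\<lambda>t. f (x, t)) has_real_derivative fy (x, y)) (at y)"
    and dxy: "\<And>x y. 0 < y \<Longrightarrow> ((\<lambda>t. fx (x, t)) has_real_derivative fxy (x, y)) (at y)"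
    and dyx: "\<And>x y. 0 < y \<Longrightarrow> ((\<lambda>s. fy (s, y)) has_real_derivative fyx (x, y)) (at x)"
    and cont: "continuous_on upper_half_plane fyx"
    and y: "0 < y"
  shows "fxy (x, y) = fyx (x, y)"
proof -
  define c where "c = y / 2"
  have c: "0 < c" "c < y" using y by (auto simp: c_def)
  have ftc: "((\<lambda>r. fy (s, r)) has_integral f (s, t) - f (s, c)) {c..t}" if "c \<le> t" for s t
  proof (rule fundamental_theorem_of_calculus[OF that])
    fix r assume "r \<in> {c..t}"
    then have "0 < r" using c by auto
    from has_field_derivative_at_within[OF dy[OF this]]
    show "((\<lambda>t. f (s, t)) has_vector_derivative fy (s, r)) (at r within {c..t})"
      by (simp add: has_real_derivative_iff_has_vector_derivative)
  qed
  have eq: "integral {c..t} (\<lambda>r. fyx (x, r)) = fx (x, t) - fx (x, c)" if t: "c \<le> t" for t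
  proof -
    have "((\<lambda>s. integral (cbox c t) (\<lambda>r. fy (s, r))) has_real_derivative
        integral (cbox c t) (\<lambda>r. fyx (x, r))) (at x within UNIV)"
    proof (rule leibniz_rule_field_derivative[where U = UNIV and fx = "\<lambda>s r. fyx (s, r)"])
      show "continuous_on (UNIV \<times> cbox c t) (\<lambda>(s, r). fyx (s, r))"
        using c by (intro continuous_on_subset[OF cont, THEN continuous_on_eq]) (auto simp: upper_half_plane_def)
      show "(\<lambda>r. fy (s, r)) integrable_on cbox c t" for s
        using ftc[OF t] by (auto simp: integrable_on_def)
    qed (use c dyx in auto)
    then have "((\<lambda>s. f (s, t) - f (s, c)) has_real_derivative integral {c..t} (\<lambda>r. fyx (x, r))) (at x)"
      using integral_unique[OF ftc[OF t]] by simp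
    moreover have "((\<lambda>s. f (s, t) - f (s, c)) has_real_derivative fx (x, t) - fx (x, c)) (at x)"
      using c t by (intro DERIV_diff dx) auto
    ultimately show ?thesis by (rule DERIV_unique)
  qed
  have "continuous_on {c..2 * y} (\<lambda>r. fyx (x, r))"
    by (rule continuous_on_compose2[OF cont]) (use c in \<open>auto intro!: continuous_intros simp: upper_half_plane_def\<close>)
  from integral_has_real_derivative[OF this, of y]
  have "((\<lambda>t. integral {c..t} (\<lambda>r. fyx (x, r))) has_real_derivative fyx (x, y)) (at y within {c..2 * y})"
    using c by simp
  then have "((\<lambda>t. integral {c..t} (\<lambda>r. fyx (x, r))) has_real_derivative fyx (x, y)) (at y)"
    using c by (simp add: at_within_Icc_at)
  then have "((\<lambda>t. fx (x, t) - fx (x, c)) has_real_derivative fyx (x, y)) (at y)"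
    by (rule has_field_derivative_transform_within_open[where S = "{c<..}"]) (use c eq in auto)
  moreover have "((\<lambda>t. fx (x, t) - fx (x, c)) has_real_derivative fxy (x, y) - 0) (at y)"
    by (intro DERIV_diff dxy y DERIV_const)
  ultimately show ?thesis using DERIV_unique by fastforce
qed

text \<open>Stated for a generic pair so that it applies to \<open>(u, v)\<close> and to \<open>(v, - u)\<close>; both mixed derivatives of \<open>q\<close>
  are the same function \<open>qxy\<close>.\<close>

lemma dunkl_laplace_of_cauchy_riemann:
  fixes p px py pxx pyy q qx qy qxy :: "real \<times> real \<Rightarrow> real"
  assumes cr: "\<And>x y. 0 < y \<Longrightarrow> x \<noteq> 0 \<Longrightarrow> px (x, y) + l / x * (p (x, y) - p (- x, y)) = qy (x, y)"
      "\<And>x y. 0 < y \<Longrightarrow> x \<noteq> 0 \<Longrightarrow> py (x, y) + (qx (x, y) + l / x * (q (x, y) - q (- x, y))) = 0"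
    and d: "\<And>x y. 0 < y \<Longrightarrow> ((\<lambda>s. p (s, y)) has_real_derivative px (x, y)) (at x)"
      "\<And>x y. 0 < y \<Longrightarrow> ((\<lambda>s. px (s, y)) has_real_derivative pxx (x, y)) (at x)"
      "\<And>x y. 0 < y \<Longrightarrow> ((\<lambda>t. py (x, t)) has_real_derivative pyy (x, y)) (at y)"
      "\<And>x y. 0 < y \<Longrightarrow> ((\<lambda>t. q (x, t)) has_real_derivative qy (x, y)) (at y)"
      "\<And>x y. 0 < y \<Longrightarrow> ((\<lambda>t. qx (x, t)) has_real_derivative qxy (x, y)) (at y)"
      "\<And>x y. 0 < y \<Longrightarrow> ((\<lambda>s. qy (s, y)) has_real_derivative qxy (x, y)) (at x)"
    and y: "0 < y" and x: "x \<noteq> 0"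
  shows "pxx (x, y) + pyy (x, y) + 2 * l / x * px (x, y) = l / x\<^sup>2 * (p (x, y) - p (- x, y))"
proof -
  define m where "m = l / x"
  have dinv: "((\<lambda>s. l / s) has_real_derivative - (l / x\<^sup>2)) (at x)"
    using x by (auto intro!: derivative_eq_intros simp: power2_eq_square)
  have dref: "((\<lambda>s. p (- s, y)) has_real_derivative - px (- x, y)) (at x)"
    using DERIV_mirror[of "\<lambda>s. p (s, y)" "px (- x, y)" x] d(1)[OF y, of "- x"] by simp
  have "((\<lambda>s. px (s, y) + l / s * (p (s, y) - p (- s, y))) has_real_derivative
      pxx (x, y) + (- (l / x\<^sup>2) * (p (x, y) - p (- x, y)) + (px (x, y) - - px (- x, y)) * (l / x))) (at x)"
    by (intro DERIV_add DERIV_mult DERIV_diff d y dinv dref)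
  then have "((\<lambda>s. qy (s, y)) has_real_derivative
      pxx (x, y) + (- (l / x\<^sup>2) * (p (x, y) - p (- x, y)) + (px (x, y) - - px (- x, y)) * (l / x))) (at x)"
    by (rule has_field_derivative_transform_within_open[where S = "- {0}"])
       (use x cr(1)[OF y] in auto)
  from DERIV_unique[OF this d(6)[OF y]]
  have 1: "pxx (x, y) = qxy (x, y) + l / x\<^sup>2 * (p (x, y) - p (- x, y)) - (px (x, y) + px (- x, y)) * m"
    by (simp add: m_def)
  have "((\<lambda>t. - (qx (x, t) + l / x * (q (x, t) - q (- x, t)))) has_real_derivative
      - (qxy (x, y) + l / x * (qy (x, y) - qy (- x, y)))) (at y)"
    by (intro DERIV_minus DERIV_add DERIV_cmult DERIV_diff d y)
  then have "((\<lambda>t. py (x, t)) has_real_derivative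
      - (qxy (x, y) + l / x * (qy (x, y) - qy (- x, y)))) (at y)"
  proof (rule has_field_derivative_transform_within_open[where S = "{0<..}"])
    fix t :: real assume "t \<in> {0<..}"
    then show "- (qx (x, t) + l / x * (q (x, t) - q (- x, t))) = py (x, t)"
      using cr(2)[OF _ x, of t] by (simp add: add_eq_0_iff)
  qed (use y in auto)
  from DERIV_unique[OF this d(3)[OF y]]
  have 2: "pyy (x, y) = - (qxy (x, y) + m * (qy (x, y) - qy (- x, y)))"
    by (simp add: m_def)
  have 3: "qy (x, y) = px (x, y) + m * (p (x, y) - p (- x, y))"
    "qy (- x, y) = px (- x, y) + m * (p (x, y) - p (- x, y))"
    using cr(1)[OF y x] cr(1)[OF y, of "- x"] x by (auto simp: m_def algebra_simps)
  have "pxx (x, y) + pyy (x, y) + 2 * m * px (x, y) = l / x\<^sup>2 * (p (x, y) - p (- x, y))"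
    unfolding 1 2 3 by (simp add: algebra_simps)
  then show ?thesis by (simp add: m_def)
qed

lemma C2_on_partials:
  fixes f :: "real \<times> real \<Rightarrow> real"
  assumes "C2_on f upper_half_plane"
  obtains fx fy fxx fyy fxy where "C2_half_plane f fx fy fxx fyy fxy"
proof -
  from assms obtain f' :: "real \<times> real \<Rightarrow> (real \<times> real) \<Rightarrow>\<^sub>L real"
    and f'' :: "real \<times> real \<Rightarrow> (real \<times> real) \<Rightarrow>\<^sub>L ((real \<times> real) \<Rightarrow>\<^sub>L real)"
    where d1: "\<And>z. z \<in> upper_half_plane \<Longrightarrow> (f has_derivative f' z) (at z)"
      and d2: "\<And>z. z \<in> upper_half_plane \<Longrightarrow> (f' has_derivative f'' z) (at z)"
      and cont: "continuous_on upper_half_plane f''"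
    unfolding C2_on_def by blast
  have H: "(x, y) \<in> upper_half_plane" if "0 < y" for x y :: real
    using that by (simp add: upper_half_plane_def)
  define D where "D i z = f' z i" for i z
  define DD where "DD i j z = f'' z i j" for i j z
  have split: "blinfun_apply T h = blinfun_apply T (1, 0) * fst h + blinfun_apply T (0, 1) * snd h"
    for T :: "(real \<times> real) \<Rightarrow>\<^sub>L real" and h
  proof -
    have "h = fst h *\<^sub>R (1, 0) + snd h *\<^sub>R (0, 1)" by (simp add: prod_eq_iff)
    then have "blinfun_apply T h = blinfun_apply T (fst h *\<^sub>R (1, 0) + snd h *\<^sub>R (0, 1))" by (rule arg_cong)
    also have "\<dots> = fst h * blinfun_apply T (1, 0) + snd h * blinfun_apply T (0, 1)"
      by (simp only: blinfun.add_right blinfun.scaleR_right real_scaleR_def)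
    finally show ?thesis by (simp only: mult.commute)
  qed
  have px: "((\<lambda>s. (s, y)) has_derivative (\<lambda>h. h *\<^sub>R (1, 0))) (at x)" for x y :: real
    by (auto intro!: derivative_eq_intros)
  have py: "((\<lambda>t. (x, t)) has_derivative (\<lambda>h. h *\<^sub>R (0, 1))) (at y)" for x y :: real
    by (auto intro!: derivative_eq_intros)
  have fD: "(f has_derivative (\<lambda>h. D (1, 0) (x, y) * fst h + D (0, 1) (x, y) * snd h)) (at (x, y))"
    if "0 < y" for x y
    using d1[OF H[OF that]] by (rule has_derivative_eq_rhs) (auto simp: D_def split[symmetric])
  have DDD: "(D j has_derivative (\<lambda>h. f'' z h j)) (at z)" if "z \<in> upper_half_plane" for j z
    unfolding D_def using bounded_linear.has_derivative[OF blinfun.bounded_linear_left d2[OF that]] .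
  have along_x: "((\<lambda>s. g (s, y)) has_real_derivative T (1, 0)) (at x)"
    if "(g has_derivative blinfun_apply T) (at (x, y))" for g x y and T :: "(real \<times> real) \<Rightarrow>\<^sub>L real"
    using has_derivative_compose[OF px that] unfolding has_field_derivative_def
    by (rule has_derivative_eq_rhs) (rule ext, simp only: blinfun.scaleR_right real_scaleR_def mult.commute)
  have along_y: "((\<lambda>t. g (x, t)) has_real_derivative T (0, 1)) (at y)"
    if "(g has_derivative blinfun_apply T) (at (x, y))" for g x y and T :: "(real \<times> real) \<Rightarrow>\<^sub>L real"
    using has_derivative_compose[OF py that] unfolding has_field_derivative_def
    by (rule has_derivative_eq_rhs) (rule ext, simp only: blinfun.scaleR_right real_scaleR_def mult.commute)
  have Dx: "((\<lambda>s. D j (s, y)) has_real_derivative DD (1, 0) j (x, y)) (at x)" if "0 < y" for j x y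
    using has_derivative_compose[OF px DDD[OF H[OF that]]] unfolding has_field_derivative_def
    by (rule has_derivative_eq_rhs)
       (rule ext, simp only: DD_def blinfun.scaleR_right blinfun.scaleR_left real_scaleR_def mult.commute)
  have Dy: "((\<lambda>t. D j (x, t)) has_real_derivative DD (0, 1) j (x, y)) (at y)" if "0 < y" for j x y
    using has_derivative_compose[OF py DDD[OF H[OF that]]] unfolding has_field_derivative_def
    by (rule has_derivative_eq_rhs)
       (rule ext, simp only: DD_def blinfun.scaleR_right blinfun.scaleR_left real_scaleR_def mult.commute)
  have contD: "continuous_on upper_half_plane (D j)" for j
    by (rule has_derivative_continuous_on) (rule has_derivative_at_withinI[OF DDD])
  have contDD: "continuous_on upper_half_plane (DD i j)" for i j
    unfolding DD_def
    by (intro bounded_linear.continuous_on[OF blinfun.bounded_linear_left] cont)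
  have fx: "((\<lambda>s. f (s, y)) has_real_derivative D (1, 0) (x, y)) (at x)" if "0 < y" for x y
    unfolding D_def by (rule along_x[OF d1[OF H[OF that]]])
  have fy: "((\<lambda>t. f (x, t)) has_real_derivative D (0, 1) (x, y)) (at y)" if "0 < y" for x y
    unfolding D_def by (rule along_y[OF d1[OF H[OF that]]])
  have mixed: "DD (0, 1) (1, 0) (x, y) = DD (1, 0) (0, 1) (x, y)" if "0 < y" for x y
    by (rule mixed_partials_eq[where f = f and fx = "D (1, 0)" and fy = "D (0, 1)"])
       (use fx fy Dx Dy contDD that in auto)
  have "C2_half_plane f (D (1, 0)) (D (0, 1)) (DD (1, 0) (1, 0)) (DD (0, 1) (0, 1)) (DD (1, 0) (0, 1))"
  proof
    show "((\<lambda>t. D (1, 0) (x, t)) has_real_derivative DD (1, 0) (0, 1) (x, y)) (at y)" if "0 < y" for x y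
      using Dy[OF that, of "(1, 0)" x] mixed[OF that] by simp
  qed (use fD fx fy Dx Dy contD contDD in auto)
  then show ?thesis by (rule that)
qed

lemma lambda_analytic_imp_dunkl_pair:
  assumes l: "0 < l" and F: "lambda_analytic l F"
  obtains ux uy uxx uyy uxy vx vy vxx vyy vxy
  where "dunkl_pair l (\<lambda>z. Re (F z)) ux uy uxx uyy uxy (\<lambda>z. Im (F z)) vx vy vxx vyy vxy"
proof -
  define u where "u z = Re (F z)" for z
  define v where "v z = Im (F z)" for z
  have C2: "C2_on u upper_half_plane" "C2_on v upper_half_plane"
    and eqs: "\<And>x y. 0 < y \<Longrightarrow> dunkl l (\<lambda>s. u (s, y)) x - deriv (\<lambda>t. v (x, t)) y = 0"
      "\<And>x y. 0 < y \<Longrightarrow> deriv (\<lambda>t. u (x, t)) y + dunkl l (\<lambda>s. v (s, y)) x = 0"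
    using F by (auto simp: lambda_analytic_def Let_def u_def[abs_def] v_def[abs_def] upper_half_plane_def)
  obtain ux uy uxx uyy uxy where "C2_half_plane u ux uy uxx uyy uxy"
    by (rule C2_on_partials[OF C2(1)])
  then interpret u: C2_half_plane u ux uy uxx uyy uxy .
  obtain vx vy vxx vyy vxy where "C2_half_plane v vx vy vxx vyy vxy"
    by (rule C2_on_partials[OF C2(2)])
  then interpret v: C2_half_plane v vx vy vxx vyy vxy .
  have cr1: "ux (x, y) + l / x * (u (x, y) - u (- x, y)) = vy (x, y)" if "0 < y" "x \<noteq> 0" for x y
    using eqs(1)[OF that(1), of x] that(2) DERIV_imp_deriv[OF u.has_dx[OF that(1)]] DERIV_imp_deriv[OF v.has_dy[OF that(1)]]
    by (simp add: dunkl_def)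
  have cr2: "uy (x, y) + (vx (x, y) + l / x * (v (x, y) - v (- x, y))) = 0" if "0 < y" "x \<noteq> 0" for x y
    using eqs(2)[OF that(1), of x] that(2) DERIV_imp_deriv[OF u.has_dy[OF that(1)]] DERIV_imp_deriv[OF v.has_dx[OF that(1)]]
    by (simp add: dunkl_def)
  have "dunkl_harmonic l u ux uy uxx uyy uxy"
  proof (unfold_locales, rule l)
    show "uxx (x, y) + uyy (x, y) + 2 * l / x * ux (x, y) = l / x\<^sup>2 * (u (x, y) - u (- x, y))"
      if "0 < y" "x \<noteq> 0" for x y
      by (rule dunkl_laplace_of_cauchy_riemann[where q = v and qx = vx and qy = vy and qxy = vxy and py = uy])
         (use cr1 cr2 u.has_dx u.has_dxx u.has_dyy v.has_dy v.has_dxy v.has_dyx that in auto)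
  qed
  moreover have "dunkl_harmonic l v vx vy vxx vyy vxy"
  proof (unfold_locales, rule l)
    show "vxx (x, y) + vyy (x, y) + 2 * l / x * vx (x, y) = l / x\<^sup>2 * (v (x, y) - v (- x, y))"
      if xy: "0 < y" "x \<noteq> 0" for x y
    proof (rule dunkl_laplace_of_cauchy_riemann[where q = "\<lambda>z. - u z" and qx = "\<lambda>z. - ux z"
          and qy = "\<lambda>z. - uy z" and qxy = "\<lambda>z. - uxy z" and py = vy])
      show "vx (x, y) + l / x * (v (x, y) - v (- x, y)) = - uy (x, y)" if "0 < y" "x \<noteq> 0" for x y
        using cr2[OF that] by linarith
      show "vy (x, y) + (- ux (x, y) + l / x * (- u (x, y) - - u (- x, y))) = 0" if "0 < y" "x \<noteq> 0" for x y
        using cr1[OF that] by (simp add: algebra_simps)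
    qed (use v.has_dx v.has_dxx v.has_dyy u.has_dy u.has_dxy u.has_dyx xy in \<open>auto intro!: DERIV_minus\<close>)
  qed
  ultimately have "dunkl_pair l u ux uy uxx uyy uxy v vx vy vxx vyy vxy"
    by (intro dunkl_pair.intro dunkl_pair_axioms.intro cr1 cr2)
  then show ?thesis unfolding u_def[abs_def] v_def[abs_def] by (rule that)
qed

section \<open>Estimates on the sublevel sets of the maximal function\<close>

lemma (in dunkl_harmonic) line_sq:
  assumes y: "0 < y"
  shows "(\<integral>\<^sup>+x. ennreal (\<bar>x\<bar> powr (2 * l) * sq (x, y)) \<partial>lborel)
    = 2 * (\<integral>\<^sup>+x. ennreal ((f (x, y))\<^sup>2 * \<bar>x\<bar> powr (2 * l)) \<partial>lborel)"
proof -
  note [measurable] = measurable_line[OF y]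
  let ?g = "\<lambda>x. ennreal ((f (x, y))\<^sup>2 * \<bar>x\<bar> powr (2 * l))"
  have g [measurable]: "?g \<in> borel_measurable borel" by measurable
  have "(\<integral>\<^sup>+x. ennreal (\<bar>x\<bar> powr (2 * l) * sq (x, y)) \<partial>lborel) = (\<integral>\<^sup>+x. ?g x + ?g (- x) \<partial>lborel)"
    by (intro nn_integral_cong) (simp add: sq_def algebra_simps ennreal_plus[symmetric] del: ennreal_plus)
  also have "\<dots> = (\<integral>\<^sup>+x. ?g x \<partial>lborel) + (\<integral>\<^sup>+x. ?g (- x) \<partial>lborel)"
    by (intro nn_integral_add) measurable
  also have "(\<integral>\<^sup>+x. ?g (- x) \<partial>lborel) = (\<integral>\<^sup>+x. ?g x \<partial>lborel)"
    by (rule nn_integral_reflect[OF g])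
  finally show ?thesis by (simp only: mult_2)
qed

lemma (in dunkl_harmonic) measurable_line_sq:
  assumes "0 < y"
  shows "(\<lambda>x. sq (x, y)) \<in> borel_measurable borel"
  by (rule borel_measurable_continuous_onI, rule continuous_on_compose2[OF continuous_on_sq])
     (use assms in \<open>auto intro!: continuous_intros simp: upper_half_plane_def\<close>)

text \<open>The Steklov average \<open>(2d)\<^bsup>-1\<^esup> \<integral> \<phi>\<close> over \<open>[x - d, x + d]\<close>, expressed by an antiderivative of \<open>\<phi>\<close>. By the mean
  value theorem it is a value of \<open>\<phi>\<close> at a point of that interval.\<close>

lemma smooth_approximation_of_Lipschitz:
  fixes \<phi> :: "real \<Rightarrow> real"
  assumes lip: "\<And>x y. \<bar>\<phi> x - \<phi> y\<bar> \<le> \<bar>x - y\<bar>" and d: "0 < d"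
  obtains \<psi> \<psi>' where "\<And>x. (\<psi> has_real_derivative \<psi>' x) (at x)" "continuous_on UNIV \<psi>'"
    "\<And>x. \<bar>\<psi>' x\<bar> \<le> 1" "\<And>x. \<bar>\<psi> x - \<phi> x\<bar> \<le> d"
proof -
  have cont: "isCont \<phi> x" for x
  proof -
    have "\<phi> \<midarrow>x\<rightarrow> \<phi> x"
      by (rule LIM_I) (use lip in \<open>auto intro!: exI[of _ "_::real"] intro: le_less_trans\<close>)
    then show ?thesis by (simp add: isCont_def)
  qed
  obtain G where "\<And>x. (G has_vector_derivative \<phi> x) (at x)"
    using einterval_antiderivative[of "-\<infinity>" \<infinity> \<phi>] cont by auto
  then have G: "(G has_real_derivative \<phi> x) (at x)" for x
    by (simp add: has_real_derivative_iff_has_vector_derivative)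
  define \<psi> where "\<psi> x = (G (x + d) - G (x - d)) / (2 * d)" for x
  define \<psi>' where "\<psi>' x = (\<phi> (x + d) - \<phi> (x - d)) / (2 * d)" for x
  show ?thesis
  proof (rule that)
    show "(\<psi> has_real_derivative \<psi>' x) (at x)" for x
    proof -
      have shift: "((\<lambda>x. G (x + c)) has_real_derivative \<phi> (x + c)) (at x)" for c
        using G[of "x + c"] by (simp only: DERIV_shift)
      from DERIV_cdivide[OF DERIV_diff[OF shift[of d] shift[of "- d"]], of "2 * d"]
      show ?thesis by (simp only: \<psi>_def[abs_def] \<psi>'_def add_uminus_conv_diff)
    qed
    have "continuous_on UNIV \<phi>" using cont by (simp add: continuous_at_imp_continuous_on)
    then have shift: "continuous_on UNIV (\<lambda>x. \<phi> (x + c))" for c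
      by (rule continuous_on_compose2) (auto intro!: continuous_intros)
    show "continuous_on UNIV \<psi>'"
      unfolding \<psi>'_def using d continuous_on_divide[OF continuous_on_diff[OF shift[of d] shift[of "- d"]], of "\<lambda>_. 2 * d"]
      by simp
    show "\<bar>\<psi>' x\<bar> \<le> 1" for x
      using lip[of "x + d" "x - d"] d by (simp add: \<psi>'_def abs_divide)
    show "\<bar>\<psi> x - \<phi> x\<bar> \<le> d" for x
    proof -
      obtain z where z: "x - d < z" "z < x + d" "G (x + d) - G (x - d) = (x + d - (x - d)) * \<phi> z"
        using MVT2[of "x - d" "x + d" G \<phi>] G d by auto
      then have "\<psi> x = \<phi> z" using d by (simp add: \<psi>_def)
      then show ?thesis using lip[of z x] z by linarith
    qed
  qed
qed

lemma nt_maximal_ge: "0 < y \<Longrightarrow> \<bar>s - x\<bar> < y \<Longrightarrow> ennreal \<bar>u (s, y)\<bar> \<le> nt_maximal u x"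
  unfolding nt_maximal_def by (rule SUP_upper2[of "(s, y)"]) (auto simp: upper_half_plane_def)

lemma open_nt_maximal_superlevel: "open {x. a < nt_maximal u x}"
proof -
  have "{x. a < nt_maximal u x}
      = (\<Union>z\<in>{z \<in> upper_half_plane. a < ennreal \<bar>u z\<bar>}. {x. \<bar>fst z - x\<bar> < snd z})"
    by (auto simp: nt_maximal_def less_SUP_iff) blast
  also have "open \<dots>"
    by (intro open_UN ballI open_Collect_less continuous_intros)
  finally show ?thesis .
qed

text \<open>The identities for \<open>A\<close> and \<open>B\<close> mix the values at \<open>x\<close> and \<open>- x\<close>, so the sets on which the maximal function
  is small have to be symmetric.\<close>

definition sym_maximal :: "(real \<times> real \<Rightarrow> real) \<Rightarrow> real \<Rightarrow> ennreal" where
  "sym_maximal u x = max (nt_maximal u x) (nt_maximal u (- x))"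

lemma open_sym_maximal_superlevel: "open {x. a < sym_maximal u x}"
proof -
  have "{x. a < sym_maximal u x} = {x. a < nt_maximal u x} \<union> uminus -` {x. a < nt_maximal u x}"
    by (auto simp: sym_maximal_def less_max_iff_disj)
  moreover have "open (uminus -` {x. a < nt_maximal u x})"
    by (rule open_vimage[OF open_nt_maximal_superlevel]) (intro continuous_intros)
  ultimately show ?thesis
    by (simp only: open_Un[OF open_nt_maximal_superlevel])
qed

lemma measurable_nt_maximal [measurable]: "nt_maximal u \<in> borel_measurable borel"
  by (rule borel_measurableI_greater) (simp add: open_nt_maximal_superlevel)

lemma measurable_sym_maximal [measurable]: "sym_maximal u \<in> borel_measurable borel"
  by (rule borel_measurableI_greater) (simp add: open_sym_maximal_superlevel)

context dunkl_pair
begin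

text \<open>The exponent of the decay of the line integrals of \<open>u\<^sup>2 + v\<^sup>2\<close> is below \<open>-1\<close>, because \<open>(2l + 1) (2 - p)/p\<close> is at
  least \<open>2l + 1\<close>.\<close>

lemma strip_mass_finite:
  assumes p: "0 < p" "p \<le> 1" and N: "0 \<le> N" and e: "0 < e"
    and Lp: "\<And>y. 0 < y \<Longrightarrow> (\<integral>\<^sup>+x. ennreal (\<bar>u (x, y)\<bar> powr p * \<bar>x\<bar> powr (2 * l)) \<partial>lborel) \<le> ennreal N"
      "\<And>y. 0 < y \<Longrightarrow> (\<integral>\<^sup>+x. ennreal (\<bar>v (x, y)\<bar> powr p * \<bar>x\<bar> powr (2 * l)) \<partial>lborel) \<le> ennreal N"
  shows "strip_mass e < \<infinity>"
proof -
  define \<gamma> where "\<gamma> = - (2 * l + 1) * ((2 - p) / p)"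
  have "1 < (2 * l + 1) * 1" using u.l_pos by simp
  also have "\<dots> \<le> (2 * l + 1) * ((2 - p) / p)"
    using u.l_pos p by (intro mult_left_mono) (auto simp: field_simps)
  finally have \<gamma>: "\<gamma> < -1" unfolding \<gamma>_def mult_minus_left by simp
  have p2: "p < 2" using p by simp
  obtain C where C: "0 \<le> C" "\<And>y. 0 < y \<Longrightarrow>
      (\<integral>\<^sup>+x. ennreal ((u (x, y))\<^sup>2 * \<bar>x\<bar> powr (2 * l)) \<partial>lborel) \<le> ennreal (C * y powr \<gamma>)"
    using u.line_square_decay[OF p(1) p2 N Lp(1)] unfolding \<gamma>_def by blast
  obtain C' where C': "0 \<le> C'" "\<And>y. 0 < y \<Longrightarrow>
      (\<integral>\<^sup>+x. ennreal ((v (x, y))\<^sup>2 * \<bar>x\<bar> powr (2 * l)) \<partial>lborel) \<le> ennreal (C' * y powr \<gamma>)"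
    using v.line_square_decay[OF p(1) p2 N Lp(2)] unfolding \<gamma>_def by blast
  have line: "(\<integral>\<^sup>+x. ennreal (\<bar>x\<bar> powr (2 * l) * (u.sq (x, y) + v.sq (x, y))) \<partial>lborel)
      \<le> ennreal (2 * C + 2 * C') * ennreal (y powr \<gamma>)" if y: "0 < y" for y
  proof -
    note [measurable] = u.measurable_line_sq[OF y] v.measurable_line_sq[OF y]
    have "(\<integral>\<^sup>+x. ennreal (\<bar>x\<bar> powr (2 * l) * (u.sq (x, y) + v.sq (x, y))) \<partial>lborel)
      = (\<integral>\<^sup>+x. ennreal (\<bar>x\<bar> powr (2 * l) * u.sq (x, y)) + ennreal (\<bar>x\<bar> powr (2 * l) * v.sq (x, y)) \<partial>lborel)"
      by (intro nn_integral_cong) (simp add: distrib_left u.sq_nonneg v.sq_nonneg)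
    also have "\<dots> = (\<integral>\<^sup>+x. ennreal (\<bar>x\<bar> powr (2 * l) * u.sq (x, y)) \<partial>lborel)
        + (\<integral>\<^sup>+x. ennreal (\<bar>x\<bar> powr (2 * l) * v.sq (x, y)) \<partial>lborel)"
      by (intro nn_integral_add) measurable
    also have "\<dots> \<le> 2 * ennreal (C * y powr \<gamma>) + 2 * ennreal (C' * y powr \<gamma>)"
      unfolding u.line_sq[OF y] v.line_sq[OF y] by (intro add_mono mult_left_mono C C' y) auto
    also have "\<dots> = ennreal (2 * C + 2 * C') * ennreal (y powr \<gamma>)"
      using C(1) C'(1) by (simp add: ennreal_mult'[symmetric] ennreal_plus[symmetric] distrib_right mult.assoc
          del: ennreal_plus flip: ennreal_numeral)
    finally show ?thesis .
  qed
  have "strip_mass e \<le> (\<integral>\<^sup>+y. ennreal (2 * C + 2 * C') * (ennreal (y powr \<gamma>) * indicator {e..} y) \<partial>lborel)"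
    unfolding strip_mass_def w_def
  proof (intro nn_integral_mono)
    fix y
    show "(\<integral>\<^sup>+x. ennreal (\<bar>x\<bar> powr (2 * l) * (u.sq (x, y) + v.sq (x, y))) \<partial>lborel) * indicator {e..} y
      \<le> ennreal (2 * C + 2 * C') * (ennreal (y powr \<gamma>) * indicator {e..} y)"
      using line[of y] e by (cases "y \<in> {e..}") auto
  qed
  also have "\<dots> = ennreal (2 * C + 2 * C') * (\<integral>\<^sup>+y. ennreal (y powr \<gamma>) * indicator {e..} y \<partial>lborel)"
    by (intro nn_integral_cmult) measurable
  also have "(\<integral>\<^sup>+y. ennreal (y powr \<gamma>) * indicator {e..} y \<partial>lborel) = ennreal (- (e powr (\<gamma> + 1)) / (\<gamma> + 1))"
    by (rule nn_integral_has_integral_lebesgue'[OF _ has_integral_powr_to_inf]) (use \<gamma> e in auto)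
  finally show ?thesis
    by (rule order.strict_trans1) (simp add: ennreal_mult_less_top)
qed

text \<open>Let \<open>K\<close> be the closed set where the maximal function is at most \<open>\<alpha>\<close>. Every point above the graph of the
  distance to \<open>K\<close> belongs to the cone over some point of \<open>K\<close>, hence \<open>\<bar>u\<bar> \<le> \<alpha>\<close> there; and \<open>\<bar>u (x, y)\<bar>\<close> never
  exceeds the maximal function at \<open>x\<close>. The comparison of \<open>v\<close> with \<open>u\<close> on smooth graphs slightly above
  this one bounds the integral of \<open>v\<^sup>2\<close> along them. Over \<open>K\<close> these graphs tend to the line at height
  \<open>\<epsilon>\<close>, and Fatou's lemma applies. The right-hand side counts \<open>\<alpha>\<^sup>2\<close> off \<open>K\<close> and the square of the maximal
  function on \<open>K\<close>.\<close>

lemma sublevel_estimate: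
  assumes strip: "\<And>e. 0 < e \<Longrightarrow> strip_mass e < \<infinity>"
    and \<epsilon>: "0 < \<epsilon>" and \<alpha>: "0 < \<alpha>"
  shows "(\<integral>\<^sup>+x. ennreal (\<bar>x\<bar> powr (2 * l) * v.sq (x, \<epsilon>)) * indicator {x. sym_maximal u x \<le> ennreal \<alpha>} x \<partial>lborel)
    \<le> 12 * (\<integral>\<^sup>+x. (min (sym_maximal u x) (ennreal \<alpha>))\<^sup>2 * ennreal (\<bar>x\<bar> powr (2 * l)) \<partial>lborel)"
    (is "?L \<le> 12 * ?R")
proof (cases "{x. sym_maximal u x \<le> ennreal \<alpha>} = {}")
  case True
  then show ?thesis by simp
next
  case False
  define K where "K = {x. sym_maximal u x \<le> ennreal \<alpha>}"
  have "K = - {x. ennreal \<alpha> < sym_maximal u x}" by (auto simp: K_def)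
  then have K: "closed K" "K \<noteq> {}" using open_sym_maximal_superlevel False by (auto simp: K_def)
  have [measurable]: "K \<in> sets borel" using K by simp
  have u_le: "ennreal (u.sq (x, y)) \<le> 2 * (min (sym_maximal u x) (ennreal \<alpha>))\<^sup>2"
    if y: "infdist x K < y" for x y
  proof -
    obtain x' where x': "x' \<in> K" "infdist x K = dist x x'"
      using infdist_attains_inf[OF K] by blast
    have y0: "0 < y" using y infdist_nonneg[of x K] by linarith
    have xx': "\<bar>x - x'\<bar> < y" using x' y by (simp add: dist_real_def)
    have "ennreal \<bar>u (x, y)\<bar> \<le> nt_maximal u x" "ennreal \<bar>u (- x, y)\<bar> \<le> nt_maximal u (- x)"
      using y0 by (auto intro!: nt_maximal_ge)
    moreover have "ennreal \<bar>u (x, y)\<bar> \<le> nt_maximal u x'" "ennreal \<bar>u (- x, y)\<bar> \<le> nt_maximal u (- x')"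
      using y0 xx' by (auto intro!: nt_maximal_ge)
    moreover have "nt_maximal u x' \<le> ennreal \<alpha>" "nt_maximal u (- x') \<le> ennreal \<alpha>"
      using x'(1) by (auto simp: K_def sym_maximal_def)
    ultimately have le: "ennreal \<bar>u (x, y)\<bar> \<le> min (sym_maximal u x) (ennreal \<alpha>)"
      "ennreal \<bar>u (- x, y)\<bar> \<le> min (sym_maximal u x) (ennreal \<alpha>)"
      by (auto simp: sym_maximal_def le_max_iff_disj intro: order_trans)
    have "ennreal (u.sq (x, y)) = (ennreal \<bar>u (x, y)\<bar>)\<^sup>2 + (ennreal \<bar>u (- x, y)\<bar>)\<^sup>2"
      by (simp add: u.sq_def ennreal_power)
    also have "\<dots> \<le> (min (sym_maximal u x) (ennreal \<alpha>))\<^sup>2 + (min (sym_maximal u x) (ennreal \<alpha>))\<^sup>2"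
      by (intro add_mono power_mono le) auto
    finally show ?thesis by (simp add: mult_2)
  qed
  have step: "\<exists>\<eta>. continuous_on UNIV \<eta> \<and> (\<forall>x\<in>K. \<bar>\<eta> x - \<epsilon>\<bar> \<le> 2 * d) \<and> (\<forall>x. 0 < \<eta> x) \<and>
      (\<integral>\<^sup>+x. ennreal (\<bar>x\<bar> powr (2 * l) * v.sq (x, \<eta> x)) \<partial>lborel) \<le> 12 * ?R"
    if d: "0 < d" "d < \<epsilon>" for d
  proof -
    have "\<bar>infdist x K - infdist y K\<bar> \<le> \<bar>x - y\<bar>" for x y
      using infdist_triangle_abs[of x K y] by (simp add: dist_real_def)
    from smooth_approximation_of_Lipschitz[OF this d(1)] obtain \<psi> \<psi>' where
      \<psi>: "\<And>x. (\<psi> has_real_derivative \<psi>' x) (at x)" "continuous_on UNIV \<psi>'"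
        "\<And>x. \<bar>\<psi>' x\<bar> \<le> 1" "\<And>x. \<bar>\<psi> x - infdist x K\<bar> \<le> d" by blast
    \<comment> \<open>The translation by \<open>\<epsilon> > d\<close> compensates the error of the smoothing, so the graph lies above the distance function.\<close>
    interpret g: dunkl_graph l u ux uy uxx uyy uxy v vx vy vxx vyy vxy "\<lambda>x. \<psi> x + \<epsilon>" \<psi>' "\<epsilon> - d"
    proof
      show "\<epsilon> - d \<le> \<psi> x + \<epsilon>" for x
        using \<psi>(4)[of x] infdist_nonneg[of x K] by linarith
      show "((\<lambda>x. \<psi> x + \<epsilon>) has_real_derivative \<psi>' x) (at x)" for x
        using DERIV_add[OF \<psi>(1)[of x] DERIV_const[of \<epsilon>]] by simp
    qed (use \<psi> d in auto)
    have "strip_mass (\<epsilon> - d) < \<infinity>" by (rule strip) (use d in simp)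
    from g.graph_estimate[OF this d(1)] obtain t where t: "0 < t" "t < d"
      and est: "(\<integral>\<^sup>+x. ennreal (\<bar>x\<bar> powr (2 * l) * v.sq (x, \<psi> x + \<epsilon> + t)) \<partial>lborel)
        \<le> 6 * (\<integral>\<^sup>+x. ennreal (\<bar>x\<bar> powr (2 * l) * u.sq (x, \<psi> x + \<epsilon> + t)) \<partial>lborel)"
      unfolding w_def by blast
    have above: "infdist x K < \<psi> x + \<epsilon> + t" for x
      using \<psi>(4)[of x] d t by linarith
    have "(\<integral>\<^sup>+x. ennreal (\<bar>x\<bar> powr (2 * l) * u.sq (x, \<psi> x + \<epsilon> + t)) \<partial>lborel)
      \<le> (\<integral>\<^sup>+x. 2 * ((min (sym_maximal u x) (ennreal \<alpha>))\<^sup>2 * ennreal (\<bar>x\<bar> powr (2 * l))) \<partial>lborel)"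
    proof (intro nn_integral_mono)
      fix x
      have "ennreal (\<bar>x\<bar> powr (2 * l) * u.sq (x, \<psi> x + \<epsilon> + t))
          = ennreal (u.sq (x, \<psi> x + \<epsilon> + t)) * ennreal (\<bar>x\<bar> powr (2 * l))"
        by (simp add: ennreal_mult'[symmetric] ennreal_mult''[symmetric] u.sq_nonneg mult.commute)
      also have "\<dots> \<le> 2 * (min (sym_maximal u x) (ennreal \<alpha>))\<^sup>2 * ennreal (\<bar>x\<bar> powr (2 * l))"
        by (intro mult_right_mono u_le above) simp
      finally show "ennreal (\<bar>x\<bar> powr (2 * l) * u.sq (x, \<psi> x + \<epsilon> + t))
        \<le> 2 * ((min (sym_maximal u x) (ennreal \<alpha>))\<^sup>2 * ennreal (\<bar>x\<bar> powr (2 * l)))"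
        by (simp add: mult.assoc)
    qed
    also have "\<dots> = 2 * ?R"
      by (intro nn_integral_cmult) measurable
    finally have "6 * (\<integral>\<^sup>+x. ennreal (\<bar>x\<bar> powr (2 * l) * u.sq (x, \<psi> x + \<epsilon> + t)) \<partial>lborel) \<le> 6 * (2 * ?R)"
      by (intro mult_left_mono) auto
    also have "\<dots> = 12 * ?R" by (simp add: mult.assoc[symmetric])
    finally have "(\<integral>\<^sup>+x. ennreal (\<bar>x\<bar> powr (2 * l) * v.sq (x, \<psi> x + \<epsilon> + t)) \<partial>lborel) \<le> 12 * ?R"
      using est by (rule order_trans[rotated])
    moreover have "continuous_on UNIV (\<lambda>x. \<psi> x + \<epsilon> + t)"
      by (intro continuous_on_add g.cont_\<psi> continuous_on_const)
    moreover have "\<bar>\<psi> x + \<epsilon> + t - \<epsilon>\<bar> \<le> 2 * d" if "x \<in> K" for x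
      using \<psi>(4)[of x] that t by simp
    moreover have "0 < \<psi> x + \<epsilon> + t" for x
      using above[of x] infdist_nonneg[of x K] by linarith
    ultimately show ?thesis by (intro exI[of _ "\<lambda>x. \<psi> x + \<epsilon> + t"]) auto
  qed
  define d where "d n = \<epsilon> / real (n + 2)" for n
  have d: "0 < d n" "d n < \<epsilon>" for n using \<epsilon> by (auto simp: d_def field_simps intro!: add_pos_nonneg)
  have d0: "d \<longlonglongrightarrow> 0" unfolding d_def
    using LIMSEQ_ignore_initial_segment[OF lim_const_over_n[of \<epsilon>], of 2] by simp
  obtain \<eta> where \<eta>: "\<And>n. continuous_on UNIV (\<eta> n)" "\<And>n x. x \<in> K \<Longrightarrow> \<bar>\<eta> n x - \<epsilon>\<bar> \<le> 2 * d n" "\<And>n x. 0 < \<eta> n x"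
    "\<And>n. (\<integral>\<^sup>+x. ennreal (\<bar>x\<bar> powr (2 * l) * v.sq (x, \<eta> n x)) \<partial>lborel) \<le> 12 * ?R"
  proof -
    have "\<forall>n. \<exists>\<eta>. continuous_on UNIV \<eta> \<and> (\<forall>x\<in>K. \<bar>\<eta> x - \<epsilon>\<bar> \<le> 2 * d n) \<and> (\<forall>x. 0 < \<eta> x) \<and>
      (\<integral>\<^sup>+x. ennreal (\<bar>x\<bar> powr (2 * l) * v.sq (x, \<eta> x)) \<partial>lborel) \<le> 12 * ?R"
      by (intro allI step d)
    from choice[OF this] obtain \<eta> where \<eta>: "\<forall>n. continuous_on UNIV (\<eta> n) \<and>
      (\<forall>x\<in>K. \<bar>\<eta> n x - \<epsilon>\<bar> \<le> 2 * d n) \<and> (\<forall>x. 0 < \<eta> n x) \<and>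
      (\<integral>\<^sup>+x. ennreal (\<bar>x\<bar> powr (2 * l) * v.sq (x, \<eta> n x)) \<partial>lborel) \<le> 12 * ?R" ..
    show thesis by (rule that[of \<eta>]) (simp_all only: \<eta>)
  qed
  define h where "h n x = ennreal (\<bar>x\<bar> powr (2 * l) * v.sq (x, \<eta> n x)) * indicator K x" for n x
  have [measurable]: "h n \<in> borel_measurable borel" for n
  proof -
    have "continuous_on UNIV (\<lambda>x. v.sq (x, \<eta> n x))"
      by (rule cont_compose_half_plane[OF v.continuous_on_sq]) (auto intro!: continuous_intros \<eta>)
    then have [measurable]: "(\<lambda>x. v.sq (x, \<eta> n x)) \<in> borel_measurable borel"
      by (rule borel_measurable_continuous_onI)
    show ?thesis unfolding h_def by measurable
  qed
  have lim: "(\<lambda>n. h n x) \<longlonglongrightarrow> ennreal (\<bar>x\<bar> powr (2 * l) * v.sq (x, \<epsilon>)) * indicator K x" for x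
  proof (cases "x \<in> K")
    case True
    have "(\<lambda>n. \<eta> n x - \<epsilon>) \<longlonglongrightarrow> 0"
      by (rule Lim_null_comparison[of _ "\<lambda>n. 2 * d n"])
         (use \<eta>(2)[OF True] tendsto_mult_right_zero[OF d0] in auto)
    then have e: "(\<lambda>n. \<eta> n x) \<longlonglongrightarrow> \<epsilon>" by (simp add: LIM_zero_iff)
    have "isCont v.sq (x, \<epsilon>)"
      using has_derivative_continuous[OF v.has_deriv_sq[OF \<epsilon>]] .
    from isCont_tendsto_compose[OF this tendsto_Pair[OF tendsto_const e]]
    have "(\<lambda>n. v.sq (x, \<eta> n x)) \<longlonglongrightarrow> v.sq (x, \<epsilon>)" .
    then show ?thesis using True unfolding h_def by (auto intro!: tendsto_intros)
  qed (simp add: h_def)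
  have "?L = (\<integral>\<^sup>+x. liminf (\<lambda>n. h n x) \<partial>lborel)"
    unfolding K_def[symmetric]
    by (intro nn_integral_cong) (use lim_imp_Liminf[OF _ lim] in auto)
  also have "\<dots> \<le> liminf (\<lambda>n. \<integral>\<^sup>+x. h n x \<partial>lborel)"
    by (intro nn_integral_liminf) measurable
  also have "\<dots> \<le> liminf (\<lambda>n. 12 * ?R)"
  proof (intro Liminf_mono always_eventually allI)
    fix n
    have "(\<integral>\<^sup>+x. h n x \<partial>lborel) \<le> (\<integral>\<^sup>+x. ennreal (\<bar>x\<bar> powr (2 * l) * v.sq (x, \<eta> n x)) \<partial>lborel)"
      by (intro nn_integral_mono) (auto simp: h_def indicator_def)
    also note \<eta>(4)[of n]
    finally show "(\<integral>\<^sup>+x. h n x \<partial>lborel) \<le> 12 * ?R" .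
  qed
  also have "\<dots> = 12 * ?R" by (simp add: Liminf_const)
  finally show ?thesis .
qed

end

section \<open>Integration over the levels\<close>

lemma measurable_ennreal_powr [measurable]:
  assumes [measurable]: "f \<in> borel_measurable M"
  shows "(\<lambda>x. ennreal_powr (f x) r) \<in> borel_measurable M"
  unfolding ennreal_powr_def by measurable

lemma square_mult_powr:
  fixes a :: real
  assumes "0 < a"
  shows "a\<^sup>2 * a powr r = a powr (r + 2)"
  using assms by (simp add: powr_add powr_numeral mult.commute)

lemma ennreal_powr_ennreal: "0 \<le> a \<Longrightarrow> ennreal_powr (ennreal a) r = ennreal (a powr r)"
  by (simp add: ennreal_powr_def)

lemma ennreal_powr_mono:
  assumes "a \<le> b" "0 \<le> r"
  shows "ennreal_powr a r \<le> ennreal_powr b r"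
proof (cases b)
  case (real b')
  with assms(1) obtain a' where "a = ennreal a'" "0 \<le> a'" by (cases a) (auto simp: top_unique)
  then show ?thesis using real assms by (auto simp: ennreal_powr_ennreal intro!: ennreal_leI powr_mono2)
qed (simp add: ennreal_powr_def)

lemma ennreal_powr_cmult:
  assumes "0 < c"
  shows "ennreal_powr (ennreal c * a) r = ennreal (c powr r) * ennreal_powr a r"
proof (cases a)
  case (real a')
  then show ?thesis using assms by (simp add: ennreal_mult'[symmetric] ennreal_powr_ennreal powr_mult)
next
  case top
  then show ?thesis using assms by (simp add: ennreal_powr_def ennreal_mult_top)
qed

lemma nn_integral_powr_tail:
  assumes "0 < (a :: real)" "p < 2"
  shows "(\<integral>\<^sup>+\<alpha>. ennreal (\<alpha> powr (p - 3)) * indicator {a..} \<alpha> \<partial>lborel) = ennreal (a powr (p - 2) / (2 - p))"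
proof -
  have "p - 3 < -1" using assms by simp
  moreover have "- (a powr (p - 3 + 1)) / (p - 3 + 1) = a powr (p - 2) / (2 - p)"
    using assms by (simp add: field_simps)
  ultimately show ?thesis
    using nn_integral_has_integral_lebesgue'[OF _ has_integral_powr_to_inf[of "p - 3" a]] assms by simp
qed

text \<open>If \<open>a \<le> m\<close> the first term suffices; otherwise \<open>\<integral>\<close> of \<open>\<alpha>\<^bsup>p-3\<^esup>\<close> over \<open>\<alpha> \<ge> a\<close> is \<open>a\<^bsup>p-2\<^esup> / (2 - p)\<close>. Applied with \<open>a = \<bar>v\<bar>\<close>, this
  passes from the \<open>L\<^sup>2\<close> bounds on sublevel sets to \<open>L\<^sup>p\<close>; here \<open>p < 2\<close> is essential.\<close>

lemma powr_le_level_integral: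
  assumes p: "0 < p" "p < 2" and a: "0 \<le> a"
  shows "ennreal (a powr p) \<le> ennreal_powr m p
    + ennreal ((2 - p) * a\<^sup>2) * (\<integral>\<^sup>+\<alpha>. (if 0 < \<alpha> \<and> m \<le> ennreal \<alpha> then ennreal (\<alpha> powr (p - 3)) else 0) \<partial>lborel)"
    (is "_ \<le> _ + _ * ?L")
proof (cases "ennreal a \<le> m")
  case True
  then have "ennreal (a powr p) \<le> ennreal_powr m p"
    using ennreal_powr_mono[of "ennreal a" m p] a p by (simp add: ennreal_powr_ennreal)
  then show ?thesis by (rule order_trans) simp
next
  case False
  then have m: "m \<le> ennreal a" by simp
  have a0: "0 < a" using False a by (cases "a = 0") auto
  have "ennreal (a powr (p - 2) / (2 - p)) = (\<integral>\<^sup>+\<alpha>. ennreal (\<alpha> powr (p - 3)) * indicator {a..} \<alpha> \<partial>lborel)"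
    by (rule nn_integral_powr_tail[OF a0 p(2), symmetric])
  also have "\<dots> \<le> ?L"
    using a0 by (intro nn_integral_mono) (auto simp: indicator_def intro: order_trans[OF m] ennreal_leI)
  finally have "ennreal ((2 - p) * a\<^sup>2) * ennreal (a powr (p - 2) / (2 - p))
    \<le> ennreal ((2 - p) * a\<^sup>2) * ?L"
    by (rule mult_left_mono) simp
  moreover have "ennreal ((2 - p) * a\<^sup>2) * ennreal (a powr (p - 2) / (2 - p)) = ennreal (a powr p)"
  proof -
    have "a\<^sup>2 * a powr (p - 2) = a powr p"
      using square_mult_powr[OF a0, of "p - 2"] by simp
    then have "(2 - p) * a\<^sup>2 * (a powr (p - 2) / (2 - p)) = a powr p"
      using p by simp
    then show ?thesis using p by (subst ennreal_mult'[symmetric]) auto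
  qed
  ultimately have "ennreal (a powr p) \<le> ennreal ((2 - p) * a\<^sup>2) *
      ?L" by simp
  then show ?thesis by (rule order_trans) simp
qed

lemma level_integral_min_square_le:
  assumes p: "0 < p" "p < 2"
  shows "(\<integral>\<^sup>+\<alpha>. (if 0 < \<alpha> then ennreal (\<alpha> powr (p - 3)) * (min m (ennreal \<alpha>))\<^sup>2 else 0) \<partial>lborel)
    \<le> ennreal (1 / p + 1 / (2 - p)) * ennreal_powr m p"
proof (cases m)
  case top
  have "0 < 1 / p + 1 / (2 - p)" using p by (intro add_pos_pos) auto
  then show ?thesis using top by (simp add: ennreal_powr_def ennreal_mult_top)
next
  case (real r)
  show ?thesis
  proof (cases "r = 0")
    case True
    have "(if 0 < \<alpha> then ennreal (\<alpha> powr (p - 3)) * (min m (ennreal \<alpha>))\<^sup>2 else 0) = 0" for \<alpha>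
      using real True by (simp add: min_def)
    then show ?thesis by simp
  next
    case False
    with real have r: "0 < r" by simp
    have e: "p - 1 > -1" using p by auto
    have low: "(\<integral>\<^sup>+\<alpha>. ennreal (\<alpha> powr (p - 1)) * indicator {0..r} \<alpha> \<partial>lborel) = ennreal (r powr p / p)"
      using nn_integral_has_integral_lebesgue'[OF _ has_integral_powr_from_0[OF e, of r]] r by simp
    note high = nn_integral_powr_tail[OF r p(2)]
    have "(\<integral>\<^sup>+\<alpha>. (if 0 < \<alpha> then ennreal (\<alpha> powr (p - 3)) * (min m (ennreal \<alpha>))\<^sup>2 else 0) \<partial>lborel)
      \<le> (\<integral>\<^sup>+\<alpha>. ennreal (\<alpha> powr (p - 1)) * indicator {0..r} \<alpha>
          + ennreal (r\<^sup>2) * (ennreal (\<alpha> powr (p - 3)) * indicator {r..} \<alpha>) \<partial>lborel)"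
    proof (intro nn_integral_mono)
      fix \<alpha> :: real
      show "(if 0 < \<alpha> then ennreal (\<alpha> powr (p - 3)) * (min m (ennreal \<alpha>))\<^sup>2 else 0)
        \<le> ennreal (\<alpha> powr (p - 1)) * indicator {0..r} \<alpha>
          + ennreal (r\<^sup>2) * (ennreal (\<alpha> powr (p - 3)) * indicator {r..} \<alpha>)"
      proof (cases "0 < \<alpha>")
        case a: True
        show ?thesis
        proof (cases "\<alpha> \<le> r")
          case True
          have "\<alpha> powr (p - 3) * \<alpha>\<^sup>2 = \<alpha> powr (p - 1)"
            using square_mult_powr[OF a, of "p - 3"] by (simp add: mult.commute)
          moreover have "min m (ennreal \<alpha>) = ennreal \<alpha>" using True real by (simp add: min_absorb2 ennreal_leI)
          ultimately have "ennreal (\<alpha> powr (p - 3)) * (min m (ennreal \<alpha>))\<^sup>2 = ennreal (\<alpha> powr (p - 1))"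
            using a by (simp add: ennreal_power ennreal_mult'[symmetric])
          then show ?thesis using a True by simp
        next
          case False
          then have "min m (ennreal \<alpha>) = ennreal r" using real by (simp add: min_absorb1 ennreal_leI)
          then show ?thesis using a False r by (simp add: ennreal_power mult.commute)
        qed
      qed simp
    qed
    also have "\<dots> = ennreal (r powr p / p) + ennreal (r\<^sup>2) * ennreal (r powr (p - 2) / (2 - p))"
      by (subst nn_integral_add, measurable) (subst nn_integral_cmult, auto simp: low high)
    also have "ennreal (r\<^sup>2) * ennreal (r powr (p - 2) / (2 - p)) = ennreal (r powr p / (2 - p))"
    proof -
      have "r\<^sup>2 * r powr (p - 2) = r powr p"
        using square_mult_powr[OF r, of "p - 2"] by simp
      then show ?thesis by (subst ennreal_mult'[symmetric]) (auto simp: times_divide_eq_right)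
    qed
    also have "ennreal (r powr p / p) + ennreal (r powr p / (2 - p)) = ennreal ((1 / p + 1 / (2 - p)) * r powr p)"
      using p by (subst ennreal_plus[symmetric]) (auto simp: distrib_right)
    also have "\<dots> = ennreal (1 / p + 1 / (2 - p)) * ennreal_powr m p"
      using p real by (simp add: ennreal_mult'[symmetric] ennreal_powr_ennreal del: ennreal_plus)
    finally show ?thesis .
  qed
qed

text \<open>Integrate the sublevel estimate against \<open>\<alpha>\<^bsup>p-3\<^esup> d\<alpha>\<close> and exchange the integrals on both sides.\<close>

lemma (in dunkl_pair) conjugate_estimate:
  assumes p: "0 < p" "p < 2"
    and strip: "\<And>e. 0 < e \<Longrightarrow> strip_mass e < \<infinity>"
    and y: "0 < y"
  shows "(\<integral>\<^sup>+x. ennreal (\<bar>v (x, y)\<bar> powr p) * ennreal (\<bar>x\<bar> powr (2 * l)) \<partial>lborel)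
    \<le> ennreal (1 + 12 * (2 - p) * (1 / p + 1 / (2 - p))) *
      (\<integral>\<^sup>+x. ennreal_powr (sym_maximal u x) p * ennreal (\<bar>x\<bar> powr (2 * l)) \<partial>lborel)"
proof -
  let ?W = "\<lambda>x. ennreal (\<bar>x\<bar> powr (2 * l))"
  let ?M = "sym_maximal u"
  let ?I = "\<integral>\<^sup>+x. ennreal_powr (?M x) p * ?W x \<partial>lborel"
  let ?k = "\<lambda>m \<alpha>. if 0 < \<alpha> \<and> m \<le> ennreal \<alpha> then ennreal (\<alpha> powr (p - 3)) else 0"
  let ?m = "\<lambda>x \<alpha>. if 0 < \<alpha> then ennreal (\<alpha> powr (p - 3)) * (min (?M x) (ennreal \<alpha>))\<^sup>2 else 0"
  let ?V = "\<lambda>x. ennreal ((2 - p) * (v (x, y))\<^sup>2) * ?W x"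
  note [measurable] = v.measurable_line[OF y]
  have "(\<integral>\<^sup>+x. ennreal (\<bar>v (x, y)\<bar> powr p) * ?W x \<partial>lborel)
    \<le> (\<integral>\<^sup>+x. ennreal_powr (?M x) p * ?W x + (\<integral>\<^sup>+\<alpha>. ?V x * ?k (?M x) \<alpha> \<partial>lborel) \<partial>lborel)"
  proof (intro nn_integral_mono)
    fix x
    have "ennreal (\<bar>v (x, y)\<bar> powr p) * ?W x
      \<le> (ennreal_powr (?M x) p + ennreal ((2 - p) * (v (x, y))\<^sup>2) * (\<integral>\<^sup>+\<alpha>. ?k (?M x) \<alpha> \<partial>lborel)) * ?W x"
      using powr_le_level_integral[OF p, of "\<bar>v (x, y)\<bar>" "?M x"] by (intro mult_right_mono) auto
    also have "\<dots> = ennreal_powr (?M x) p * ?W x + ?V x * (\<integral>\<^sup>+\<alpha>. ?k (?M x) \<alpha> \<partial>lborel)"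
      by (simp only: distrib_right) (simp only: mult_ac)
    also have "?V x * (\<integral>\<^sup>+\<alpha>. ?k (?M x) \<alpha> \<partial>lborel) = (\<integral>\<^sup>+\<alpha>. ?V x * ?k (?M x) \<alpha> \<partial>lborel)"
      by (intro nn_integral_cmult[symmetric]) measurable
    finally show "ennreal (\<bar>v (x, y)\<bar> powr p) * ?W x
      \<le> ennreal_powr (?M x) p * ?W x + (\<integral>\<^sup>+\<alpha>. ?V x * ?k (?M x) \<alpha> \<partial>lborel)" .
  qed
  also have "\<dots> = ?I + (\<integral>\<^sup>+x. \<integral>\<^sup>+\<alpha>. ?V x * ?k (?M x) \<alpha> \<partial>lborel \<partial>lborel)"
    by (intro nn_integral_add) measurable
  also have "(\<integral>\<^sup>+x. \<integral>\<^sup>+\<alpha>. ?V x * ?k (?M x) \<alpha> \<partial>lborel \<partial>lborel) = (\<integral>\<^sup>+\<alpha>. \<integral>\<^sup>+x. ?V x * ?k (?M x) \<alpha> \<partial>lborel \<partial>lborel)"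
    by (rule lborel_pair.Fubini'[symmetric]) measurable
  also have "\<dots> \<le> (\<integral>\<^sup>+\<alpha>. \<integral>\<^sup>+x. ennreal (12 * (2 - p)) *
      (?m x \<alpha> * ?W x) \<partial>lborel \<partial>lborel)"
  proof (rule nn_integral_mono)
    fix \<alpha> :: real
    show "(\<integral>\<^sup>+x. ?V x * ?k (?M x) \<alpha> \<partial>lborel) \<le> (\<integral>\<^sup>+x. ennreal (12 * (2 - p)) *
      (?m x \<alpha> * ?W x) \<partial>lborel)"
    proof (cases "0 < \<alpha>")
      case True
      let ?a = "ennreal (\<alpha> powr (p - 3))"
      note [measurable] = v.measurable_line_sq[OF y]
      have "(\<integral>\<^sup>+x. ?V x * ?k (?M x) \<alpha> \<partial>lborel)
        \<le> (\<integral>\<^sup>+x. (ennreal (2 - p) * ?a) * (ennreal (\<bar>x\<bar> powr (2 * l) * v.sq (x, y)) * indicator {x. ?M x \<le> ennreal \<alpha>} x) \<partial>lborel)"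
      proof (intro nn_integral_mono)
        fix x
        have "(2 - p) * (v (x, y))\<^sup>2 * \<bar>x\<bar> powr (2 * l) * \<alpha> powr (p - 3)
          \<le> (2 - p) * v.sq (x, y) * \<bar>x\<bar> powr (2 * l) * \<alpha> powr (p - 3)"
          using p by (intro mult_right_mono mult_left_mono) (auto simp: v.sq_def)
        then have "ennreal ((2 - p) * (v (x, y))\<^sup>2 * \<bar>x\<bar> powr (2 * l) * \<alpha> powr (p - 3))
          \<le> ennreal ((2 - p) * \<alpha> powr (p - 3) * (\<bar>x\<bar> powr (2 * l) * v.sq (x, y)))"
          by (intro ennreal_leI) (simp add: mult_ac)
        then show "?V x * ?k (?M x) \<alpha> \<le> (ennreal (2 - p) * ?a) *
            (ennreal (\<bar>x\<bar> powr (2 * l) * v.sq (x, y)) * indicator {x. ?M x \<le> ennreal \<alpha>} x)"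
          using p True by (auto simp: ennreal_mult'[symmetric] ennreal_mult''[symmetric] v.sq_nonneg)
      qed
      also have "\<dots> = (ennreal (2 - p) * ?a) *
          (\<integral>\<^sup>+x. ennreal (\<bar>x\<bar> powr (2 * l) * v.sq (x, y)) * indicator {x. ?M x \<le> ennreal \<alpha>} x \<partial>lborel)"
        by (intro nn_integral_cmult) measurable
      also have "\<dots> \<le> (ennreal (2 - p) * ?a) * (12 * (\<integral>\<^sup>+x. (min (?M x) (ennreal \<alpha>))\<^sup>2 * ?W x \<partial>lborel))"
        by (intro mult_left_mono sublevel_estimate strip y True) auto
      also have "\<dots> = (12 * ennreal (2 - p) * ?a) * (\<integral>\<^sup>+x. (min (?M x) (ennreal \<alpha>))\<^sup>2 * ?W x \<partial>lborel)"
        by (simp only: mult_ac)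
      also have "\<dots> = (\<integral>\<^sup>+x. (12 * ennreal (2 - p) * ?a) * ((min (?M x) (ennreal \<alpha>))\<^sup>2 * ?W x) \<partial>lborel)"
        by (intro nn_integral_cmult[symmetric]) measurable
      also have "\<dots> = (\<integral>\<^sup>+x. ennreal (12 * (2 - p)) *
        (?m x \<alpha> * ?W x) \<partial>lborel)"
      proof -
        have "ennreal (12 * (2 - p)) = 12 * ennreal (2 - p)" by (subst ennreal_mult') auto
        then show ?thesis using True by (intro nn_integral_cong) (simp only: if_True mult_ac)
      qed
      finally show ?thesis .
    qed simp
  qed
  also have "\<dots> = (\<integral>\<^sup>+x. \<integral>\<^sup>+\<alpha>. ennreal (12 * (2 - p)) *
      (?m x \<alpha> * ?W x) \<partial>lborel \<partial>lborel)"
    by (rule lborel_pair.Fubini') measurable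
  also have "\<dots> \<le> (\<integral>\<^sup>+x. ennreal (12 * (2 - p) * (1 / p + 1 / (2 - p))) * (ennreal_powr (?M x) p * ?W x) \<partial>lborel)"
  proof (intro nn_integral_mono)
    fix x
    have "(\<integral>\<^sup>+\<alpha>. ennreal (12 * (2 - p)) * (?m x \<alpha> * ?W x) \<partial>lborel) = ennreal (12 * (2 - p)) * ((\<integral>\<^sup>+\<alpha>. ?m x \<alpha> \<partial>lborel) * ?W x)"
      by (subst nn_integral_cmult, measurable) (subst nn_integral_multc, measurable)
    also have "\<dots> \<le> ennreal (12 * (2 - p)) * ((ennreal (1 / p + 1 / (2 - p)) * ennreal_powr (?M x) p) * ?W x)"
      by (intro mult_left_mono mult_right_mono level_integral_min_square_le p) auto
    also have "\<dots> = (ennreal (12 * (2 - p)) * ennreal (1 / p + 1 / (2 - p))) * (ennreal_powr (?M x) p * ?W x)"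
      by (simp only: mult_ac)
    also have "ennreal (12 * (2 - p)) * ennreal (1 / p + 1 / (2 - p)) = ennreal (12 * (2 - p) * (1 / p + 1 / (2 - p)))"
      using p by (intro ennreal_mult'[symmetric]) auto
    finally show "(\<integral>\<^sup>+\<alpha>. ennreal (12 * (2 - p)) * (?m x \<alpha> * ?W x) \<partial>lborel)
      \<le> ennreal (12 * (2 - p) * (1 / p + 1 / (2 - p))) * (ennreal_powr (?M x) p * ?W x)" .
  qed
  also have "\<dots> = ennreal (12 * (2 - p) * (1 / p + 1 / (2 - p))) * ?I"
    by (intro nn_integral_cmult) measurable
  also have "?I + ennreal (12 * (2 - p) * (1 / p + 1 / (2 - p))) * ?I
      = ennreal (1 + 12 * (2 - p) * (1 / p + 1 / (2 - p))) * ?I"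
  proof -
    have "0 \<le> 12 * (2 - p) * (1 / p + 1 / (2 - p))" using p by (intro mult_nonneg_nonneg add_nonneg_nonneg) auto
    then show ?thesis by (simp add: distrib_right)
  qed
  finally show ?thesis by (simp add: add_left_mono)
qed

lemma sym_maximal_integral_le:
  assumes p: "0 \<le> p"
  shows "(\<integral>\<^sup>+x. ennreal_powr (sym_maximal u x) p * ennreal (\<bar>x\<bar> powr a) \<partial>lborel)
    \<le> 2 * (\<integral>\<^sup>+x. ennreal_powr (nt_maximal u x) p * ennreal (\<bar>x\<bar> powr a) \<partial>lborel)"
proof -
  let ?g = "\<lambda>x. ennreal_powr (nt_maximal u x) p * ennreal (\<bar>x\<bar> powr a)"
  have g [measurable]: "?g \<in> borel_measurable borel" by measurable
  have "ennreal_powr (sym_maximal u x) p * ennreal (\<bar>x\<bar> powr a) \<le> ?g x + ?g (- x)" for x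
    by (auto simp: sym_maximal_def max_def)
  then have "(\<integral>\<^sup>+x. ennreal_powr (sym_maximal u x) p * ennreal (\<bar>x\<bar> powr a) \<partial>lborel) \<le> (\<integral>\<^sup>+x. ?g x + ?g (- x) \<partial>lborel)"
    by (intro nn_integral_mono)
  also have "\<dots> = (\<integral>\<^sup>+x. ?g x \<partial>lborel) + (\<integral>\<^sup>+x. ?g (- x) \<partial>lborel)"
    by (intro nn_integral_add) measurable
  also have "(\<integral>\<^sup>+x. ?g (- x) \<partial>lborel) = (\<integral>\<^sup>+x. ?g x \<partial>lborel)"
    by (rule nn_integral_reflect[OF g])
  finally show ?thesis by (simp only: mult_2)
qed

lemma c_const_pos: "0 < l \<Longrightarrow> 0 < c_const l"
  by (simp add: c_const_def Gamma_real_pos)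

lemma Hardy_line_integral_bound:
  assumes l: "0 < l" and p: "0 < p" and F: "Hardy_norm l p F < \<infinity>"
  obtains N where "0 \<le> N" "\<And>y. 0 < y \<Longrightarrow>
    (\<integral>\<^sup>+x. ennreal (cmod (F (x, y)) powr p * \<bar>x\<bar> powr (2 * l)) \<partial>lborel) \<le> ennreal N"
proof -
  obtain n where n: "Hardy_norm l p F = ennreal n" "0 \<le> n" using F by (cases "Hardy_norm l p F") auto
  show ?thesis
  proof (rule that)
    show "0 \<le> n powr p / c_const l" using c_const_pos[OF l] by simp
    fix y :: real assume y: "0 < y"
    let ?I = "\<integral>\<^sup>+x. ennreal (cmod (F (x, y)) powr p * \<bar>x\<bar> powr (2 * l)) \<partial>lborel"
    have "Lp_norm l p (\<lambda>x. ennreal (cmod (F (x, y)))) \<le> ennreal n"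
      unfolding n(1)[symmetric] Hardy_norm_def using y by (intro SUP_upper) simp
    then have le: "ennreal_powr (ennreal (c_const l) * ?I) (1 / p) \<le> ennreal n"
      by (simp add: Lp_norm_def ennreal_powr_ennreal ennreal_mult'[symmetric])
    have "ennreal (c_const l) * ?I \<noteq> \<infinity>"
    proof
      assume "ennreal (c_const l) * ?I = \<infinity>"
      with le show False by (simp add: ennreal_powr_def top_unique)
    qed
    then have "?I \<noteq> \<infinity>" using c_const_pos[OF l] by (auto simp: ennreal_mult_eq_top_iff)
    then obtain i where i: "?I = ennreal i" "0 \<le> i" by (cases ?I) auto
    have "(c_const l * i) powr (1 / p) \<le> n"
      using le i n(2) c_const_pos[OF l] by (simp add: ennreal_mult'[symmetric] ennreal_powr_ennreal)
    then have "((c_const l * i) powr (1 / p)) powr p \<le> n powr p"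
      using p by (intro powr_mono2) auto
    then have "c_const l * i \<le> n powr p"
      using p i(2) c_const_pos[OF l] by (simp add: powr_powr)
    then have "i \<le> n powr p / c_const l"
      using c_const_pos[OF l] by (simp add: field_simps)
    then show "?I \<le> ennreal (n powr p / c_const l)" unfolding i(1) by (rule ennreal_leI)
  qed
qed

theorem theorem3p6:
  fixes l p :: real
  assumes "l > 0" and "2 * l / (2 * l + 1) < p" and "p \<le> 1"
  shows "\<exists>c::real. c > 0 \<and>
    (\<forall>F \<in> Hardy l p.
       Hardy_norm l p F \<le> ennreal c * Lp_norm l p (nt_maximal (\<lambda>z. Re (F z))))"
proof -
  have "0 \<le> 2 * l / (2 * l + 1)" using assms(1) by simp
  then have p: "0 < p" "p < 2" "p \<le> 1" using assms by linarith+
  define C where "C = 1 + 12 * (2 - p) * (1 / p + 1 / (2 - p))"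
  have "0 \<le> 12 * (2 - p) * (1 / p + 1 / (2 - p))" using p by (intro mult_nonneg_nonneg add_nonneg_nonneg) auto
  then have C: "1 \<le> C" by (simp add: C_def)
  define c where "c = 4 * (1 + C)"
  have c: "0 < c" using C by (simp add: c_def)
  have "Hardy_norm l p F \<le> ennreal (c powr (1 / p)) * Lp_norm l p (nt_maximal (\<lambda>z. Re (F z)))"
    if F: "F \<in> Hardy l p" for F
  proof -
    from F have F': "lambda_analytic l F" "Hardy_norm l p F < \<infinity>" by (auto simp: Hardy_def)
    let ?u = "\<lambda>z. Re (F z)" and ?v = "\<lambda>z. Im (F z)"
    let ?W = "\<lambda>x. ennreal (\<bar>x\<bar> powr (2 * l))"
    obtain ux uy uxx uyy uxy vx vy vxx vyy vxy where "dunkl_pair l ?u ux uy uxx uyy uxy ?v vx vy vxx vyy vxy"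
      using lambda_analytic_imp_dunkl_pair[OF assms(1) F'(1)] .
    then interpret dunkl_pair l ?u ux uy uxx uyy uxy ?v vx vy vxx vyy vxy .
    obtain N where N: "0 \<le> N" "\<And>y. 0 < y \<Longrightarrow>
      (\<integral>\<^sup>+x. ennreal (cmod (F (x, y)) powr p * \<bar>x\<bar> powr (2 * l)) \<partial>lborel) \<le> ennreal N"
      using Hardy_line_integral_bound[OF assms(1) p(1) F'(2)] by blast
    have le_mod: "(\<integral>\<^sup>+x. ennreal (\<bar>g (x, y)\<bar> powr p * \<bar>x\<bar> powr (2 * l)) \<partial>lborel) \<le> ennreal N"
      if "0 < y" "\<And>z. \<bar>g z\<bar> \<le> cmod (F z)" for g :: "real \<times> real \<Rightarrow> real" and y
    proof -
      have "(\<integral>\<^sup>+x. ennreal (\<bar>g (x, y)\<bar> powr p * \<bar>x\<bar> powr (2 * l)) \<partial>lborel)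
        \<le> (\<integral>\<^sup>+x. ennreal (cmod (F (x, y)) powr p * \<bar>x\<bar> powr (2 * l)) \<partial>lborel)"
        using p that(2) by (intro nn_integral_mono ennreal_leI mult_right_mono powr_mono2) auto
      also note N(2)[OF that(1)]
      finally show ?thesis .
    qed
    define J where "J = (\<integral>\<^sup>+x. ennreal_powr (nt_maximal ?u x) p * ?W x \<partial>lborel)"
    have strip: "strip_mass e < \<infinity>" if "0 < e" for e
      by (rule strip_mass_finite[OF p(1,3) N(1) that]) (auto intro!: le_mod abs_Re_le_cmod abs_Im_le_cmod)
    have line: "(\<integral>\<^sup>+x. ennreal_powr (ennreal (cmod (F (x, y)))) p * ?W x \<partial>lborel) \<le> ennreal c * J"
      if y: "0 < y" for y
    proof -
      note [measurable] = u.measurable_line[OF y] v.measurable_line[OF y]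
      have "(\<integral>\<^sup>+x. ennreal_powr (ennreal (cmod (F (x, y)))) p * ?W x \<partial>lborel)
        \<le> (\<integral>\<^sup>+x. 2 * (ennreal (\<bar>?u (x, y)\<bar> powr p) * ?W x + ennreal (\<bar>?v (x, y)\<bar> powr p) * ?W x) \<partial>lborel)"
      proof (intro nn_integral_mono)
        fix x
        have "cmod (F (x, y)) powr p \<le> (\<bar>?u (x, y)\<bar> + \<bar>?v (x, y)\<bar>) powr p"
          using p by (intro powr_mono2 cmod_le) auto
        also have "\<dots> \<le> 2 * (\<bar>?u (x, y)\<bar> powr p + \<bar>?v (x, y)\<bar> powr p)"
          using p by (intro powr_add_le_double) auto
        finally have "ennreal (cmod (F (x, y)) powr p) \<le> 2 * (ennreal (\<bar>?u (x, y)\<bar> powr p) + ennreal (\<bar>?v (x, y)\<bar> powr p))"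
          by (simp add: ennreal_plus[symmetric] ennreal_mult''[symmetric] ennreal_leI flip: ennreal_numeral del: ennreal_plus)
        from mult_right_mono[OF this, of "?W x"]
        show "ennreal_powr (ennreal (cmod (F (x, y)))) p * ?W x
          \<le> 2 * (ennreal (\<bar>?u (x, y)\<bar> powr p) * ?W x + ennreal (\<bar>?v (x, y)\<bar> powr p) * ?W x)"
          by (simp add: ennreal_powr_ennreal distrib_right mult.assoc)
      qed
      also have "\<dots> = 2 * ((\<integral>\<^sup>+x. ennreal (\<bar>?u (x, y)\<bar> powr p) * ?W x \<partial>lborel)
          + (\<integral>\<^sup>+x. ennreal (\<bar>?v (x, y)\<bar> powr p) * ?W x \<partial>lborel))"
        by (subst nn_integral_cmult, measurable) (subst nn_integral_add, measurable)
      also have "\<dots> \<le> 2 * (J + ennreal C * (2 * J))"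
      proof (intro mult_left_mono add_mono)
        show "(\<integral>\<^sup>+x. ennreal (\<bar>?u (x, y)\<bar> powr p) * ?W x \<partial>lborel) \<le> J"
          unfolding J_def
        proof (intro nn_integral_mono mult_right_mono)
          fix x
          show "ennreal (\<bar>?u (x, y)\<bar> powr p) \<le> ennreal_powr (nt_maximal ?u x) p"
            using ennreal_powr_mono[OF nt_maximal_ge[OF y, of x x ?u], of p] y p by (simp add: ennreal_powr_ennreal)
        qed simp
        have "(\<integral>\<^sup>+x. ennreal (\<bar>?v (x, y)\<bar> powr p) * ?W x \<partial>lborel)
          \<le> ennreal C * (\<integral>\<^sup>+x. ennreal_powr (sym_maximal ?u x) p * ?W x \<partial>lborel)"
          unfolding C_def by (rule conjugate_estimate[OF p(1,2) strip y])
        also have "\<dots> \<le> ennreal C * (2 * J)"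
          unfolding J_def using p by (intro mult_left_mono sym_maximal_integral_le) auto
        finally show "(\<integral>\<^sup>+x. ennreal (\<bar>?v (x, y)\<bar> powr p) * ?W x \<partial>lborel) \<le> ennreal C * (2 * J)" .
      qed simp
      also have "\<dots> \<le> 2 * (2 * J + ennreal C * (2 * J))"
        by (intro mult_left_mono add_mono) (simp_all add: mult_2)
      also have "\<dots> = 4 * (1 + ennreal C) * J"
        by (simp add: distrib_left distrib_right mult_ac)
      also have "4 * (1 + ennreal C) = ennreal c"
      proof -
        have "4 * (1 + ennreal C) = ennreal 4 * ennreal (1 + C)" using C by simp
        also have "\<dots> = ennreal c" unfolding c_def using C by (intro ennreal_mult'[symmetric]) simp
        finally show ?thesis .
      qed
      finally show ?thesis .
    qed
    show ?thesis
      unfolding Hardy_norm_def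
    proof (rule SUP_least)
      fix y :: real assume "y \<in> {0<..}"
      then have y: "0 < y" by simp
      have "ennreal (c_const l) * (\<integral>\<^sup>+x. ennreal_powr (ennreal (cmod (F (x, y)))) p * ?W x \<partial>lborel)
        \<le> ennreal (c_const l) * (ennreal c * J)"
        by (intro mult_left_mono line y) simp
      also have "\<dots> = ennreal c * (ennreal (c_const l) * J)"
        by (simp only: mult_ac)
      finally have "Lp_norm l p (\<lambda>x. ennreal (cmod (F (x, y)))) \<le> ennreal_powr (ennreal c * (ennreal (c_const l) * J)) (1 / p)"
        unfolding Lp_norm_def using p by (intro ennreal_powr_mono) auto
      also have "\<dots> = ennreal (c powr (1 / p)) * Lp_norm l p (nt_maximal ?u)"
        unfolding Lp_norm_def J_def by (rule ennreal_powr_cmult[OF c])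
      finally show "Lp_norm l p (\<lambda>x. ennreal (cmod (F (x, y)))) \<le> ennreal (c powr (1 / p)) * Lp_norm l p (nt_maximal ?u)" .
    qed
  qed
  then show ?thesis
    using c by (intro exI[of _ "c powr (1 / p)"]) auto
qed

end
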